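(* (i) For a positive integer $d$, let the types $T_1,T_2,\dots,T_d$ be given, where $$T_i=A_1^{m_1^{(i)}}*A_2^{m_2^{(i)}}*\dots*A_n^{m_n^{(i)}},\quad i=1,2,\dots,j-1,j+1,\dots,d,$$ and $$T_j=B_\alpha*A_1^{m_1^{(j)}}*A_2^{m_2^{(j)}}*\dots*A_n^{m_n^{(j)}}$$ for some $\alpha\ge1$, and let $l,m_1,m_2,\dots,m_l,s_1,s_2,\dots,s_l$ be given non-negative integers with $$\operatorname{rk} T_1+\operatorname{rk} T_2+\dots+\operatorname{rk} T_d+s_1+s_2+\dots+s_l=n.$$ Then the number of factorisations $$c=\sigma_1\sigma_2\cdots \sigma_d\,\sigma_1^{(1)}\sigma_2^{(1)}\cdots \sigma_{m_1}^{(1)}\,\sigma_1^{(2)}\sigma_2^{(2)}\cdots \sigma_{m_2}^{(2)}\cdots\sigma_1^{(l)}\sigma_2^{(l)}\cdots \sigma_{m_l}^{(l)},$$ where $c$ is a Coxeter element in $W(B_n)$, such that the combinatorial type of $\sigma_i$ is $T_i$, $i=1,2,\dots,d$, and such that $$\ell_T( \sigma_1^{(i)})+\ell_T(\sigma_2^{(i)})+\cdots+\ell_T(\sigma_{m_i}^{(i)})=s_i,\quad i=1,2,\dots,l,$$ is given by $$n^{d-1}\binom {n-\operatorname{rk} T_j}{m_1^{(j)},m_2^{(j)},\dots,m_n^{(j)}}\Bigg(\prod_{\substack{i=1\\ i\ne j}}^{d}\frac {1} {n-\operatorname{rk} T_i}\binom {n-\operatorname{rk} T_i}{m_1^{(i)},m_2^{(i)},\dots,m_n^{(i)}}\Bigg)\binom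 {m_1n} {s_1}\binom {m_2n} {s_2}\cdots\binom {m_ln} {s_l}.$$ (ii) For a positive integer $d$, let the types $T_1,T_2,\dots,T_d$ be given, where $$T_i=A_1^{m_1^{(i)}}*A_2^{m_2^{(i)}}*\dots*A_n^{m_n^{(i)}},\quad i=1,2,\dots,d,$$ and let $l,m_1,m_2,\dots,m_l,s_1,s_2,\dots,s_l$ be given non-negative integers. Then the number of factorisations $$c=\sigma_1\sigma_2\cdots \sigma_d\,\sigma_1^{(1)}\cdots \sigma_{m_1}^{(1)}\,\sigma_1^{(2)}\cdots \sigma_{m_2}^{(2)}\cdots\sigma_1^{(l)}\cdots \sigma_{m_l}^{(l)},$$ where $c$ is a Coxeter element in $W(B_n)$, which satisfy $$\ell_T( \sigma_1^{(i)})+\ell_T(\sigma_2^{(i)})+\cdots+\ell_T(\sigma_{m_i}^{(i)})=s_i,\quad i=1,2,\dots,l,$$ plus the condition that the combinatorial type of $\sigma_i$ is $T_i$, $i=1,2,\dots,d$, is given by $$n^{d-1}(n-\operatorname{rk} T_1-\operatorname{rk} T_2-\dots-\operatorname{rk} T_d)\Bigg(\prod _{i=1} ^{d}\frac {1} {n-\operatorname{rk} T_i}\binom {n-\operatorname{rk} T_i}{m_1^{(i)},m_2^{(i)},\dots,m_n^{(i)}}\Bigg)\binom {m_1n} {s_1}\binom {m_2n} {s_2}\cdots\binom {m_ln} {s_l}.$$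
   Context: $W(B_n)$ is realised as the group of permutations $\pi$ of $\{1,\dots,n,\bar 1,\dots,\bar n\}$ with $\pi(\bar i)=\overline{\pi(i)}$ (where $\bar{\bar i}=i$); the Coxeter element is $c=(1,2,\dots,n,\bar1,\dots,\bar n)$. Every element decomposes uniquely (up to order) into "type $A$ cycles" $(a_1,\dots,a_k)(\bar a_1,\dots,\bar a_k)$ of length $k$, said to have combinatorial type $A_{k-1}$, and "type $B$ cycles" $(a_1,\dots,a_k,\bar a_1,\dots,\bar a_k)$ of length $k$, said to have combinatorial type $B_k$ (with $B_1$ distinguished from $A_1$); the combinatorial type of an element is the product of these. $\ell_T$ is the absolute length (minimal number of reflections in a product representation). The rank of a type is the rank of the corresponding root system ($\operatorname{rk} A_k=k$, $\operatorname{rk} B_k=k$, additive over $*$). The multinomial coefficient is $\binom {M}{m_1,\dots,m_r}=\frac {M!} {m_1!\cdots m_r!\,(M-m_1-\dots-m_r)!}$.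
   Formalization: In part (ii) the condition rk T_1+…+rk T_d+s_1+…+s_l=n, stated only in part (i), is also assumed; without it (ii) fails, e.g. d=1, l=0, T_1 trivial gives 0 factorisations while the formula gives 1. *)

theory Defs
  imports Complex_Main "HOL-Combinatorics.Combinatorics"
begin

text \<open>
  The barred letter \<open>i\<close> is encoded as the negative integer \<open>-i\<close>, so that the bar
  operation is \<^const>\<open>uminus\<close> and an element of \<open>W(B\<^sub>n)\<close> is a permutation of
  \<open>{-n,\<dots>,-1,1,\<dots>,n}\<close> commuting with negation (extended by the identity to all of \<open>int\<close>).
\<close>

definition letters :: "nat \<Rightarrow> int set" where
  "letters n = {i. i \<noteq> 0 \<and> \<bar>i\<bar> \<le> int n}"

definition W_B :: "nat \<Rightarrow> (int \<Rightarrow> int) set" where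
  "W_B n = {p. p permutes letters n \<and> (\<forall>i\<in>letters n. p (- i) = - p i)}"

text \<open>Products of permutations are compositions, the rightmost factor being applied first.\<close>

definition perm_prod :: "(int \<Rightarrow> int) list \<Rightarrow> int \<Rightarrow> int" where
  "perm_prod ps = foldr (\<circ>) ps id"

definition A_cycle :: "int list \<Rightarrow> int \<Rightarrow> int" where
  "A_cycle xs = cycle_of_list xs \<circ> cycle_of_list (map uminus xs)"

definition B_cycle :: "int list \<Rightarrow> int \<Rightarrow> int" where
  "B_cycle xs = cycle_of_list (xs @ map uminus xs)"

text \<open>
  The Coxeter elements are the conjugates of \<open>(1,2,\<dots>,n,-1,-2,\<dots>,-n)\<close>, which is one of them.
\<close>

definition coxeter_element :: "nat \<Rightarrow> (int \<Rightarrow> int) \<Rightarrow> bool" where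
  "coxeter_element n c \<longleftrightarrow> (\<exists>w\<in>W_B n. c = w \<circ> B_cycle [1..int n] \<circ> inv w)"

text \<open>
  The reflections: \<open>(i,j)(-i,-j)\<close> belongs to the root \<open>e\<^sub>i - e\<^sub>j\<close> (with \<open>e\<^sub>-\<^sub>i = - e\<^sub>i\<close>),
  and \<open>(i,-i)\<close> to the root \<open>e\<^sub>i\<close>.
\<close>

definition reflections :: "nat \<Rightarrow> (int \<Rightarrow> int) set" where
  "reflections n =
     {A_cycle [i, j] | i j. i \<in> letters n \<and> j \<in> letters n \<and> \<bar>i\<bar> \<noteq> \<bar>j\<bar>} \<union>
     {B_cycle [i] | i. i \<in> letters n}"

definition absolute_length :: "nat \<Rightarrow> (int \<Rightarrow> int) \<Rightarrow> nat" where
  "absolute_length n w =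
     (LEAST k. \<exists>ts. length ts = k \<and> set ts \<subseteq> reflections n \<and> w = perm_prod ts)"

text \<open>
  A type is the multiset of its irreducible components, so that \<open>+\<close> on multisets is the
  product \<open>*\<close> of types.
\<close>

datatype component = TypeA nat | TypeB nat

type_synonym cox_type = "component multiset"

fun component_rank :: "component \<Rightarrow> nat" where
  "component_rank (TypeA k) = k"
| "component_rank (TypeB k) = k"

definition rk :: "cox_type \<Rightarrow> nat" where
  "rk T = (\<Sum>X\<in>#T. component_rank X)"

text \<open>The type \<open>A\<^sub>1\<close> to the power \<open>m 1\<close>, times \dots, times \<open>A\<^sub>n\<close> to the power \<open>m n\<close>.\<close>

definition A_type :: "nat \<Rightarrow> (nat \<Rightarrow> nat) \<Rightarrow> cox_type" where
  "A_type n m = (\<Sum>k = 1..n. replicate_mset (m k) (TypeA k))"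

text \<open>
  \<open>w\<close> is the product of disjoint type \<open>A\<close> cycles, given by the lists in \<open>as\<close>, and type \<open>B\<close>
  cycles, given by the lists in \<open>bs\<close>. Type \<open>A\<close> cycles of length 1 are the identity and have the
  trivial type \<open>A\<^sub>0\<close>, hence they are omitted.
\<close>

definition has_comb_type :: "nat \<Rightarrow> (int \<Rightarrow> int) \<Rightarrow> cox_type \<Rightarrow> bool" where
  "has_comb_type n w T \<longleftrightarrow>
     (\<exists>as bs.
        (\<forall>xs\<in>set as. length xs \<ge> 2) \<and> (\<forall>xs\<in>set bs. length xs \<ge> 1) \<and>
        set (concat (as @ bs)) \<subseteq> letters n \<and>
        distinct (map abs (concat (as @ bs))) \<and>
        w = perm_prod (map A_cycle as @ map B_cycle bs) \<and>
        T = mset (map (\<lambda>xs. TypeA (length xs - 1)) as) + mset (map (\<lambda>xs. TypeB (length xs)) bs))"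

text \<open>
  The multinomial coefficient with lower entries \<open>m 1, \<dots>, m n\<close>; it vanishes if their sum
  exceeds \<open>M\<close>, in accordance with \<open>1 / k! = 0\<close> for negative \<open>k\<close>.
\<close>

definition multinom :: "nat \<Rightarrow> nat \<Rightarrow> (nat \<Rightarrow> nat) \<Rightarrow> real" where
  "multinom M n m =
     (if (\<Sum>k = 1..n. m k) \<le> M
      then fact M / ((\<Prod>k = 1..n. fact (m k)) * fact (M - (\<Sum>k = 1..n. m k)))
      else 0)"

text \<open>
  The factorisations of \<open>c\<close> into \<open>d\<close> factors \<open>ss\<close> of prescribed types, followed by \<open>l\<close> blocks
  \<open>tss\<close> of factors, the \<open>i\<close>-th block having \<open>m i\<close> factors of total absolute length \<open>s i\<close>.
  All lists are indexed from 0.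
\<close>

definition factorisations ::
  "nat \<Rightarrow> (int \<Rightarrow> int) \<Rightarrow> nat \<Rightarrow> (nat \<Rightarrow> cox_type) \<Rightarrow> nat \<Rightarrow> (nat \<Rightarrow> nat) \<Rightarrow> (nat \<Rightarrow> nat)
     \<Rightarrow> ((int \<Rightarrow> int) list \<times> (int \<Rightarrow> int) list list) set" where
  "factorisations n c d T l m s =
     {(ss, tss).
        length ss = d \<and> set ss \<subseteq> W_B n \<and>
        length tss = l \<and> (\<forall>i<l. length (tss ! i) = m i \<and> set (tss ! i) \<subseteq> W_B n) \<and>
        c = perm_prod (ss @ concat tss) \<and>
        (\<forall>i<d. has_comb_type n (ss ! i) (T i)) \<and>
        (\<forall>i<l. (\<Sum>t\<leftarrow>tss ! i. absolute_length n t) = s i)}"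

end

theory Submission
  imports Defs
begin

text \<open>
  Forgetting signs sends \<open>w \<in> W(B\<^sub>n)\<close> to a permutation of \<open>{1, \<dots>, n}\<close>, and the Coxeter elements are
  exactly the elements that become an \<open>n\<close>-cycle and have sign \<open>-1\<close>, i.e. an odd number of type \<open>B\<close>
  cycles. The rank condition forces the orbits of the factors of a Coxeter element to merge in a
  tree-like way and exactly one type \<open>B\<close> cycle to occur among them. Conversely, if the factors have
  this number of blocks and of type \<open>B\<close> cycles and their orbits jointly connect \<open>{1, \<dots>, n}\<close>, then
  their product is a Coxeter element, in whatever order the factors are multiplied. So instead of
  factorisations one counts connecting tuples. The number of ways in which a family of factors
  connects a given partition depends only on the product of the block sizes, and this property is
  inherited by products of families, the constants being multiplied. For a single type the constant
  is found by counting tuples of disjoint sets, for a given absolute length by summing over the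
  types, and for the blocks of factors by Vandermonde convolution. The result counts the
  factorisations of all \<open>2\<^sup>n\<^sup>-\<^sup>1 (n - 1)!\<close> Coxeter elements together; these are conjugate and
  hence have equally many.
\<close>

subsection \<open>Partitions generated by a family of sets\<close>

text \<open>The product of the block sizes is the right weight because a single set of
  \<open>r + 1\<close> points connects \<open>r + 1\<close> blocks exactly when it has one point in
  each; that product counts these sets. A connecting family with constant \<open>p\<close> thus
  behaves like \<open>p\<close> copies of the family of all sets of \<open>r + 1\<close> points, and
  the product rule reduces to one identity about single sets. Families of ranks \<open>r\<close> and
  \<open>s\<close> produce the extra factor \<open>n * (r + s choose r)\<close>. Writing the
  constants as \<open>2 ^ r * fact r * q / n\<close> absorbs it, so the \<open>q\<close> multiply.
  For \<open>r = n - 1\<close> the factor \<open>2 ^ r * fact r\<close> is the number of Coxeter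
  elements, which leaves \<open>q / n\<close> factorisations for each. A type with only
  \<open>A\<close> cycles has \<open>q = n / (n - rk T)\<close> times its multinomial coefficient;
  with one \<open>B\<close> cycle the denominator is absent. The extra factor of (ii) is the sum of
  the \<open>s i\<close>: deciding which factor carries the only \<open>B\<close> cycle obeys a
  product rule and turns \<open>m * n choose s\<close> into \<open>s * (m * n choose s)\<close>. The
  absolute length is not computed in general: bounds from ranks and signs settle the elements with
  at most one \<open>B\<close> cycle.\<close>

definition closed_under :: "'a set set \<Rightarrow> 'a set \<Rightarrow> bool" where
  "closed_under F A \<longleftrightarrow> (\<forall>S\<in>F. S \<inter> A \<noteq> {} \<longrightarrow> S \<subseteq> A)"

text \<open>Blocks are defined through closed sets and not through paths, so two families generate
  the same partition as soon as they have the same closed sets. Orbits, cycles and edges are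
  compared in this way throughout.\<close>

definition component_of :: "'a set \<Rightarrow> 'a set set \<Rightarrow> 'a \<Rightarrow> 'a set" where
  "component_of U F x = \<Inter>{A. A \<subseteq> U \<and> closed_under F A \<and> x \<in> A}"

definition comps :: "'a set \<Rightarrow> 'a set set \<Rightarrow> 'a set set" where
  "comps U F = component_of U F ` U"

lemma closed_under_Un [simp]: "closed_under (F \<union> G) A \<longleftrightarrow> closed_under F A \<and> closed_under G A"
  by (auto simp: closed_under_def)

lemma closed_under_insert [simp]:
  "closed_under (insert S F) A \<longleftrightarrow> (S \<inter> A \<noteq> {} \<longrightarrow> S \<subseteq> A) \<and> closed_under F A"
  by (auto simp: closed_under_def)

lemma closed_under_empty_family [simp]: "closed_under {} A"
  by (auto simp: closed_under_def)

lemma closed_under_Inter: "(\<And>A. A \<in> \<A> \<Longrightarrow> closed_under F A) \<Longrightarrow> closed_under F (\<Inter>\<A>)"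
  unfolding closed_under_def by blast

lemma closed_under_Union: "(\<And>A. A \<in> \<A> \<Longrightarrow> closed_under F A) \<Longrightarrow> closed_under F (\<Union>\<A>)"
  unfolding closed_under_def by blast

lemma closed_under_univ: "F \<subseteq> Pow U \<Longrightarrow> closed_under F U"
  unfolding closed_under_def by blast

context
  fixes U :: "'a set" and F :: "'a set set"
  assumes F: "F \<subseteq> Pow U"
begin

lemma closed_component_of: "closed_under F (component_of U F x)"
  unfolding component_of_def by (rule closed_under_Inter) auto

lemma component_of_subset: "x \<in> U \<Longrightarrow> component_of U F x \<subseteq> U"
  using closed_under_univ[OF F] unfolding component_of_def by blast

lemma component_of_self: "x \<in> component_of U F x"
  unfolding component_of_def by auto

lemma component_of_least: "A \<subseteq> U \<Longrightarrow> closed_under F A \<Longrightarrow> x \<in> A \<Longrightarrow> component_of U F x \<subseteq> A"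
  unfolding component_of_def by auto

lemma component_of_eq:
  assumes x: "x \<in> U" and y: "y \<in> component_of U F x"
  shows "component_of U F y = component_of U F x"
proof
  show 1: "component_of U F y \<subseteq> component_of U F x"
    using component_of_least[OF component_of_subset[OF x] closed_component_of y] .
  \<comment> \<open>A difference of closed sets is closed. If it contained \<open>x\<close>,
    minimality of the block of \<open>x\<close> would put \<open>y\<close> into it, which is
    impossible.\<close>
  have "closed_under F (component_of U F x - component_of U F y)"
    using F closed_component_of[of x] closed_component_of[of y] unfolding closed_under_def by blast
  then have "x \<in> component_of U F y"
    using component_of_least[of "component_of U F x - component_of U F y" x]
      component_of_subset[OF x] component_of_self[of x] component_of_self[of y] y by blast
  then show "component_of U F x \<subseteq> component_of U F y"
    using component_of_least[of "component_of U F y" x] closed_component_of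
      component_of_subset[of y] y component_of_subset[OF x] by blast
qed

lemma comps_disjoint: "X \<in> comps U F \<Longrightarrow> Y \<in> comps U F \<Longrightarrow> z \<in> X \<Longrightarrow> z \<in> Y \<Longrightarrow> X = Y"
  unfolding comps_def using component_of_eq by blast

lemma comps_nonempty: "X \<in> comps U F \<Longrightarrow> X \<noteq> {}"
  unfolding comps_def using component_of_self by blast

lemma Union_comps: "\<Union>(comps U F) = U"
  unfolding comps_def using component_of_self component_of_subset by blast

lemma comps_subset: "X \<in> comps U F \<Longrightarrow> X \<subseteq> U"
  using Union_comps by blast

lemma comps_closed: "X \<in> comps U F \<Longrightarrow> closed_under F X"
  unfolding comps_def using closed_component_of by blast

lemma comps_in_closed: "X \<in> comps U F \<Longrightarrow> A \<subseteq> U \<Longrightarrow> closed_under F A \<Longrightarrow> X \<inter> A \<noteq> {} \<Longrightarrow> X \<subseteq> A"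
proof -
  assume X: "X \<in> comps U F" and A: "A \<subseteq> U" "closed_under F A" and "X \<inter> A \<noteq> {}"
  then obtain x where x: "x \<in> X" "x \<in> A" by blast
  from X obtain y where y: "y \<in> U" "X = component_of U F y" unfolding comps_def by blast
  then have "X = component_of U F x" using component_of_eq[OF y(1)] x by blast
  then show "X \<subseteq> A" using component_of_least[OF A x(2)] by simp
qed

lemma component_in_comps: "x \<in> U \<Longrightarrow> component_of U F x \<in> comps U F"
  unfolding comps_def by blast

lemma comps_eq_component: "X \<in> comps U F \<Longrightarrow> x \<in> X \<Longrightarrow> X = component_of U F x"
  unfolding comps_def using component_of_eq by blast

lemma finite_comps: "finite U \<Longrightarrow> finite (comps U F)"
  unfolding comps_def by simp

lemma pairwise_disjnt_comps: "pairwise disjnt (comps U F)"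
  unfolding pairwise_def disjnt_def using comps_disjoint by blast

lemma card_comps_le: "finite U \<Longrightarrow> card (comps U F) \<le> card U"
  unfolding comps_def by (rule card_image_le)

lemma sum_card_comps: "finite U \<Longrightarrow> (\<Sum>X\<in>comps U F. card X) = card U"
proof -
  assume U: "finite U"
  have "card (\<Union>(comps U F)) = (\<Sum>X\<in>comps U F. card X)"
    by (rule card_Union_disjoint[OF pairwise_disjnt_comps])
      (rule finite_subset[OF comps_subset U])
  then show ?thesis by (simp add: Union_comps)
qed

text \<open>The union of the blocks that meet \<open>S\<close> contains \<open>S\<close> and is
  closed. Conversely, a closed set of the enlarged family that contains a point of such a block
  contains the block, hence \<open>S\<close>, hence all of these blocks.\<close>

lemma comps_insert:
  assumes S: "S \<subseteq> U" "S \<noteq> {}"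
  shows "comps U (insert S F) =
     insert (\<Union>{X\<in>comps U F. X \<inter> S \<noteq> {}}) {X\<in>comps U F. X \<inter> S = {}}" (is "_ = insert ?J ?R")
proof -
  have F': "insert S F \<subseteq> Pow U" using F S by auto
  have clJ: "closed_under (insert S F) ?J"
  proof -
    have "closed_under F ?J" by (rule closed_under_Union) (use comps_closed in auto)
    moreover have "S \<subseteq> ?J" using S Union_comps by blast
    ultimately show ?thesis by simp
  qed
  have subJ: "?J \<subseteq> U" using comps_subset by blast
  have new: "component_of U (insert S F) x =
      (if component_of U F x \<inter> S = {} then component_of U F x else ?J)" if x: "x \<in> U" for x
  proof (cases "component_of U F x \<inter> S = {}")
    case True
    have "component_of U (insert S F) x \<subseteq> component_of U F x"
      unfolding component_of_def[of U "insert S F"]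
      using True closed_component_of[of x] component_of_self[of x] component_of_subset[OF x]
      by (intro Inter_lower) auto
    moreover have "component_of U F x \<subseteq> component_of U (insert S F) x"
      unfolding component_of_def by auto
    ultimately show ?thesis using True by auto
  next
    case False
    have xJ: "x \<in> ?J" using component_in_comps[OF x] component_of_self[of x] False by blast
    have 1: "component_of U (insert S F) x \<subseteq> ?J"
      unfolding component_of_def[of U "insert S F"] using clJ xJ subJ by (intro Inter_lower) auto
    have "?J \<subseteq> A" if A: "A \<subseteq> U" "closed_under (insert S F) A" "x \<in> A" for A
    proof -
      have "component_of U F x \<subseteq> A" using component_of_least[OF A(1) _ A(3)] A(2) by simp
      then have "S \<subseteq> A" using False A(2) by auto
      then show ?thesis using comps_in_closed[OF _ A(1)] A(2) by fastforce
    qed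
    then have "?J \<subseteq> component_of U (insert S F) x" unfolding component_of_def by blast
    then show ?thesis using False 1 by auto
  qed
  obtain s where s: "s \<in> S" "s \<in> U" using S by blast
  have "?J \<in> comps U (insert S F)"
  proof -
    have "component_of U F s \<inter> S \<noteq> {}" using component_of_self[of s] s by blast
    then have "component_of U (insert S F) s = ?J" using new[OF s(2)] by simp
    then show ?thesis unfolding comps_def[of U "insert S F"] using s(2) by blast
  qed
  moreover have "?R \<subseteq> comps U (insert S F)"
  proof
    fix X assume "X \<in> ?R"
    then obtain x where "x \<in> U" "X = component_of U F x" "X \<inter> S = {}" unfolding comps_def by blast
    then have "X = component_of U (insert S F) x" using new by simp
    then show "X \<in> comps U (insert S F)" unfolding comps_def using \<open>x \<in> U\<close> by blast
  qed
  moreover have "comps U (insert S F) \<subseteq> insert ?J ?R"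
    using new component_in_comps unfolding comps_def[of U "insert S F"] by auto
  ultimately show ?thesis by blast
qed

text \<open>The blocks met by \<open>S\<close> become one. The additive form keeps truncated
  subtraction away.\<close>

lemma card_comps_insert:
  assumes U: "finite U" and S: "S \<subseteq> U" "S \<noteq> {}"
  shows "card (comps U (insert S F)) + card {X\<in>comps U F. X \<inter> S \<noteq> {}} = card (comps U F) + 1"
proof -
  let ?H = "{X\<in>comps U F. X \<inter> S \<noteq> {}}" and ?R = "{X\<in>comps U F. X \<inter> S = {}}"
  have "\<Union>?H \<inter> S \<noteq> {}" using S Union_comps by blast
  then have "\<Union>?H \<notin> ?R" by blast
  then have "card (comps U (insert S F)) = card ?R + 1"
    unfolding comps_insert[OF S] using finite_comps[OF U] by simp
  moreover have "card (comps U F) = card ?H + card ?R"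
  proof -
    have "comps U F = ?H \<union> ?R" "?H \<inter> ?R = {}" by blast+
    then show ?thesis using card_Un_disjoint[of ?H ?R] finite_comps[OF U] by simp
  qed
  ultimately show ?thesis by simp
qed

lemma card_hit_le:
  assumes "finite S"
  shows "card {X\<in>comps U F. X \<inter> S \<noteq> {}} \<le> card S"
proof -
  have "{X\<in>comps U F. X \<inter> S \<noteq> {}} \<subseteq> component_of U F ` S"
    using comps_eq_component by blast
  then show ?thesis using surj_card_le[OF assms] by blast
qed

end

lemma component_of_cong:
  assumes "\<And>A. A \<subseteq> U \<Longrightarrow> closed_under F A \<longleftrightarrow> closed_under G A"
  shows "component_of U F x = component_of U G x"
  unfolding component_of_def using assms by (intro arg_cong[where f=Inter]) auto

lemma comps_cong:
  assumes "\<And>A. A \<subseteq> U \<Longrightarrow> closed_under F A \<longleftrightarrow> closed_under G A"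
  shows "comps U F = comps U G"
  unfolding comps_def using component_of_cong[OF assms] by auto

lemma comps_empty: "comps U {} = (\<lambda>x. {x}) ` U"
proof -
  have "component_of U {} x = {x}" if "x \<in> U" for x
    unfolding component_of_def using that by auto
  then show ?thesis unfolding comps_def by simp
qed

lemma card_comps_empty: "card (comps U {}) = card U"
  unfolding comps_empty by (rule card_image) simp

text \<open>The assumption makes the partition of \<open>F\<close> the finer one. Sending each block
  of \<open>F\<close> to the block of \<open>G\<close> around it is onto; if the numbers agree it is
  also injective, and then the partitions coincide.\<close>

lemma card_comps_mono:
  assumes U: "finite U" and F: "F \<subseteq> Pow U" and G: "G \<subseteq> Pow U"
    and sub: "\<And>A. A \<subseteq> U \<Longrightarrow> closed_under G A \<Longrightarrow> closed_under F A"
  shows "card (comps U G) \<le> card (comps U F)"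
    and "card (comps U G) = card (comps U F) \<Longrightarrow> comps U G = comps U F"
proof -
  have le: "component_of U F x \<subseteq> component_of U G x" if "x \<in> U" for x
    using component_of_least[OF F component_of_subset[OF G that] sub[OF component_of_subset[OF G that] closed_component_of[OF G]]]
      component_of_self[OF G] by blast
  define h where "h X = component_of U G (SOME x. x \<in> X)" for X
  have h: "h X \<in> comps U G \<and> X \<subseteq> h X" if X: "X \<in> comps U F" for X
  proof -
    have "(SOME x. x \<in> X) \<in> X" using comps_nonempty[OF F X] by (simp add: some_in_eq)
    then have s: "(SOME x. x \<in> X) \<in> U" "X = component_of U F (SOME x. x \<in> X)"
      using comps_subset[OF F X] comps_eq_component[OF F X] by auto
    then show ?thesis unfolding h_def using component_in_comps[OF G] le by metis
  qed
  have surj: "h ` comps U F = comps U G"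
  proof
    show "h ` comps U F \<subseteq> comps U G" using h by auto
    show "comps U G \<subseteq> h ` comps U F"
    proof
      fix Y assume Y: "Y \<in> comps U G"
      then obtain x where x: "x \<in> Y" "x \<in> U" using comps_nonempty[OF G Y] comps_subset[OF G Y] by blast
      have "h (component_of U F x) = Y"
        using h[OF component_in_comps[OF F x(2)]] component_of_self[OF F, of x] comps_disjoint[OF G _ Y _ x(1)]
        by blast
      then show "Y \<in> h ` comps U F" using component_in_comps[OF F x(2)] by blast
    qed
  qed
  show "card (comps U G) \<le> card (comps U F)"
    using surj_card_le[OF finite_comps[OF F U], of "comps U G" h] by (simp add: surj)
  assume "card (comps U G) = card (comps U F)"
  then have inj: "inj_on h (comps U F)"
    by (intro eq_card_imp_inj_on finite_comps[OF F U]) (simp add: surj)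
  have "component_of U F x = component_of U G x" if x: "x \<in> U" for x
  proof
    show "component_of U F x \<subseteq> component_of U G x" using le x .
    show "component_of U G x \<subseteq> component_of U F x"
    proof
      fix y assume y: "y \<in> component_of U G x"
      then have yU: "y \<in> U" using component_of_subset[OF G x] by auto
      have "h (component_of U F z) = component_of U G x" if "z \<in> U" "z \<in> component_of U G x" for z
        using h[OF component_in_comps[OF F that(1)]] component_of_self[OF F, of z]
          comps_disjoint[OF G _ component_in_comps[OF G x] _ that(2)] by blast
      then have "h (component_of U F y) = h (component_of U F x)"
        using x y yU component_of_self[OF G, of x] by simp
      then have "component_of U F y = component_of U F x"
        using inj_onD[OF inj] component_in_comps[OF F] x yU by blast
      then show "y \<in> component_of U F x" using component_of_self[OF F, of y] by simp
    qed
  qed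
  then show "comps U G = comps U F" unfolding comps_def by auto
qed

lemma card_comps_insert_le:
  assumes "finite U" "F \<subseteq> Pow U" "S \<subseteq> U"
  shows "card (comps U F) \<le> card (comps U (insert S F)) + (card S - 1)"
proof (cases "S = {}")
  case True
  then have "comps U (insert S F) = comps U F" by (intro comps_cong) auto
  then show ?thesis by simp
next
  case False
  have fS: "finite S" using finite_subset[OF assms(3,1)] .
  have "card S > 0" using False fS by (simp add: card_gt_0_iff)
  then show ?thesis
    using card_comps_insert[OF assms(2,1,3) False] card_hit_le[OF assms(2) fS] by simp
qed

lemma card_comps_insert_pair:
  assumes U: "finite U" and F: "F \<subseteq> Pow U" and x: "x \<in> U" and y: "y \<in> U"
  shows "card (comps U F) = card (comps U (insert {x,y} F)) +
     (if component_of U F x = component_of U F y then 0 else 1)"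
proof -
  have h: "{X\<in>comps U F. X \<inter> {x,y} \<noteq> {}} = {component_of U F x, component_of U F y}"
    using component_of_self[OF F] component_in_comps[OF F] x y comps_eq_component[OF F] by auto
  have "card (comps U (insert {x,y} F)) + card {component_of U F x, component_of U F y} = card (comps U F) + 1"
    using card_comps_insert[OF F U, of "{x,y}"] x y unfolding h by simp
  then show ?thesis by (cases "component_of U F x = component_of U F y") simp_all
qed

definition conn :: "'a set \<Rightarrow> 'a set set \<Rightarrow> bool" where
  "conn U F \<longleftrightarrow> comps U F = {U}"

lemma conn_iff_card:
  assumes "U \<noteq> {}" "F \<subseteq> Pow U"
  shows "conn U F \<longleftrightarrow> card (comps U F) = 1"
proof
  show "conn U F \<Longrightarrow> card (comps U F) = 1" by (simp add: conn_def)
  assume "card (comps U F) = 1"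
  then obtain X where "comps U F = {X}" by (auto simp: card_1_singleton_iff)
  then show "conn U F" using Union_comps[OF assms(2)] by (auto simp: conn_def)
qed

lemma conn_iff_closed:
  assumes U: "U \<noteq> {}" and F: "F \<subseteq> Pow U"
  shows "conn U F \<longleftrightarrow> (\<forall>A. A \<subseteq> U \<longrightarrow> closed_under F A \<longrightarrow> A = {} \<or> A = U)"
proof
  assume c: "conn U F"
  show "\<forall>A. A \<subseteq> U \<longrightarrow> closed_under F A \<longrightarrow> A = {} \<or> A = U"
    using comps_in_closed[OF F, of U] c unfolding conn_def by auto
next
  assume *: "\<forall>A. A \<subseteq> U \<longrightarrow> closed_under F A \<longrightarrow> A = {} \<or> A = U"
  have "component_of U F x = U" if "x \<in> U" for x
    using * component_of_subset[OF F that] closed_component_of[OF F] component_of_self[OF F, of x] by blast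
  then show "conn U F" using U unfolding conn_def comps_def by auto
qed

lemma conn_insert_iff:
  assumes S: "S \<subseteq> U" "S \<noteq> {}" and F: "F \<subseteq> Pow U"
  shows "conn U (insert S F) \<longleftrightarrow> (\<forall>X\<in>comps U F. X \<inter> S \<noteq> {})"
proof
  assume c: "conn U (insert S F)"
  show "\<forall>X\<in>comps U F. X \<inter> S \<noteq> {}"
  proof (rule ballI, rule ccontr)
    fix X assume X: "X \<in> comps U F" "\<not> X \<inter> S \<noteq> {}"
    then have "X \<in> {U}" using c comps_insert[OF F S] unfolding conn_def by auto
    then show False using X S by auto
  qed
next
  assume *: "\<forall>X\<in>comps U F. X \<inter> S \<noteq> {}"
  then have "{X \<in> comps U F. X \<inter> S \<noteq> {}} = comps U F" "{X \<in> comps U F. X \<inter> S = {}} = {}" by auto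
  then show "conn U (insert S F)"
    unfolding conn_def comps_insert[OF F S] using Union_comps[OF F] * by auto
qed

lemma conn_cong:
  assumes "\<And>A. A \<subseteq> U \<Longrightarrow> closed_under F A \<longleftrightarrow> closed_under G A"
  shows "conn U F \<longleftrightarrow> conn U G"
  unfolding conn_def using comps_cong[of U F G] assms by simp

subsection \<open>Counting transversals\<close>

text \<open>With as many points as there are disjoint blocks and every block met, \<open>S\<close>
  has exactly one point in each block and is the image of a unique choice function.\<close>

lemma card_transversals:
  assumes P: "finite P" "pairwise disjnt P" and V: "finite V"
  shows "card {S. S \<subseteq> V \<inter> \<Union>P \<and> card S = card P \<and> (\<forall>X\<in>P. X \<inter> S \<noteq> {})} = (\<Prod>X\<in>P. card (X \<inter> V))"
    (is "card ?T = _")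
proof -
  have dj: "X = Y" if "X \<in> P" "Y \<in> P" "z \<in> X" "z \<in> Y" for X Y z
    using P(2) that unfolding pairwise_def disjnt_def by blast
  have "bij_betw (\<lambda>f. f ` P) (PiE P (\<lambda>X. X \<inter> V)) ?T"
  proof (rule bij_betwI')
    fix f g assume f: "f \<in> PiE P (\<lambda>X. X \<inter> V)" and g: "g \<in> PiE P (\<lambda>X. X \<inter> V)"
    have "f = g" if e: "f ` P = g ` P"
    proof (rule PiE_ext[OF f g])
      fix X assume X: "X \<in> P"
      then obtain Y where Y: "Y \<in> P" "f X = g Y" using e by (metis imageE imageI)
      have "f X \<in> X" "g Y \<in> Y" using f g X Y by (auto simp: PiE_def Pi_def)
      then have "X = Y" using dj[OF X Y(1)] Y(2) by metis
      then show "f X = g X" using Y by simp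
    qed
    then show "(f ` P = g ` P) = (f = g)" by auto
  next
    fix f assume f: "f \<in> PiE P (\<lambda>X. X \<inter> V)"
    then have fX: "f X \<in> X" "f X \<in> V" if "X \<in> P" for X using that by (auto simp: PiE_def Pi_def)
    have "inj_on f P" by (rule inj_onI) (metis fX(1) dj)
    then have "card (f ` P) = card P" by (rule card_image)
    then show "f ` P \<in> ?T" using fX by auto
  next
    fix S assume S: "S \<in> ?T"
    then have fS: "finite S" using V finite_subset by blast
    define f where "f = (\<lambda>X\<in>P. SOME x. x \<in> X \<inter> S)"
    have fX: "f X \<in> X \<inter> S" if "X \<in> P" for X
    proof -
      have "\<exists>x. x \<in> X \<inter> S" using S that by auto
      then have "(SOME x. x \<in> X \<inter> S) \<in> X \<inter> S" by (rule someI_ex)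
      then show ?thesis using that by (simp add: f_def)
    qed
    have "inj_on f P" by (rule inj_onI) (metis fX IntD1 dj)
    then have "card (f ` P) = card S" using S by (simp add: card_image)
    then have "f ` P = S" using card_subset_eq[OF fS] fX by blast
    moreover have "f \<in> PiE P (\<lambda>X. X \<inter> V)"
      unfolding PiE_def using fX S by (auto simp: f_def)
    ultimately show "\<exists>f\<in>PiE P (\<lambda>X. X \<inter> V). S = f ` P" by blast
  qed
  then have "card ?T = card (PiE P (\<lambda>X. X \<inter> V))" by (simp add: bij_betw_same_card)
  then show ?thesis using card_PiE[OF P(1)] by simp
qed

definition hits :: "'a set set \<Rightarrow> 'a set \<Rightarrow> 'a set set" where
  "hits P S = {X\<in>P. X \<inter> S \<noteq> {}}"

text \<open>A set of \<open>j\<close> points that meets \<open>j\<close> blocks is a transversal of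
  these blocks. Collecting the sets \<open>S\<close> by the blocks \<open>Q\<close> that they meet
  turns the number of choices into a product.\<close>

lemma sum_partial_transversals:
  fixes g :: "'a set set \<Rightarrow> 'b :: comm_semiring_1"
  assumes P: "finite P" "pairwise disjnt P" and V: "finite V" "V \<subseteq> \<Union>P"
  shows "(\<Sum>S | S \<subseteq> V \<and> card S = j \<and> card (hits P S) = j. g (hits P S)) =
     (\<Sum>Q | Q \<subseteq> P \<and> card Q = j. (\<Prod>X\<in>Q. of_nat (card (X \<inter> V))) * g Q)"
proof -
  let ?A = "{S. S \<subseteq> V \<and> card S = j \<and> card (hits P S) = j}" and ?B = "{Q. Q \<subseteq> P \<and> card Q = j}"
  have fA: "finite ?A" using V by simp
  have dj: "X = Y" if "X \<in> P" "Y \<in> P" "z \<in> X" "z \<in> Y" for X Y z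
    using P(2) that unfolding pairwise_def disjnt_def by blast
  have fB: "finite ?B" using P by simp
  have "(\<Sum>S\<in>?A. g (hits P S)) = (\<Sum>Q\<in>?B. \<Sum>S\<in>{S\<in>?A. hits P S = Q}. g (hits P S))"
    by (rule sum.group[symmetric, OF fA fB]) (auto simp: hits_def)
  also have "\<dots> = (\<Sum>Q\<in>?B. (\<Prod>X\<in>Q. of_nat (card (X \<inter> V))) * g Q)"
  proof (rule sum.cong[OF refl])
    fix Q assume Q: "Q \<in> ?B"
    have fQ: "finite Q" using Q P finite_subset by blast
    have dQ: "pairwise disjnt Q" using Q P pairwise_subset by blast
    have "{S\<in>?A. hits P S = Q} =
        {S. S \<subseteq> V \<inter> \<Union>Q \<and> card S = card Q \<and> (\<forall>X\<in>Q. X \<inter> S \<noteq> {})}" (is "?L = ?R")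
    proof
      show "?L \<subseteq> ?R"
      proof
        fix S assume S: "S \<in> ?L"
        have "S \<subseteq> \<Union>Q"
        proof
          fix x assume x: "x \<in> S"
          then obtain X where "X \<in> P" "x \<in> X" using S V by blast
          then show "x \<in> \<Union>Q" using S x unfolding hits_def by blast
        qed
        moreover have "\<forall>X\<in>Q. X \<inter> S \<noteq> {}" using S unfolding hits_def by blast
        ultimately show "S \<in> ?R" using S Q by simp
      qed
      show "?R \<subseteq> ?L"
      proof
        fix S assume S: "S \<in> ?R"
        have "X \<in> Q" if "X \<in> P" "X \<inter> S \<noteq> {}" for X
        proof -
          from that S obtain x Y where xY: "x \<in> X" "Y \<in> Q" "x \<in> Y" by blast
          then have "X = Y" using dj[OF that(1) _ xY(1,3)] Q by blast
          then show ?thesis using xY by simp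
        qed
        then have "hits P S = Q" using S Q unfolding hits_def by blast
        then show "S \<in> ?L" using S Q by simp
      qed
    qed
    then have c: "card {S\<in>?A. hits P S = Q} = (\<Prod>X\<in>Q. card (X \<inter> V))"
      using card_transversals[OF fQ dQ V(1)] by simp
    have "(\<Sum>S\<in>{S\<in>?A. hits P S = Q}. g (hits P S)) = (\<Sum>S\<in>{S\<in>?A. hits P S = Q}. g Q)"
      by (rule sum.cong) simp_all
    also have "\<dots> = of_nat (\<Prod>X\<in>Q. card (X \<inter> V)) * g Q" using c by simp
    finally show "(\<Sum>S\<in>{S\<in>?A. hits P S = Q}. g (hits P S)) = (\<Prod>X\<in>Q. of_nat (card (X \<inter> V))) * g Q"
      by simp
  qed
  finally show ?thesis .
qed

text \<open>Double counting: a fixed \<open>X\<close> lies in \<open>card P - 1 choose i\<close> of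
  the subsets of size \<open>Suc i\<close>.\<close>

lemma sum_subsets_sum:
  fixes g :: "'a \<Rightarrow> 'b :: comm_semiring_1"
  assumes P: "finite P"
  shows "(\<Sum>Q | Q \<subseteq> P \<and> card Q = Suc i. \<Sum>X\<in>Q. g X) = of_nat ((card P - 1) choose i) * (\<Sum>X\<in>P. g X)"
proof -
  let ?B = "{Q. Q \<subseteq> P \<and> card Q = Suc i}"
  have fB: "finite ?B" using P by simp
  have "(\<Sum>Q\<in>?B. \<Sum>X\<in>Q. g X) = (\<Sum>Q\<in>?B. \<Sum>X\<in>{X\<in>P. X \<in> Q}. g X)"
    by (intro sum.cong refl) auto
  also have "\<dots> = (\<Sum>X\<in>P. \<Sum>Q\<in>{Q\<in>?B. X \<in> Q}. g X)"
    by (rule sum.swap_restrict[OF fB P])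
  also have "\<dots> = (\<Sum>X\<in>P. of_nat ((card P - 1) choose i) * g X)"
  proof (rule sum.cong[OF refl])
    fix X assume X: "X \<in> P"
    have "bij_betw (insert X) {Q. Q \<subseteq> P - {X} \<and> card Q = i} {Q\<in>?B. X \<in> Q}"
    proof (rule bij_betwI[where g="\<lambda>Q. Q - {X}"])
      show "insert X \<in> {Q. Q \<subseteq> P - {X} \<and> card Q = i} \<rightarrow> {Q \<in> ?B. X \<in> Q}"
      proof
        fix Q assume Q: "Q \<in> {Q. Q \<subseteq> P - {X} \<and> card Q = i}"
        then have "finite Q" "X \<notin> Q" using P finite_subset by blast+
        then show "insert X Q \<in> {Q \<in> ?B. X \<in> Q}" using Q X by auto
      qed
      show "(\<lambda>Q. Q - {X}) \<in> {Q \<in> ?B. X \<in> Q} \<rightarrow> {Q. Q \<subseteq> P - {X} \<and> card Q = i}"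
        by (auto simp: card_Diff_singleton)
    qed auto
    then have "card {Q\<in>?B. X \<in> Q} = (card P - 1) choose i"
      using bij_betw_same_card n_subsets[of "P - {X}" i] P X by fastforce
    then show "(\<Sum>Q\<in>{Q\<in>?B. X \<in> Q}. g X) = of_nat ((card P - 1) choose i) * g X" by simp
  qed
  finally show ?thesis by (simp add: sum_distrib_left)
qed

lemma prod_comps_insert:
  fixes h :: "'a set \<Rightarrow> 'b :: comm_semiring_1"
  assumes F: "F \<subseteq> Pow U" and U: "finite U" and S: "S \<subseteq> U" "S \<noteq> {}"
  shows "(\<Prod>X\<in>comps U (insert S F). h X) =
    h (\<Union>(hits (comps U F) S)) * (\<Prod>X\<in>comps U F - hits (comps U F) S. h X)"
proof -
  have e: "comps U F - hits (comps U F) S = {X\<in>comps U F. X \<inter> S = {}}" unfolding hits_def by blast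
  have "\<Union>(hits (comps U F) S) \<inter> S \<noteq> {}" using S Union_comps[OF F] unfolding hits_def by blast
  then have "\<Union>(hits (comps U F) S) \<notin> {X\<in>comps U F. X \<inter> S = {}}" by blast
  then show ?thesis
    unfolding e comps_insert[OF F S] hits_def[symmetric]
    using finite_comps[OF F U] by (subst prod.insert) auto
qed

text \<open>The model for all connecting families: with only as many points as blocks, a connecting
  set must choose one point in each. The set \<open>V\<close> leaves room for points that other sets
  already occupy.\<close>

lemma card_single_connecting:
  assumes F: "F \<subseteq> Pow U" and U: "finite U" "U \<noteq> {}" and V: "V \<subseteq> U"
  shows "card {S. S \<subseteq> V \<and> card S = card (comps U F) \<and> conn U (insert S F)} =
    (\<Prod>X\<in>comps U F. card (X \<inter> V))"
proof -
  have fV: "finite V" using V U finite_subset by blast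
  have ne: "comps U F \<noteq> {}" using Union_comps[OF F] U by auto
  then have pos: "card (comps U F) > 0" using finite_comps[OF F U(1)] by (simp add: card_gt_0_iff)
  have "{S. S \<subseteq> V \<and> card S = card (comps U F) \<and> conn U (insert S F)} =
    {S. S \<subseteq> V \<inter> \<Union>(comps U F) \<and> card S = card (comps U F) \<and> (\<forall>X\<in>comps U F. X \<inter> S \<noteq> {})}"
  proof (intro Collect_cong)
    fix S
    have "conn U (insert S F) \<longleftrightarrow> (\<forall>X\<in>comps U F. X \<inter> S \<noteq> {})"
      if "S \<subseteq> V" "card S = card (comps U F)"
      using conn_insert_iff[OF _ _ F, of S] that V pos by fastforce
    then show "(S \<subseteq> V \<and> card S = card (comps U F) \<and> conn U (insert S F)) \<longleftrightarrow>
      (S \<subseteq> V \<inter> \<Union>(comps U F) \<and> card S = card (comps U F) \<and> (\<forall>X\<in>comps U F. X \<inter> S \<noteq> {}))"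
      using V Union_comps[OF F] by auto
  qed
  then show ?thesis
    using card_transversals[OF finite_comps[OF F U(1)] pairwise_disjnt_comps[OF F] fV] by simp
qed

lemma conn_imp_card_comps_le:
  assumes F: "F \<subseteq> Pow U" and U: "finite U" "U \<noteq> {}" and S: "S \<subseteq> U" and c: "conn U (insert S F)"
  shows "card (comps U F) \<le> 1 + (card S - 1)"
proof -
  have "insert S F \<subseteq> Pow U" using F S by auto
  then have "card (comps U (insert S F)) = 1" using c conn_iff_card[OF U(2)] by blast
  then show ?thesis using card_comps_insert_le[OF U(1) F S] by simp
qed

text \<open>The heart of the product rule. An admissible \<open>S\<close> picks one point in each
  block of some \<open>Q\<close> with \<open>i + 1\<close> members, which accounts for the product
  of the sizes in \<open>Q\<close>; the merged block contributes their sum, the other blocks their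
  product. So each \<open>Q\<close> contributes the old weight times the sum of the sizes in
  \<open>Q\<close>, and the sum over \<open>Q\<close> is a double count.\<close>

lemma sum_connecting_weights:
  assumes F: "F \<subseteq> Pow U" and U: "finite U" "U \<noteq> {}"
  shows "(\<Sum>S | S \<subseteq> U \<and> card S = Suc i \<and> card (comps U (insert S F)) + i = card (comps U F).
            \<Prod>X\<in>comps U (insert S F). card X) =
     (card (comps U F) - 1 choose i) * card U * (\<Prod>X\<in>comps U F. card X)" (is "?lhs = _")
proof -
  let ?P = "comps U F"
  define g where "g Q = (\<Sum>X\<in>Q. card X) * (\<Prod>X\<in>?P-Q. card X)" for Q
  have "?lhs = (\<Sum>S | S \<subseteq> U \<and> card S = Suc i \<and> card (hits ?P S) = Suc i. g (hits ?P S))"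
  proof (rule sum.cong)
    show "{S. S \<subseteq> U \<and> card S = Suc i \<and> card (comps U (insert S F)) + i = card ?P} =
      {S. S \<subseteq> U \<and> card S = Suc i \<and> card (hits ?P S) = Suc i}"
    proof (intro Collect_cong conj_cong refl)
      fix S assume S: "S \<subseteq> U" "card S = Suc i"
      then have "S \<noteq> {}" by auto
      then show "(card (comps U (insert S F)) + i = card ?P) = (card (hits ?P S) = Suc i)"
        using card_comps_insert[OF F U(1) S(1)] unfolding hits_def by linarith
    qed
    fix S assume "S \<in> {S. S \<subseteq> U \<and> card S = Suc i \<and> card (hits ?P S) = Suc i}"
    then have S: "S \<subseteq> U" "S \<noteq> {}" by auto
    have "card (\<Union>(hits ?P S)) = (\<Sum>X\<in>hits ?P S. card X)"
    proof (rule card_Union_disjoint)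
      show "pairwise disjnt (hits ?P S)"
        using pairwise_disjnt_comps[OF F] by (rule pairwise_subset) (auto simp: hits_def)
      show "finite X" if "X \<in> hits ?P S" for X
        using that comps_subset[OF F] U(1) finite_subset unfolding hits_def by blast
    qed
    then show "(\<Prod>X\<in>comps U (insert S F). card X) = g (hits ?P S)"
      using prod_comps_insert[OF F U(1) S, of card] by (simp add: g_def)
  qed
  also have "\<dots> = (\<Sum>Q | Q \<subseteq> ?P \<and> card Q = Suc i. (\<Prod>X\<in>Q. of_nat (card (X \<inter> U))) * g Q)"
    using Union_comps[OF F]
    by (intro sum_partial_transversals finite_comps[OF F U(1)] pairwise_disjnt_comps[OF F] U(1)) simp
  also have "\<dots> = (\<Sum>Q | Q \<subseteq> ?P \<and> card Q = Suc i. (\<Prod>X\<in>?P. card X) * (\<Sum>X\<in>Q. card X))"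
  proof (rule sum.cong[OF refl])
    fix Q assume Q: "Q \<in> {Q. Q \<subseteq> ?P \<and> card Q = Suc i}"
    have "(\<Prod>X\<in>Q. of_nat (card (X \<inter> U))) = (\<Prod>X\<in>Q. card X)"
    proof (rule prod.cong[OF refl])
      fix X assume "X \<in> Q"
      then have "X \<inter> U = X" using Q comps_subset[OF F, of X] by blast
      then show "of_nat (card (X \<inter> U)) = card X" by simp
    qed
    moreover have "(\<Prod>X\<in>?P. card X) = (\<Prod>X\<in>?P-Q. card X) * (\<Prod>X\<in>Q. card X)"
      using Q by (intro prod.subset_diff finite_comps[OF F U(1)]) simp
    ultimately show "(\<Prod>X\<in>Q. of_nat (card (X \<inter> U))) * g Q = (\<Prod>X\<in>?P. card X) * (\<Sum>X\<in>Q. card X)"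
      by (simp add: g_def)
  qed
  also have "\<dots> = (card ?P - 1 choose i) * card U * (\<Prod>X\<in>?P. card X)"
    by (simp add: sum_distrib_left[symmetric] sum_subsets_sum[OF finite_comps[OF F U(1)]]
        sum_card_comps[OF F U(1)])
  finally show ?thesis .
qed

text \<open>Compares two disjoint sets of sizes \<open>i + 1\<close> and \<open>j + 1\<close> with a
  single set of size \<open>i + j + 1\<close>; the ratio does not depend on the partition, so tuples
  of disjoint sets can be shrunk to one set. Integers are used because \<open>card V\<close> may be
  less than \<open>i + j + 1\<close>, in which case both counts are zero.\<close>

lemma card_disjoint_pairs:
  assumes F: "F \<subseteq> Pow U" and U: "finite U" "U \<noteq> {}" and V: "V \<subseteq> U"
    and k: "card (comps U F) = Suc (i + j)"
  shows "int (card {(S1, S2). S1 \<subseteq> V \<and> S2 \<subseteq> V \<and> S1 \<inter> S2 = {} \<and> card S1 = Suc i \<and> card S2 = Suc j \<and>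
            conn U (insert S2 (insert S1 F))}) =
     int (i + j choose i) * (int (card V) - int (Suc (i + j))) *
     int (card {S. S \<subseteq> V \<and> card S = Suc (i + j) \<and> conn U (insert S F)})" (is "int (card ?L) = _")
proof -
  let ?P = "comps U F"
  let ?c = "\<lambda>X. int (card (X \<inter> V))"
  have fP: "finite ?P" using finite_comps[OF F U(1)] .
  have fV: "finite V" using V U finite_subset by blast
  define A where "A = {S. S \<subseteq> V \<and> card S = Suc i \<and> card (hits ?P S) = Suc i}"
  define B where "B S1 = {S2. S2 \<subseteq> V - S1 \<and> card S2 = Suc j \<and> conn U (insert S2 (insert S1 F))}" for S1
  \<comment> \<open>The number of choices for \<open>S2\<close> once \<open>S1\<close> is a
    transversal of \<open>Q\<close>: one point in each block missed by \<open>S1\<close>, and one in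
    the merged block, where the \<open>i + 1\<close> points of \<open>S1\<close> are no longer
    available.\<close>
  define g where "g Q = ((\<Sum>X\<in>Q. ?c X) - int (Suc i)) * (\<Prod>X\<in>?P-Q. ?c X)" for Q
  have L: "?L = Sigma A B"
  proof
    show "Sigma A B \<subseteq> ?L" unfolding A_def B_def by auto
    show "?L \<subseteq> Sigma A B"
    proof
      fix p assume "p \<in> ?L"
      then obtain S1 S2 where p: "p = (S1, S2)" and S: "S1 \<subseteq> V" "S2 \<subseteq> V" "S1 \<inter> S2 = {}"
        "card S1 = Suc i" "card S2 = Suc j" "conn U (insert S2 (insert S1 F))" by auto
      have F1: "insert S1 F \<subseteq> Pow U" using S V F by auto
      have S1: "S1 \<subseteq> U" "S1 \<noteq> {}" "finite S1" using S V fV finite_subset by auto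
      \<comment> \<open>As \<open>S2\<close> has to join whatever \<open>S1\<close> leaves, at most
        \<open>j + 1\<close> blocks may remain, so \<open>S1\<close> must meet \<open>i + 1\<close>
        different blocks.\<close>
      have "card (comps U (insert S1 F)) \<le> Suc j"
        using conn_imp_card_comps_le[OF F1 U _ S(6)] S V by auto
      then have "card (hits ?P S1) \<ge> Suc i"
        using card_comps_insert[OF F U(1) S1(1,2)] k unfolding hits_def by linarith
      moreover have "card (hits ?P S1) \<le> Suc i"
        using card_hit_le[OF F S1(3)] S(4) unfolding hits_def by simp
      ultimately show "p \<in> Sigma A B" unfolding A_def B_def p using S by auto
    qed
  qed
  have fA: "finite A" unfolding A_def using fV by simp
  have cB: "int (card (B S1)) = g (hits ?P S1)" if S1: "S1 \<in> A" for S1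
  proof -
    have S: "S1 \<subseteq> V" "card S1 = Suc i" "card (hits ?P S1) = Suc i" using S1 unfolding A_def by auto
    have S': "S1 \<subseteq> U" "S1 \<noteq> {}" "finite S1" using S V fV finite_subset by auto
    have F1: "insert S1 F \<subseteq> Pow U" using S' F by auto
    have cc: "card (comps U (insert S1 F)) = Suc j"
      using card_comps_insert[OF F U(1) S'(1,2)] k S(3) unfolding hits_def by linarith
    have VS: "V - S1 \<subseteq> U" using V by auto
    have "card (B S1) = (\<Prod>X\<in>comps U (insert S1 F). card (X \<inter> (V - S1)))"
      using card_single_connecting[OF F1 U VS] unfolding B_def cc .
    also have "\<dots> = card (\<Union>(hits ?P S1) \<inter> (V - S1)) * (\<Prod>X\<in>?P - hits ?P S1. card (X \<inter> (V - S1)))"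
      by (rule prod_comps_insert[OF F U(1) S'(1,2)])
    finally have 1: "int (card (B S1)) = int (card (\<Union>(hits ?P S1) \<inter> (V - S1))) *
       (\<Prod>X\<in>?P - hits ?P S1. int (card (X \<inter> (V - S1))))" by simp
    have 2: "(\<Prod>X\<in>?P - hits ?P S1. int (card (X \<inter> (V - S1)))) = (\<Prod>X\<in>?P - hits ?P S1. ?c X)"
    proof (rule prod.cong[OF refl])
      fix X assume "X \<in> ?P - hits ?P S1"
      then have "X \<inter> (V - S1) = X \<inter> V" unfolding hits_def by blast
      then show "int (card (X \<inter> (V - S1))) = ?c X" by simp
    qed
    have sub: "S1 \<subseteq> \<Union>(hits ?P S1) \<inter> V"
    proof
      fix x assume x: "x \<in> S1"
      then obtain X where "X \<in> ?P" "x \<in> X" using S' Union_comps[OF F] by blast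
      then have "X \<in> hits ?P S1" unfolding hits_def using x by blast
      then show "x \<in> \<Union>(hits ?P S1) \<inter> V" using \<open>x \<in> X\<close> x S by blast
    qed
    have "\<Union>(hits ?P S1) \<inter> (V - S1) = (\<Union>(hits ?P S1) \<inter> V) - S1" by blast
    then have "int (card (\<Union>(hits ?P S1) \<inter> (V - S1))) = int (card (\<Union>(hits ?P S1) \<inter> V)) - int (Suc i)"
      using card_Diff_subset[OF S'(3) sub] card_mono[OF _ sub] fV S by simp
    also have "card (\<Union>(hits ?P S1) \<inter> V) = (\<Sum>X\<in>hits ?P S1. card (X \<inter> V))"
    proof -
      have "\<Union>(hits ?P S1) \<inter> V = (\<Union>X\<in>hits ?P S1. X \<inter> V)" by blast
      also have "card \<dots> = (\<Sum>X\<in>hits ?P S1. card (X \<inter> V))"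
      proof (rule card_UN_disjoint)
        show "finite (hits ?P S1)" using fP unfolding hits_def by simp
        show "\<forall>X\<in>hits ?P S1. finite (X \<inter> V)" using fV by simp
        show "\<forall>X\<in>hits ?P S1. \<forall>Y\<in>hits ?P S1. X \<noteq> Y \<longrightarrow> X \<inter> V \<inter> (Y \<inter> V) = {}"
          using comps_disjoint[OF F] unfolding hits_def by blast
      qed
      finally show ?thesis .
    qed
    finally show ?thesis using 1 2 unfolding g_def by simp
  qed
  have "int (card ?L) = (\<Sum>S1\<in>A. int (card (B S1)))"
  proof -
    have "\<forall>S1\<in>A. finite (B S1)" unfolding B_def using fV by auto
    then show ?thesis unfolding L using card_SigmaI[OF fA, of B] by simp
  qed
  also have "\<dots> = (\<Sum>S1\<in>A. g (hits ?P S1))" using cB by simp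
  also have "\<dots> = (\<Sum>Q | Q \<subseteq> ?P \<and> card Q = Suc i. (\<Prod>X\<in>Q. of_nat (card (X \<inter> V))) * g Q)"
    unfolding A_def using Union_comps[OF F] V
    by (intro sum_partial_transversals fP pairwise_disjnt_comps[OF F] fV) simp
  \<comment> \<open>Since \<open>Q\<close> has \<open>i + 1\<close> members, the
    \<open>i + 1\<close> lost points can be charged one to each block. The summand becomes additive
    over \<open>Q\<close>, and double counting applies.\<close>
  also have "\<dots> = (\<Sum>Q | Q \<subseteq> ?P \<and> card Q = Suc i. (\<Prod>X\<in>?P. ?c X) * (\<Sum>X\<in>Q. ?c X - 1))"
  proof (rule sum.cong[OF refl])
    fix Q assume Q: "Q \<in> {Q. Q \<subseteq> ?P \<and> card Q = Suc i}"
    have "(\<Prod>X\<in>?P. ?c X) = (\<Prod>X\<in>?P-Q. ?c X) * (\<Prod>X\<in>Q. ?c X)"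
      using Q by (intro prod.subset_diff fP) simp
    moreover have "(\<Sum>X\<in>Q. ?c X - 1) = (\<Sum>X\<in>Q. ?c X) - int (Suc i)"
      using Q by (simp add: sum_subtractf)
    ultimately show "(\<Prod>X\<in>Q. of_nat (card (X \<inter> V))) * g Q = (\<Prod>X\<in>?P. ?c X) * (\<Sum>X\<in>Q. ?c X - 1)"
      by (simp add: g_def)
  qed
  also have "\<dots> = (\<Prod>X\<in>?P. ?c X) * (int (i + j choose i) * (\<Sum>X\<in>?P. ?c X - 1))"
    unfolding sum_distrib_left[symmetric] sum_subsets_sum[OF fP] k by simp
  also have "(\<Sum>X\<in>?P. ?c X - 1) = int (card V) - int (Suc (i + j))"
  proof -
    have "V = (\<Union>X\<in>?P. X \<inter> V)" using Union_comps[OF F] V by blast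
    then have "card V = card (\<Union>X\<in>?P. X \<inter> V)" by simp
    also have "\<dots> = (\<Sum>X\<in>?P. card (X \<inter> V))"
      using comps_disjoint[OF F] fV by (intro card_UN_disjoint fP) blast+
    finally show ?thesis using k by (simp add: sum_subtractf)
  qed
  also have "(\<Prod>X\<in>?P. ?c X) = int (card {S. S \<subseteq> V \<and> card S = Suc (i + j) \<and> conn U (insert S F)})"
    using card_single_connecting[OF F U V] k by simp
  finally show ?thesis by (simp add: mult_ac)
qed

lemma card_comps_Un_list_le:
  assumes "finite U" "F \<subseteq> Pow U" "set Ss \<subseteq> Pow U"
  shows "card (comps U F) \<le> card (comps U (set Ss \<union> F)) + (\<Sum>S\<leftarrow>Ss. card S - 1)"
  using assms(3)
proof (induction Ss)
  case Nil
  then show ?case by simp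
next
  case (Cons S Ss)
  have "set Ss \<union> F \<subseteq> Pow U" using Cons.prems assms(2) by auto
  then have "card (comps U (set Ss \<union> F)) \<le> card (comps U (insert S (set Ss \<union> F))) + (card S - 1)"
    using card_comps_insert_le[OF assms(1)] Cons.prems by auto
  then show ?case using Cons by simp
qed

fun disj_list :: "'a set list \<Rightarrow> bool" where
  "disj_list [] \<longleftrightarrow> True"
| "disj_list (S # Ss) \<longleftrightarrow> S \<inter> \<Union>(set Ss) = {} \<and> disj_list Ss"

lemma card_Union_disj_list:
  "disj_list Ss \<Longrightarrow> \<forall>S\<in>set Ss. finite S \<Longrightarrow> card (\<Union>(set Ss)) = (\<Sum>S\<leftarrow>Ss. card S)"
  by (induction Ss) (auto simp: card_Un_disjoint)

definition disj_tuples :: "'a set \<Rightarrow> nat list \<Rightarrow> 'a set list set" where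
  "disj_tuples U Ls = {Ss. map card Ss = Ls \<and> set Ss \<subseteq> Pow U \<and> disj_list Ss}"

lemma finite_disj_tuples: "finite U \<Longrightarrow> finite (disj_tuples U Ls)"
proof (rule finite_subset)
  show "disj_tuples U Ls \<subseteq> {Ss. set Ss \<subseteq> Pow U \<and> length Ss = length Ls}"
    unfolding disj_tuples_def by (auto dest: arg_cong[where f=length])
  show "finite U \<Longrightarrow> finite {Ss. set Ss \<subseteq> Pow U \<and> length Ss = length Ls}"
    by (rule finite_lists_length_eq) simp
qed

definition conn_tuples :: "'a set \<Rightarrow> nat list \<Rightarrow> 'a set set \<Rightarrow> 'a set list set" where
  "conn_tuples U Ls F = {Ss \<in> disj_tuples U Ls. conn U (set Ss \<union> F)}"

text \<open>With more than \<open>i + j + 1\<close> blocks neither a pair nor a single set can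
  connect, and both counts vanish.\<close>

lemma card_disjoint_pairs':
  assumes F: "F \<subseteq> Pow U" and U: "finite U" "U \<noteq> {}" and V: "V \<subseteq> U"
    and k: "card (comps U F) \<ge> Suc (i + j)"
  shows "int (card {(S1, S2). S1 \<subseteq> V \<and> S2 \<subseteq> V \<and> S1 \<inter> S2 = {} \<and> card S1 = Suc i \<and> card S2 = Suc j \<and>
            conn U (insert S2 (insert S1 F))}) =
     int (i + j choose i) * (int (card V) - int (Suc (i + j))) *
     int (card {S. S \<subseteq> V \<and> card S = Suc (i + j) \<and> conn U (insert S F)})"
proof (cases "card (comps U F) = Suc (i + j)")
  case True
  then show ?thesis by (rule card_disjoint_pairs[OF F U V])
next
  case False
  have "\<not> conn U (insert S F)" if "S \<subseteq> V" "card S = Suc (i + j)" for S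
    using conn_imp_card_comps_le[OF F U, of S] that V False k by auto
  then have e1: "{S. S \<subseteq> V \<and> card S = Suc (i + j) \<and> conn U (insert S F)} = {}" by blast
  have "\<not> conn U (insert S2 (insert S1 F))"
    if S: "S1 \<subseteq> V" "S2 \<subseteq> V" "card S1 = Suc i" "card S2 = Suc j" for S1 S2
  proof
    assume c: "conn U (insert S2 (insert S1 F))"
    have "insert S1 F \<subseteq> Pow U" using S V F by auto
    then have "card (comps U (insert S1 F)) \<le> Suc j"
      using conn_imp_card_comps_le[OF _ U _ c] S V by auto
    then show False using card_comps_insert_le[OF U(1) F, of S1] S V False k by auto
  qed
  then have e2: "{(S1, S2). S1 \<subseteq> V \<and> S2 \<subseteq> V \<and> S1 \<inter> S2 = {} \<and> card S1 = Suc i \<and> card S2 = Suc j \<and>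
            conn U (insert S2 (insert S1 F))} = {}" by blast
  show ?thesis unfolding e1 e2 by simp
qed

text \<open>The remaining sets \<open>rest\<close> are fixed and joined to the family; the first two
  sets then live in the complement \<open>V rest\<close>, whose size is the same for every
  \<open>rest\<close>. Each \<open>rest\<close> leaves at least \<open>i + j + 1\<close> blocks, so
  the ratio for pairs applies to each of them separately.\<close>

lemma card_conn_tuples_merge:
  assumes F: "F \<subseteq> Pow U" and U: "finite U" "U \<noteq> {}"
    and k: "card (comps U F) = Suc (i + j + (\<Sum>L\<leftarrow>Ls. L - 1))"
  shows "int (card (conn_tuples U (Suc i # Suc j # Ls) F)) =
    int (i + j choose i) * (int (card U) - int (Suc (i + j) + sum_list Ls)) *
    int (card (conn_tuples U (Suc (i + j) # Ls) F))"
proof -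
  define R where "R = disj_tuples U Ls"
  define V where "V rest = U - \<Union>(set rest)" for rest
  define D where "D rest = {(S1, S2). S1 \<subseteq> V rest \<and> S2 \<subseteq> V rest \<and> S1 \<inter> S2 = {} \<and>
     card S1 = Suc i \<and> card S2 = Suc j \<and> conn U (insert S2 (insert S1 (set rest \<union> F)))}" for rest
  define E where "E rest = {S. S \<subseteq> V rest \<and> card S = Suc (i + j) \<and> conn U (insert S (set rest \<union> F))}" for rest
  have fR: "finite R" unfolding R_def by (rule finite_disj_tuples[OF U(1)])
  have fD: "finite (D rest)" for rest
    by (rule finite_subset[of _ "Pow U \<times> Pow U"]) (use U in \<open>auto simp: D_def V_def\<close>)
  have fE: "finite (E rest)" for rest
    by (rule finite_subset[of _ "Pow U"]) (use U in \<open>auto simp: E_def V_def\<close>)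
  have sub_Diff: "S \<subseteq> U - W \<longleftrightarrow> S \<subseteq> U \<and> S \<inter> W = {}" for S W by blast
  have mem2: "S1 # S2 # rest \<in> conn_tuples U (Suc i # Suc j # Ls) F \<longleftrightarrow> rest \<in> R \<and> (S1, S2) \<in> D rest"
    for S1 S2 rest
    unfolding conn_tuples_def disj_tuples_def R_def D_def V_def sub_Diff mem_Collect_eq prod.case
    by (simp add: Int_Un_distrib insert_commute conj_ac)
  have mem1: "S # rest \<in> conn_tuples U (Suc (i + j) # Ls) F \<longleftrightarrow> rest \<in> R \<and> S \<in> E rest" for S rest
    unfolding conn_tuples_def disj_tuples_def R_def E_def V_def sub_Diff mem_Collect_eq
    by (simp add: conj_ac)
  have "bij_betw (\<lambda>(rest, S1, S2). S1 # S2 # rest) (Sigma R D) (conn_tuples U (Suc i # Suc j # Ls) F)"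
  proof (rule bij_betwI[where g="\<lambda>Ss. (tl (tl Ss), hd Ss, hd (tl Ss))"])
    show "(\<lambda>(rest, S1, S2). S1 # S2 # rest) \<in> Sigma R D \<rightarrow> conn_tuples U (Suc i # Suc j # Ls) F"
      by (auto simp: mem2)
    show "(\<lambda>Ss. (tl (tl Ss), hd Ss, hd (tl Ss))) \<in> conn_tuples U (Suc i # Suc j # Ls) F \<rightarrow> Sigma R D"
    proof
      fix Ss assume Ss: "Ss \<in> conn_tuples U (Suc i # Suc j # Ls) F"
      then obtain S1 S2 rest where e: "Ss = S1 # S2 # rest"
        unfolding conn_tuples_def disj_tuples_def by auto
      show "(tl (tl Ss), hd Ss, hd (tl Ss)) \<in> Sigma R D"
        using Ss unfolding e mem2 by simp
    qed
    show "(\<lambda>Ss. (tl (tl Ss), hd Ss, hd (tl Ss))) ((\<lambda>(rest, S1, S2). S1 # S2 # rest) p) = p" for p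
      by (auto split: prod.splits)
    show "(\<lambda>(rest, S1, S2). S1 # S2 # rest) (tl (tl Ss), hd Ss, hd (tl Ss)) = Ss"
      if "Ss \<in> conn_tuples U (Suc i # Suc j # Ls) F" for Ss
      using that unfolding conn_tuples_def disj_tuples_def by auto
  qed
  then have c1: "card (conn_tuples U (Suc i # Suc j # Ls) F) = (\<Sum>rest\<in>R. card (D rest))"
    using bij_betw_same_card card_SigmaI[OF fR, of D] fD by fastforce
  have "bij_betw (\<lambda>(rest, S). S # rest) (Sigma R E) (conn_tuples U (Suc (i + j) # Ls) F)"
  proof (rule bij_betwI[where g="\<lambda>Ss. (tl Ss, hd Ss)"])
    show "(\<lambda>(rest, S). S # rest) \<in> Sigma R E \<rightarrow> conn_tuples U (Suc (i + j) # Ls) F"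
      by (auto simp: mem1)
    show "(\<lambda>Ss. (tl Ss, hd Ss)) \<in> conn_tuples U (Suc (i + j) # Ls) F \<rightarrow> Sigma R E"
    proof
      fix Ss assume Ss: "Ss \<in> conn_tuples U (Suc (i + j) # Ls) F"
      then obtain S rest where e: "Ss = S # rest"
        unfolding conn_tuples_def disj_tuples_def by auto
      show "(tl Ss, hd Ss) \<in> Sigma R E"
        using Ss unfolding e mem1 by simp
    qed
    show "(\<lambda>Ss. (tl Ss, hd Ss)) ((\<lambda>(rest, S). S # rest) p) = p" for p
      by (auto split: prod.splits)
    show "(\<lambda>(rest, S). S # rest) (tl Ss, hd Ss) = Ss"
      if "Ss \<in> conn_tuples U (Suc (i + j) # Ls) F" for Ss
      using that unfolding conn_tuples_def disj_tuples_def by auto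
  qed
  then have c2: "card (conn_tuples U (Suc (i + j) # Ls) F) = (\<Sum>rest\<in>R. card (E rest))"
    using bij_betw_same_card card_SigmaI[OF fR, of E] fE by fastforce
  have DE: "int (card (D rest)) = int (i + j choose i) * (int (card U) - int (Suc (i + j) + sum_list Ls)) * int (card (E rest))"
    if r: "rest \<in> R" for rest
  proof -
    have sub: "set rest \<subseteq> Pow U" and mc: "map card rest = Ls" and dj: "disj_list rest"
      using r unfolding R_def disj_tuples_def by auto
    have F': "set rest \<union> F \<subseteq> Pow U" using sub F by auto
    have "(\<Sum>S\<leftarrow>rest. card S - 1) = (\<Sum>L\<leftarrow>Ls. L - 1)" unfolding mc[symmetric] by (simp add: o_def)
    then have ge: "card (comps U (set rest \<union> F)) \<ge> Suc (i + j)"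
      using card_comps_Un_list_le[OF U(1) F sub] k by simp
    have VU: "V rest \<subseteq> U" unfolding V_def by blast
    have "int (card (V rest)) = int (card U) - int (sum_list Ls)"
    proof -
      have f: "\<forall>S\<in>set rest. finite S" using sub U(1) finite_subset by blast
      have s: "\<Union>(set rest) \<subseteq> U" using sub by blast
      have "card (\<Union>(set rest)) = sum_list Ls"
        using card_Union_disj_list[OF dj f] mc by simp
      then show ?thesis unfolding V_def
        using card_Diff_subset[OF finite_subset[OF s U(1)] s] card_mono[OF U(1) s] by simp
    qed
    then have cV: "int (card (V rest)) - int (Suc (i + j)) =
        int (card U) - int (Suc (i + j) + sum_list Ls)" by simp
    show ?thesis
      using card_disjoint_pairs'[OF F' U VU ge] unfolding D_def E_def cV .
  qed
  show ?thesis unfolding c1 c2 of_nat_sum sum_distrib_left using DE by (intro sum.cong refl)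
qed

text \<open>Induction on the number of sets: the first two are replaced by one until a single
  transversal is left. The binomial coefficients telescope to factorials; the identity is stated
  without division.\<close>

lemma card_conn_tuples:
  assumes F: "F \<subseteq> Pow U" and U: "finite U" "U \<noteq> {}"
    and k: "card (comps U F) = Suc (\<Sum>L\<leftarrow>Ls. L - 1)" and Ls: "Ls \<noteq> []" "\<forall>L\<in>set Ls. L \<ge> 1"
    and n: "sum_list Ls \<le> card U"
  shows "card (conn_tuples U Ls F) * (\<Prod>L\<leftarrow>Ls. fact (L - 1)) * fact (card U - sum_list Ls) =
     fact (\<Sum>L\<leftarrow>Ls. L - 1) * fact (card U - 1 - (\<Sum>L\<leftarrow>Ls. L - 1)) * (\<Prod>X\<in>comps U F. card X)"
  using k Ls n
proof (induction "length Ls" arbitrary: Ls rule: less_induct)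
  case less
  then obtain L Ls' where e: "Ls = L # Ls'" by (cases Ls) auto
  then obtain i where i: "L = Suc i" using less.prems by (cases L) auto
  show ?case
  proof (cases Ls')
    case Nil
    have "bij_betw (\<lambda>S. [S]) {S. S \<subseteq> U \<and> card S = card (comps U F) \<and> conn U (insert S F)} (conn_tuples U Ls F)"
      unfolding bij_betw_def
    proof
      show "inj_on (\<lambda>S. [S]) {S. S \<subseteq> U \<and> card S = card (comps U F) \<and> conn U (insert S F)}"
        by (auto intro: inj_onI)
      show "(\<lambda>S. [S]) ` {S. S \<subseteq> U \<and> card S = card (comps U F) \<and> conn U (insert S F)} = conn_tuples U Ls F"
        using less.prems unfolding e Nil i conn_tuples_def disj_tuples_def by auto
    qed
    then have "card (conn_tuples U Ls F) = card {S. S \<subseteq> U \<and> card S = card (comps U F) \<and> conn U (insert S F)}"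
      by (rule bij_betw_same_card[symmetric])
    also have "\<dots> = (\<Prod>X\<in>comps U F. card (X \<inter> U))"
      by (rule card_single_connecting[OF F U]) simp
    also have "\<dots> = (\<Prod>X\<in>comps U F. card X)"
      using comps_subset[OF F] by (intro prod.cong) (auto simp: Int_absorb2)
    finally show ?thesis by (simp add: e Nil i)
  next
    case (Cons L2 Ls2)
    then obtain j where j: "L2 = Suc j" using less.prems e by (cases L2) auto
    let ?M = "Suc (i + j) # Ls2"
    let ?r = "i + j + (\<Sum>L\<leftarrow>Ls2. L - 1)"
    let ?b = "card U - sum_list Ls"
    have IH: "card (conn_tuples U ?M F) * (\<Prod>L\<leftarrow>?M. fact (L - 1)) * fact (card U - sum_list ?M) =
     fact (\<Sum>L\<leftarrow>?M. L - 1) * fact (card U - 1 - (\<Sum>L\<leftarrow>?M. L - 1)) * (\<Prod>X\<in>comps U F. card X)"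
      by (rule less.hyps) (use less.prems e i j Cons in auto)
    \<comment> \<open>The merged set has one point less than the two sets together, so one more
      point of \<open>U\<close> stays free. The factor \<open>Suc ?b\<close> is what turns
      \<open>fact ?b\<close> into the factorial of the induction hypothesis.\<close>
    have b: "card U - sum_list ?M = Suc ?b" using less.prems e i j Cons by simp
    have "int (card (conn_tuples U Ls F)) = int (i + j choose i) * (int (card U) - int (Suc (i + j) + sum_list Ls2)) *
         int (card (conn_tuples U ?M F))"
      using card_conn_tuples_merge[OF F U, of i j Ls2] less.prems(1) unfolding e Cons i j by simp
    also have "int (card U) - int (Suc (i + j) + sum_list Ls2) = int (Suc ?b)"
      using less.prems(4) e i j Cons by simp
    finally have m: "card (conn_tuples U Ls F) = (i + j choose i) * Suc ?b * card (conn_tuples U ?M F)"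
      by (simp only: of_nat_mult[symmetric] of_nat_eq_iff)
    have bf: "(i + j choose i) * (fact i * fact j) = (fact (i + j) :: nat)"
      using binomial_fact_lemma[of i "i + j"] by (simp add: mult_ac)
    have pl: "(\<Prod>L\<leftarrow>Ls. fact (L - 1)) = fact i * (fact j * (\<Prod>L\<leftarrow>Ls2. fact (L - 1)))"
      by (simp add: e Cons i j)
    have fs: "Suc ?b * fact ?b = (fact (Suc ?b) :: nat)" by simp
    have "card (conn_tuples U Ls F) * (\<Prod>L\<leftarrow>Ls. fact (L - 1)) * fact ?b =
       card (conn_tuples U ?M F) * (((i + j choose i) * (fact i * fact j)) * (\<Prod>L\<leftarrow>Ls2. fact (L - 1))) * (Suc ?b * fact ?b)"
      unfolding m pl by (simp only: mult_ac)
    also have "\<dots> = card (conn_tuples U ?M F) * (\<Prod>L\<leftarrow>?M. fact (L - 1)) * fact (card U - sum_list ?M)"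
      unfolding bf fs b by (simp del: fact_Suc)
    also note IH
    finally show ?thesis by (simp add: e Cons i j add.assoc)
  qed
qed

subsection \<open>Families that connect a partition\<close>

definition weight :: "'a set \<Rightarrow> 'a set set \<Rightarrow> real" where
  "weight U F = real (\<Prod>X\<in>comps U F. card X)"

text \<open>
  The key invariant: whether members of \<open>X\<close>, each lowering the number of blocks by at most \<open>r\<close>,
  merge a partition with \<open>r + 1\<close> blocks into one block depends on that partition only through
  the product of its block sizes.
\<close>

definition connecting :: "'a set \<Rightarrow> ('i \<Rightarrow> 'a set set) \<Rightarrow> 'i set \<Rightarrow> nat \<Rightarrow> real \<Rightarrow> bool" where
  "connecting U E X r p \<longleftrightarrow> finite X \<and>
     (\<forall>x\<in>X. E x \<subseteq> Pow U \<and>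
        (\<forall>F. F \<subseteq> Pow U \<longrightarrow> card (comps U F) \<le> card (comps U (E x \<union> F)) + r)) \<and>
     (\<forall>F. F \<subseteq> Pow U \<longrightarrow> card (comps U F) = Suc r \<longrightarrow>
        real (card {x\<in>X. conn U (E x \<union> F)}) = p * weight U F)"

lemma connectingI:
  assumes "finite X" "\<And>x. x \<in> X \<Longrightarrow> E x \<subseteq> Pow U"
    "\<And>x F. x \<in> X \<Longrightarrow> F \<subseteq> Pow U \<Longrightarrow> card (comps U F) \<le> card (comps U (E x \<union> F)) + r"
    "\<And>F. F \<subseteq> Pow U \<Longrightarrow> card (comps U F) = Suc r \<Longrightarrow> real (card {x\<in>X. conn U (E x \<union> F)}) = p * weight U F"
  shows "connecting U E X r p"
  unfolding connecting_def using assms by blast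

lemma connectingD:
  assumes "connecting U E X r p"
  shows "finite X" "x \<in> X \<Longrightarrow> E x \<subseteq> Pow U"
    "x \<in> X \<Longrightarrow> F \<subseteq> Pow U \<Longrightarrow> card (comps U F) \<le> card (comps U (E x \<union> F)) + r"
    "F \<subseteq> Pow U \<Longrightarrow> card (comps U F) = Suc r \<Longrightarrow> real (card {x\<in>X. conn U (E x \<union> F)}) = p * weight U F"
  using assms unfolding connecting_def by blast+

lemma connecting_empty: "connecting U E {} r 0"
  by (rule connectingI) simp_all

lemma connecting_disjoint_Un:
  assumes X: "connecting U E X r p" and Y: "connecting U E Y r q" and dj: "X \<inter> Y = {}"
  shows "connecting U E (X \<union> Y) r (p + q)"
proof (rule connectingI)
  show "finite (X \<union> Y)" using connectingD(1)[OF X] connectingD(1)[OF Y] by simp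
  show "x \<in> X \<union> Y \<Longrightarrow> E x \<subseteq> Pow U" for x
    using connectingD(2)[OF X] connectingD(2)[OF Y] by blast
  show "x \<in> X \<union> Y \<Longrightarrow> F \<subseteq> Pow U \<Longrightarrow> card (comps U F) \<le> card (comps U (E x \<union> F)) + r" for x F
    using connectingD(3)[OF X] connectingD(3)[OF Y] by blast
  fix F assume F: "F \<subseteq> Pow U" "card (comps U F) = Suc r"
  have "{x\<in>X \<union> Y. conn U (E x \<union> F)} = {x\<in>X. conn U (E x \<union> F)} \<union> {x\<in>Y. conn U (E x \<union> F)}" by blast
  moreover have "card ({x\<in>X. conn U (E x \<union> F)} \<union> {x\<in>Y. conn U (E x \<union> F)}) =
      card {x\<in>X. conn U (E x \<union> F)} + card {x\<in>Y. conn U (E x \<union> F)}"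
    using connectingD(1)[OF X] connectingD(1)[OF Y] dj by (intro card_Un_disjoint) auto
  ultimately show "real (card {x\<in>X \<union> Y. conn U (E x \<union> F)}) = (p + q) * weight U F"
    using connectingD(4)[OF X F] connectingD(4)[OF Y F] by (simp add: algebra_simps)
qed

lemma connecting_UN:
  assumes "finite I" "\<And>i. i \<in> I \<Longrightarrow> connecting U E (X i) r (p i)"
    "\<And>i j. i \<in> I \<Longrightarrow> j \<in> I \<Longrightarrow> i \<noteq> j \<Longrightarrow> X i \<inter> X j = {}"
  shows "connecting U E (\<Union>i\<in>I. X i) r (\<Sum>i\<in>I. p i)"
  using assms
proof (induction I rule: finite_induct)
  case empty
  then show ?case by (simp add: connecting_empty)
next
  case (insert i I)
  have "connecting U E (X i \<union> (\<Union>i\<in>I. X i)) r (p i + (\<Sum>i\<in>I. p i))"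
    by (rule connecting_disjoint_Un) (use insert in blast)+
  then show ?case using insert by simp
qed

lemma connecting_image:
  assumes c: "connecting U E X r p" and inj: "inj_on f X"
    and eq: "\<And>x. x \<in> X \<Longrightarrow> E' (f x) = E x"
  shows "connecting U E' (f ` X) r p"
proof -
  have "card {y\<in>f ` X. conn U (E' y \<union> F)} = card {x\<in>X. conn U (E x \<union> F)}" for F
  proof -
    have "{y\<in>f ` X. conn U (E' y \<union> F)} = f ` {x\<in>X. conn U (E x \<union> F)}" using eq by auto
    then show ?thesis using card_image[of f "{x\<in>X. conn U (E x \<union> F)}"] inj inj_on_subset by fastforce
  qed
  note cd = this
  show ?thesis
  proof (rule connectingI)
    show "finite (f ` X)" using connectingD(1)[OF c] by simp
    show "y \<in> f ` X \<Longrightarrow> E' y \<subseteq> Pow U" for y using connectingD(2)[OF c] eq by force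
    show "y \<in> f ` X \<Longrightarrow> F \<subseteq> Pow U \<Longrightarrow> card (comps U F) \<le> card (comps U (E' y \<union> F)) + r" for y F
      using connectingD(3)[OF c] eq by force
    show "F \<subseteq> Pow U \<Longrightarrow> card (comps U F) = Suc r \<Longrightarrow>
        real (card {y\<in>f ` X. conn U (E' y \<union> F)}) = p * weight U F" for F
      unfolding cd by (rule connectingD(4)[OF c])
  qed
qed

lemma not_conn_if_rank_small:
  assumes U: "finite U" "U \<noteq> {}" and E: "E \<subseteq> Pow U" and F: "F \<subseteq> Pow U"
    and le: "card (comps U F) \<le> card (comps U (E \<union> F)) + r" and gt: "card (comps U F) > Suc r"
  shows "\<not> conn U (E \<union> F)"
  using conn_iff_card[OF U(2), of "E \<union> F"] E F le gt by auto

text \<open>The members of \<open>X\<close> are replaced by sets \<open>S\<close> of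
  \<open>r + 1\<close> points at the cost of the factor \<open>p\<close>. After exchanging the sums,
  the members of \<open>Y\<close> are counted by the weight of the partition enlarged by
  \<open>S\<close>. The sum over \<open>S\<close> is \<open>sum_connecting_weights\<close>, which
  supplies \<open>card U\<close> and the binomial coefficient.\<close>

lemma connecting_Times:
  assumes U: "finite U" "U \<noteq> {}"
    and X: "connecting U A X r p" and Y: "connecting U B Y s q"
  shows "connecting U (\<lambda>(x, y). A x \<union> B y) (X \<times> Y) (r + s) (p * q * real (card U) * real (r + s choose r))"
proof -
  note fX = connectingD(1)[OF X] and fY = connectingD(1)[OF Y]
  note subX = connectingD(2)[OF X] and subY = connectingD(2)[OF Y]
  note rkX = connectingD(3)[OF X] and rkY = connectingD(3)[OF Y]
  note cX = connectingD(4)[OF X] and cY = connectingD(4)[OF Y]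
  have main: "real (card {z\<in>X \<times> Y. conn U ((case z of (x, y) \<Rightarrow> A x \<union> B y) \<union> F)}) =
      p * q * real (card U) * real (r + s choose r) * weight U F"
    if F: "F \<subseteq> Pow U" and k: "card (comps U F) = Suc (r + s)" for F
  proof -
    let ?T = "{S. S \<subseteq> U \<and> card S = Suc r}"
    have fT: "finite ?T" using U by simp
    \<comment> \<open>For exactly \<open>r + 1\<close> blocks both counts are multiples of the
      weight; for more blocks both are zero.\<close>
    have TS: "real (card {x\<in>X. conn U (A x \<union> G)}) = p * real (card {S\<in>?T. conn U (insert S G)})"
      if G: "G \<subseteq> Pow U" "card (comps U G) \<ge> Suc r" for G
    proof (cases "card (comps U G) = Suc r")
      case True
      have "card {S\<in>?T. conn U (insert S G)} = card {S. S \<subseteq> U \<and> card S = card (comps U G) \<and> conn U (insert S G)}"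
        using True by (intro arg_cong[where f=card]) auto
      also have "\<dots> = (\<Prod>X\<in>comps U G. card (X \<inter> U))"
        by (rule card_single_connecting[OF G(1) U]) simp
      also have "\<dots> = (\<Prod>X\<in>comps U G. card X)"
        using comps_subset[OF G(1)] by (intro prod.cong) (auto simp: Int_absorb2)
      finally show ?thesis using cX[OF G(1) True] by (simp add: weight_def)
    next
      case False
      have "\<not> conn U (A x \<union> G)" if "x \<in> X" for x
        using not_conn_if_rank_small[OF U subX[OF that] G(1) rkX[OF that G(1)]] False G(2) by simp
      then have "{x\<in>X. conn U (A x \<union> G)} = {}" by blast
      moreover have "\<not> conn U (insert S G)" if "S \<in> ?T" for S
        using conn_imp_card_comps_le[OF G(1) U, of S] that False G(2) by auto
      then have "{S\<in>?T. conn U (insert S G)} = {}" by blast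
      ultimately show ?thesis by (simp only: card.empty)
    qed
    have "{z\<in>X \<times> Y. conn U ((case z of (x, y) \<Rightarrow> A x \<union> B y) \<union> F)} =
        prod.swap ` (SIGMA y:Y. {x\<in>X. conn U (A x \<union> (B y \<union> F))})"
      by (auto simp: Un_assoc image_iff)
    then have "card {z\<in>X \<times> Y. conn U ((case z of (x, y) \<Rightarrow> A x \<union> B y) \<union> F)} =
        card (SIGMA y:Y. {x\<in>X. conn U (A x \<union> (B y \<union> F))})"
      by (simp add: card_image)
    also have "\<dots> = (\<Sum>y\<in>Y. card {x\<in>X. conn U (A x \<union> (B y \<union> F))})"
      using fX fY by simp
    finally have "real (card {z\<in>X \<times> Y. conn U ((case z of (x, y) \<Rightarrow> A x \<union> B y) \<union> F)}) =
        (\<Sum>y\<in>Y. real (card {x\<in>X. conn U (A x \<union> (B y \<union> F))}))" by simp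
    also have "\<dots> = (\<Sum>y\<in>Y. p * real (card {S\<in>?T. conn U (insert S (B y \<union> F))}))"
    proof (rule sum.cong[OF refl])
      fix y assume y: "y \<in> Y"
      have "B y \<union> F \<subseteq> Pow U" using subY[OF y] F by auto
      moreover have "card (comps U (B y \<union> F)) \<ge> Suc r" using rkY[OF y F] k by simp
      ultimately show "real (card {x\<in>X. conn U (A x \<union> (B y \<union> F))}) =
          p * real (card {S\<in>?T. conn U (insert S (B y \<union> F))})" by (rule TS)
    qed
    also have "\<dots> = p * (\<Sum>y\<in>Y. \<Sum>S\<in>{S\<in>?T. conn U (insert S (B y \<union> F))}. 1)"
      by (simp add: sum_distrib_left)
    also have "(\<Sum>y\<in>Y. \<Sum>S\<in>{S\<in>?T. conn U (insert S (B y \<union> F))}. 1) =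
        (\<Sum>S\<in>?T. \<Sum>y\<in>{y\<in>Y. conn U (insert S (B y \<union> F))}. (1::real))"
      by (rule sum.swap_restrict[OF fY fT])
    also have "\<dots> = (\<Sum>S\<in>?T. real (card {y\<in>Y. conn U (B y \<union> insert S F)}))"
      by simp
    \<comment> \<open>Members of \<open>Y\<close> can join at most \<open>s + 1\<close> blocks, so a
      set \<open>S\<close> that meets fewer than \<open>r + 1\<close> blocks contributes
      nothing.\<close>
    also have "\<dots> = (\<Sum>S\<in>?T. if card (comps U (insert S F)) + r = card (comps U F) then q * weight U (insert S F) else 0)"
    proof (rule sum.cong[OF refl])
      fix S assume S: "S \<in> ?T"
      have F': "insert S F \<subseteq> Pow U" using S F by auto
      have ge: "card (comps U (insert S F)) \<ge> Suc s" using card_comps_insert_le[OF U(1) F, of S] S k by simp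
      show "real (card {y\<in>Y. conn U (B y \<union> insert S F)}) =
        (if card (comps U (insert S F)) + r = card (comps U F) then q * weight U (insert S F) else 0)"
      proof (cases "card (comps U (insert S F)) = Suc s")
        case True
        then show ?thesis using cY[OF F' True] k by simp
      next
        case False
        have "\<not> conn U (B y \<union> insert S F)" if "y \<in> Y" for y
          using not_conn_if_rank_small[OF U subY[OF that] F' rkY[OF that F']] False ge by simp
        then have "{y\<in>Y. conn U (B y \<union> insert S F)} = {}" by blast
        moreover have "card (comps U (insert S F)) + r \<noteq> card (comps U F)" using False k by simp
        ultimately show ?thesis by (simp only: card.empty if_False)
      qed
    qed
    also have "\<dots> = (\<Sum>S\<in>{S\<in>?T. card (comps U (insert S F)) + r = card (comps U F)}. q * weight U (insert S F))"
      by (rule sum.inter_filter[OF fT, symmetric])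
    also have "\<dots> = q * real (\<Sum>S | S \<subseteq> U \<and> card S = Suc r \<and> card (comps U (insert S F)) + r = card (comps U F).
            \<Prod>X\<in>comps U (insert S F). card X)"
      unfolding weight_def sum_distrib_left[symmetric] of_nat_sum
      by (rule arg_cong[where f="\<lambda>x. q * x"], rule sum.cong) auto
    also have "\<dots> = q * (real (r + s choose r) * real (card U) * weight U F)"
      unfolding sum_connecting_weights[OF F U] unfolding k weight_def by simp
    finally show ?thesis by (simp add: mult_ac)
  qed
  have rk: "card (comps U F) \<le> card (comps U ((A x \<union> B y) \<union> F)) + (r + s)"
    if "x \<in> X" "y \<in> Y" "F \<subseteq> Pow U" for x y F
  proof -
    have "B y \<union> F \<subseteq> Pow U" using subY that by auto
    then show ?thesis using rkY[OF that(2,3)] rkX[OF that(1), of "B y \<union> F"] by (simp add: Un_assoc)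
  qed
  show ?thesis
  proof (rule connectingI)
    show "finite (X \<times> Y)" using fX fY by simp
    fix z assume "z \<in> X \<times> Y"
    then obtain x y where z: "z = (x, y)" "x \<in> X" "y \<in> Y" by blast
    show "(case z of (x, y) \<Rightarrow> A x \<union> B y) \<subseteq> Pow U" using subX[OF z(2)] subY[OF z(3)] z(1) by simp
    show "F \<subseteq> Pow U \<Longrightarrow> card (comps U F) \<le> card (comps U ((case z of (x, y) \<Rightarrow> A x \<union> B y) \<union> F)) + (r + s)" for F
      using rk[OF z(2,3)] z(1) by simp
  qed (rule main)
qed

subsection \<open>Signed permutations and their cycles\<close>

lemma letters_uminus [simp]: "- x \<in> letters n \<longleftrightarrow> x \<in> letters n"
  by (auto simp: letters_def)

lemma letters_nonzero: "x \<in> letters n \<Longrightarrow> x \<noteq> 0"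
  by (auto simp: letters_def)

lemma letters_iff_abs: "x \<in> letters n \<longleftrightarrow> \<bar>x\<bar> \<in> {1..int n}"
  by (auto simp: letters_def)

lemma finite_letters [simp]: "finite (letters n)"
  by (rule finite_subset[of _ "{- int n..int n}"]) (auto simp: letters_def)

lemma W_B_permutes: "w \<in> W_B n \<Longrightarrow> w permutes letters n"
  by (simp add: W_B_def)

lemma W_B_uminus: "w \<in> W_B n \<Longrightarrow> w (- x) = - w x"
  by (cases "x \<in> letters n") (auto simp: W_B_def permutes_def)

lemma W_B_in_letters: "w \<in> W_B n \<Longrightarrow> w x \<in> letters n \<longleftrightarrow> x \<in> letters n"
  by (simp add: W_B_permutes permutes_in_image)

lemma W_B_inj: "w \<in> W_B n \<Longrightarrow> w x = w y \<longleftrightarrow> x = y"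
  using permutes_inj[OF W_B_permutes] by (auto dest: injD)

lemma W_B_abs_eq: "w \<in> W_B n \<Longrightarrow> \<bar>w x\<bar> = \<bar>w y\<bar> \<longleftrightarrow> \<bar>x\<bar> = \<bar>y\<bar>"
  using W_B_inj[of w n] W_B_uminus[of w n] by (metis abs_eq_iff)

lemma W_B_compose: "v \<in> W_B n \<Longrightarrow> w \<in> W_B n \<Longrightarrow> v \<circ> w \<in> W_B n"
  using W_B_uminus[of v n] W_B_uminus[of w n] by (auto simp: W_B_def intro: permutes_compose)

lemma W_B_id [simp]: "id \<in> W_B n"
  by (simp add: W_B_def)

lemma W_B_inv:
  assumes w: "w \<in> W_B n"
  shows "inv w \<in> W_B n"
proof -
  have "inv w (- i) = - inv w i" for i
    using W_B_uminus[OF w, of "inv w i"] permutes_inverses[OF W_B_permutes[OF w]] by metis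
  then show ?thesis using w by (auto simp: W_B_def intro: permutes_inv)
qed

lemma W_B_perm_prod: "set ws \<subseteq> W_B n \<Longrightarrow> perm_prod ws \<in> W_B n"
  by (induction ws) (auto simp: perm_prod_def W_B_compose)

lemma finite_W_B: "finite (W_B n)"
  by (rule finite_subset[OF _ finite_permutations[OF finite_letters]]) (auto simp: W_B_def)

lemma perm_prod_Cons: "perm_prod (w # ws) = w \<circ> perm_prod ws"
  by (simp add: perm_prod_def)

lemma perm_prod_Nil [simp]: "perm_prod [] = id"
  by (simp add: perm_prod_def)

lemma perm_prod_append: "perm_prod (vs @ ws) = perm_prod vs \<circ> perm_prod ws"
  by (induction vs) (auto simp: perm_prod_Cons comp_assoc)

text \<open>The length, counted in absolute values, and the sign picked up after one round describe
  a cycle of either kind, so that types \<open>A\<close> and \<open>B\<close> can be treated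
  together. That sign is also the sign of the permutation, see
  \<open>sign_comp_cycle\<close>.\<close>

fun comp_len :: "component \<Rightarrow> nat" where
  "comp_len (TypeA k) = Suc k"
| "comp_len (TypeB k) = k"

fun comp_sgn :: "component \<Rightarrow> int" where
  "comp_sgn (TypeA k) = 1"
| "comp_sgn (TypeB k) = - 1"

text \<open>Excludes \<open>TypeA 0\<close>, which would stand for a fixed point and is omitted from
  combinatorial types, and the empty cycle \<open>TypeB 0\<close>.\<close>

fun proper_comp :: "component \<Rightarrow> bool" where
  "proper_comp (TypeA k) \<longleftrightarrow> k \<ge> 1"
| "proper_comp (TypeB k) \<longleftrightarrow> k \<ge> 1"

fun comp_cycle :: "component \<Rightarrow> int list \<Rightarrow> int \<Rightarrow> int" where
  "comp_cycle (TypeA k) xs = A_cycle xs"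
| "comp_cycle (TypeB k) xs = B_cycle xs"

lemma comp_len_pos: "proper_comp C \<Longrightarrow> comp_len C \<ge> 1"
  by (cases C) auto

lemma cycle_of_list_nth:
  assumes "distinct cs" "i < length cs"
  shows "cycle_of_list cs (cs ! i) = cs ! (Suc i mod length cs)"
proof -
  have "map (cycle_of_list cs) cs = rotate1 cs"
    using cyclic_rotation[OF assms(1), of 1] by simp
  then show ?thesis using assms(2) nth_rotate1[of i cs] by (metis nth_map)
qed

context
  fixes xs :: "int list"
  assumes dist: "distinct (map abs xs)" and nz: "0 \<notin> set xs"
begin

lemma abs_list_distinct: "distinct xs" "distinct (map uminus xs)"
  using dist by (auto simp: distinct_map inj_on_def)

lemma uminus_notin: "y \<in> set xs \<Longrightarrow> - y \<notin> set xs"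
proof
  assume y: "y \<in> set xs" "- y \<in> set xs"
  have "inj_on abs (set xs)" using dist by (simp add: distinct_map)
  then have "- y = y" by (rule inj_onD) (use y in auto)
  then show False using y nz by simp
qed

lemma A_cycle_nth:
  assumes i: "i < length xs"
  shows "A_cycle xs (xs ! i) = xs ! (Suc i mod length xs)"
    and "A_cycle xs (- xs ! i) = - xs ! (Suc i mod length xs)"
proof -
  let ?j = "Suc i mod length xs"
  have "0 < length xs" using i by linarith
  then have j: "?j < length xs" by simp
  have "xs ! i \<notin> set (map uminus xs)" using uminus_notin[of "- xs ! i"] i uminus_notin[of "xs ! i"] by auto
  then show "A_cycle xs (xs ! i) = xs ! ?j"
    unfolding A_cycle_def using cycle_of_list_nth[OF abs_list_distinct(1) i] by (simp add: id_outside_supp)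
  have "cycle_of_list (map uminus xs) (- xs ! i) = - xs ! ?j"
    using cycle_of_list_nth[OF abs_list_distinct(2), of i] i j by simp
  moreover have "- xs ! ?j \<notin> set xs" using uminus_notin j by simp
  ultimately show "A_cycle xs (- xs ! i) = - xs ! ?j"
    unfolding A_cycle_def by (simp add: id_outside_supp)
qed

lemma B_cycle_nth:
  assumes i: "i < length xs"
  shows "B_cycle xs (xs ! i) = (if Suc i < length xs then xs ! Suc i else - xs ! 0)"
    and "B_cycle xs (- xs ! i) = (if Suc i < length xs then - xs ! Suc i else xs ! 0)"
proof -
  let ?cs = "xs @ map uminus xs"
  have d: "distinct ?cs" using abs_list_distinct uminus_notin by auto
  have len: "length ?cs = 2 * length xs" by simp
  have 1: "?cs ! i = xs ! i" using i by (simp add: nth_append)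
  have 2: "?cs ! (length xs + i) = - xs ! i" using i by (simp add: nth_append)
  have 0: "map uminus xs ! 0 = - xs ! 0" using i by (cases xs) auto
  have "Suc i mod (2 * length xs) = Suc i" using i by simp
  then show "B_cycle xs (xs ! i) = (if Suc i < length xs then xs ! Suc i else - xs ! 0)"
    using cycle_of_list_nth[OF d, of i] i unfolding B_cycle_def 1 len
    by (auto simp: nth_append 0)
  have 3: "Suc (length xs + i) mod (2 * length xs) = (if Suc i < length xs then Suc (length xs + i) else 0)"
  proof (cases "Suc i < length xs")
    case False
    then have "Suc (length xs + i) = 2 * length xs" using i by simp
    then show ?thesis using False by (simp only: mod_self if_False)
  qed simp
  show "B_cycle xs (- xs ! i) = (if Suc i < length xs then - xs ! Suc i else xs ! 0)"
    using cycle_of_list_nth[OF d, of "length xs + i"] i unfolding B_cycle_def 2 len 3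
    by (auto simp: nth_append)
qed

lemma comp_cycle_nth:
  assumes "length xs = comp_len C" "i < length xs"
  shows "comp_cycle C xs (xs ! i) = (if Suc i < length xs then xs ! Suc i else comp_sgn C * xs ! 0)"
    and "comp_cycle C xs (- xs ! i) = - (if Suc i < length xs then xs ! Suc i else comp_sgn C * xs ! 0)"
proof -
  have "Suc i mod length xs = (if Suc i < length xs then Suc i else 0)" using assms(2)
    by (cases "Suc i = length xs") auto
  then show "comp_cycle C xs (xs ! i) = (if Suc i < length xs then xs ! Suc i else comp_sgn C * xs ! 0)"
    "comp_cycle C xs (- xs ! i) = - (if Suc i < length xs then xs ! Suc i else comp_sgn C * xs ! 0)"
    using A_cycle_nth[OF assms(2)] B_cycle_nth[OF assms(2)] by (cases C; simp)+
qed

lemma abs_in_abs_set_cases: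
  assumes "\<bar>y\<bar> \<in> abs ` set xs"
  obtains i where "i < length xs" "y = xs ! i" | i where "i < length xs" "y = - xs ! i"
proof -
  from assms obtain z where "z \<in> set xs" "\<bar>y\<bar> = \<bar>z\<bar>" by auto
  then obtain i where "i < length xs" "y = xs ! i \<or> y = - xs ! i"
    by (auto simp: in_set_conv_nth abs_eq_iff)
  then show ?thesis using that by blast
qed

lemma comp_cycle_outside:
  assumes "\<bar>y\<bar> \<notin> abs ` set xs"
  shows "comp_cycle C xs y = y"
proof -
  have "y \<notin> set xs" "y \<notin> set (map uminus xs)" using assms by (auto simp: image_iff)
  then show ?thesis by (cases C) (auto simp: A_cycle_def B_cycle_def id_outside_supp)
qed

lemma comp_cycle_uminus:
  assumes "length xs = comp_len C"
  shows "comp_cycle C xs (- y) = - comp_cycle C xs y"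
proof (cases "\<bar>y\<bar> \<in> abs ` set xs")
  case True
  then show ?thesis
    by (rule abs_in_abs_set_cases) (use comp_cycle_nth[OF assms] in auto)
next
  case False
  then show ?thesis using comp_cycle_outside[of y] comp_cycle_outside[of "- y"] by simp
qed

lemma comp_cycle_abs_in:
  assumes "length xs = comp_len C" "\<bar>y\<bar> \<in> abs ` set xs"
  shows "\<bar>comp_cycle C xs y\<bar> \<in> abs ` set xs"
proof -
  have *: "\<bar>if Suc i < length xs then xs ! Suc i else comp_sgn C * xs ! 0\<bar> \<in> abs ` set xs"
    if "i < length xs" for i
  proof -
    have "xs ! 0 \<in> set xs" using that by (intro nth_mem) linarith
    then show ?thesis using that by (cases C) (auto simp: abs_mult)
  qed
  from assms(2) show ?thesis
    by (rule abs_in_abs_set_cases) (use comp_cycle_nth[OF assms(1)] * in \<open>auto simp: abs_minus_cancel\<close>)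
qed

lemma comp_cycle_W_B:
  assumes "length xs = comp_len C" "set xs \<subseteq> letters n"
  shows "comp_cycle C xs \<in> W_B n"
proof -
  have "comp_cycle C xs permutes letters n"
  proof (cases C)
    case (TypeA k)
    have "cycle_of_list xs permutes letters n" "cycle_of_list (map uminus xs) permutes letters n"
      using cycle_permutes[of xs] cycle_permutes[of "map uminus xs"] assms(2)
      by (auto elim!: permutes_subset)
    then show ?thesis using TypeA by (auto simp: A_cycle_def intro: permutes_compose)
  next
    case (TypeB k)
    have "cycle_of_list (xs @ map uminus xs) permutes letters n"
      by (rule permutes_subset[OF cycle_permutes]) (use assms(2) in auto)
    then show ?thesis using TypeB by (simp add: B_cycle_def)
  qed
  then show ?thesis using comp_cycle_uminus[OF assms(1)] by (simp add: W_B_def)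
qed

end

subsection \<open>Cycle lists\<close>

text \<open>A cycle is given by a starting letter, since \<open>w\<close> determines the rest of the
  list. The rotations of a cycle and of its negative appear as the \<open>2 * comp_len C\<close>
  possible starting letters, by which the later count divides.\<close>

definition cyc_at :: "(int \<Rightarrow> int) \<Rightarrow> component \<Rightarrow> int \<Rightarrow> bool" where
  "cyc_at w C x \<longleftrightarrow> proper_comp C \<and> inj_on (\<lambda>i. \<bar>(w ^^ i) x\<bar>) {..<comp_len C} \<and>
     (w ^^ comp_len C) x = comp_sgn C * x"

definition cyc_list :: "(int \<Rightarrow> int) \<Rightarrow> component \<Rightarrow> int \<Rightarrow> int list" where
  "cyc_list w C x = map (\<lambda>i. (w ^^ i) x) [0..<comp_len C]"

definition cyc_set :: "(int \<Rightarrow> int) \<Rightarrow> component \<Rightarrow> int \<Rightarrow> int set" where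
  "cyc_set w C x = (\<lambda>i. \<bar>(w ^^ i) x\<bar>) ` {..<comp_len C}"

lemma cyc_set_eq_list: "cyc_set w C x = abs ` set (cyc_list w C x)"
  by (auto simp: cyc_set_def cyc_list_def)

lemma length_cyc_list [simp]: "length (cyc_list w C x) = comp_len C"
  by (simp add: cyc_list_def)

context
  fixes n :: nat and w :: "int \<Rightarrow> int"
  assumes w: "w \<in> W_B n"
begin

lemma funpow_uminus: "(w ^^ i) (- x) = - (w ^^ i) x"
  by (induction i) (auto simp: W_B_uminus[OF w])

lemma funpow_in_letters: "x \<in> letters n \<Longrightarrow> (w ^^ i) x \<in> letters n"
  by (induction i) (auto simp: W_B_in_letters[OF w])

lemma funpow_abs_eq: "\<bar>(w ^^ i) x\<bar> = \<bar>(w ^^ i) y\<bar> \<longleftrightarrow> \<bar>x\<bar> = \<bar>y\<bar>"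
  by (induction i) (auto simp: W_B_abs_eq[OF w])

lemma comp_sgn_abs [simp]: "\<bar>comp_sgn C * x\<bar> = \<bar>x\<bar>"
  by (cases C) auto

lemma cyc_at_uminus: "cyc_at w C (- x) \<longleftrightarrow> cyc_at w C x"
  unfolding cyc_at_def funpow_uminus by simp

lemma cyc_set_uminus: "cyc_set w C (- x) = cyc_set w C x"
  unfolding cyc_set_def funpow_uminus by simp

lemma cyc_at_step: "cyc_at w C x \<Longrightarrow> cyc_at w C (w x)"
  unfolding cyc_at_def
proof (elim conjE, intro conjI)
  assume "proper_comp C" then show "proper_comp C" .
  assume inj: "inj_on (\<lambda>i. \<bar>(w ^^ i) x\<bar>) {..<comp_len C}"
  have e: "(w ^^ i) (w x) = w ((w ^^ i) x)" for i by (simp add: funpow_swap1)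
  show "inj_on (\<lambda>i. \<bar>(w ^^ i) (w x)\<bar>) {..<comp_len C}"
    unfolding e using inj W_B_abs_eq[OF w] by (auto simp: inj_on_def)
  assume "(w ^^ comp_len C) x = comp_sgn C * x"
  then show "(w ^^ comp_len C) (w x) = comp_sgn C * w x"
    unfolding e using W_B_uminus[OF w] by (cases C) auto
qed

lemma cyc_set_step:
  assumes "cyc_at w C x"
  shows "cyc_set w C (w x) = cyc_set w C x"
proof -
  have "(w ^^ comp_len C) x = comp_sgn C * x" "comp_len C \<ge> 1"
    using assms comp_len_pos unfolding cyc_at_def by auto
  then obtain m where m: "comp_len C = Suc m" and e: "\<bar>(w ^^ Suc m) x\<bar> = \<bar>x\<bar>"
    by (cases "comp_len C") auto
  have "cyc_set w C (w x) = (\<lambda>i. \<bar>(w ^^ i) x\<bar>) ` (Suc ` {..<Suc m})"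
    unfolding cyc_set_def m image_image by (intro image_cong) (auto simp: funpow_swap1)
  also have "Suc ` {..<Suc m} = insert (Suc m) {1..m}"
    by (simp add: lessThan_Suc image_Suc_lessThan)
  also have "(\<lambda>i. \<bar>(w ^^ i) x\<bar>) ` insert (Suc m) {1..m} = (\<lambda>i. \<bar>(w ^^ i) x\<bar>) ` insert 0 {1..m}"
    using e by simp
  also have "insert 0 {1..m} = {..<Suc m}" by auto
  finally show ?thesis unfolding cyc_set_def m .
qed

lemma cyc_at_funpow: "cyc_at w C x \<Longrightarrow> cyc_at w C ((w ^^ i) x)"
  by (induction i) (auto intro: cyc_at_step)

lemma cyc_set_funpow: "cyc_at w C x \<Longrightarrow> cyc_set w C ((w ^^ i) x) = cyc_set w C x"
  by (induction i) (auto simp: cyc_set_step cyc_at_funpow)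

lemma cyc_set_self: "cyc_at w C x \<Longrightarrow> \<bar>x\<bar> \<in> cyc_set w C x"
  using comp_len_pos[of C] unfolding cyc_set_def cyc_at_def
  by (intro image_eqI[of _ _ 0]) auto

lemma cyc_at_in_cyc_set:
  assumes "cyc_at w C x" "\<bar>y\<bar> \<in> cyc_set w C x"
  shows "cyc_at w C y" "cyc_set w C y = cyc_set w C x"
proof -
  from assms(2) obtain i where "\<bar>y\<bar> = \<bar>(w ^^ i) x\<bar>" unfolding cyc_set_def by auto
  then have "y = (w ^^ i) x \<or> y = - (w ^^ i) x" by (auto simp: abs_eq_iff)
  then show "cyc_at w C y" "cyc_set w C y = cyc_set w C x"
    using cyc_at_funpow[OF assms(1)] cyc_set_funpow[OF assms(1)] cyc_at_uminus cyc_set_uminus by auto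
qed

lemma cyc_set_closed: "cyc_at w C x \<Longrightarrow> \<bar>y\<bar> \<in> cyc_set w C x \<Longrightarrow> \<bar>w y\<bar> \<in> cyc_set w C x"
  using cyc_at_in_cyc_set cyc_at_step cyc_set_step cyc_set_self by metis

text \<open>The length is the first return of the absolute value. The sign at this return, visible
  because \<open>x\<close> is not \<open>0\<close>, tells the kind.\<close>

lemma cyc_at_unique:
  assumes C: "cyc_at w C x" and D: "cyc_at w D x" and x: "x \<noteq> 0"
  shows "C = D"
proof -
  have lt: False if "cyc_at w C x" "cyc_at w D x" "comp_len C < comp_len D" for C D
  proof -
    have "\<bar>(w ^^ comp_len C) x\<bar> = \<bar>(w ^^ 0) x\<bar>" using that(1) unfolding cyc_at_def by simp
    then have "comp_len C = 0" using that(2,3) unfolding cyc_at_def inj_on_def by auto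
    then show False using comp_len_pos[of C] that(1) unfolding cyc_at_def by simp
  qed
  have len: "comp_len C = comp_len D" using lt[OF C D] lt[OF D C] by (cases "comp_len C" "comp_len D" rule: linorder_cases) auto
  then have "comp_sgn C * x = comp_sgn D * x" using C D unfolding cyc_at_def by metis
  then show ?thesis using x len by (cases C; cases D) auto
qed

lemma cyc_set_disjoint:
  assumes C: "cyc_at w C x" and D: "cyc_at w D y" and x: "x \<in> letters n"
    and z: "z \<in> cyc_set w C x" "z \<in> cyc_set w D y"
  shows "C = D" "cyc_set w C x = cyc_set w D y"
proof -
  have "\<bar>z\<bar> = z" using z unfolding cyc_set_def by auto
  then have "cyc_at w C z" "cyc_at w D z" "cyc_set w C z = cyc_set w C x" "cyc_set w D z = cyc_set w D y"
    using cyc_at_in_cyc_set[OF C] cyc_at_in_cyc_set[OF D] z by auto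
  moreover have "z \<noteq> 0"
    using z(1) funpow_in_letters[OF x] letters_nonzero unfolding cyc_set_def by fastforce
  ultimately show "C = D" "cyc_set w C x = cyc_set w D y" using cyc_at_unique by metis+
qed

lemma cyc_set_subset: "x \<in> letters n \<Longrightarrow> cyc_set w C x \<subseteq> {1..int n}"
  using funpow_in_letters letters_iff_abs unfolding cyc_set_def by blast

lemma card_cyc_set: "cyc_at w C x \<Longrightarrow> card (cyc_set w C x) = comp_len C"
  unfolding cyc_set_def cyc_at_def by (simp add: card_image)

text \<open>The type is read off at the first return of the absolute value of \<open>x\<close>: it
  is \<open>A\<close> or \<open>B\<close> according to the sign of the letter reached there.\<close>

lemma cyc_at_exists:
  assumes x: "x \<in> letters n" "w x \<noteq> x"
  shows "\<exists>C. cyc_at w C x"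
proof -
  have "permutation w" using W_B_permutes[OF w] finite_letters permutation_permutes by blast
  then obtain N where N: "N > 0" "(w ^^ N) x = x" by (rule permutation_self)
  define m where "m = (LEAST m. m > 0 \<and> \<bar>(w ^^ m) x\<bar> = \<bar>x\<bar>)"
  have m: "m > 0" "\<bar>(w ^^ m) x\<bar> = \<bar>x\<bar>"
    using LeastI[of "\<lambda>m. m > 0 \<and> \<bar>(w ^^ m) x\<bar> = \<bar>x\<bar>" N] N unfolding m_def by auto
  have least: "\<bar>(w ^^ k) x\<bar> \<noteq> \<bar>x\<bar>" if "0 < k" "k < m" for k
    using not_less_Least[of k "\<lambda>m. m > 0 \<and> \<bar>(w ^^ m) x\<bar> = \<bar>x\<bar>"] that unfolding m_def by auto
  have lt: False if "i < j" "j < m" "\<bar>(w ^^ i) x\<bar> = \<bar>(w ^^ j) x\<bar>" for i j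
  proof -
    have "(w ^^ j) x = (w ^^ i) ((w ^^ (j - i)) x)" using that(1)
      by (metis add_diff_inverse_nat comp_apply funpow_add less_imp_le not_less)
    then have "\<bar>x\<bar> = \<bar>(w ^^ (j - i)) x\<bar>" using that(3) funpow_abs_eq[of i x] by metis
    then show False using least[of "j - i"] that(1,2) by (metis less_imp_diff_less zero_less_diff)
  qed
  have inj: "inj_on (\<lambda>i. \<bar>(w ^^ i) x\<bar>) {..<m}"
  proof (rule inj_onI)
    fix i j assume "i \<in> {..<m}" "j \<in> {..<m}" "\<bar>(w ^^ i) x\<bar> = \<bar>(w ^^ j) x\<bar>"
    then show "i = j" using lt[of i j] lt[of j i] by (cases i j rule: linorder_cases) auto
  qed
  from m(2) have "(w ^^ m) x = x \<or> (w ^^ m) x = - x" by (auto simp: abs_eq_iff)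
  then show ?thesis
  proof
    assume a: "(w ^^ m) x = x"
    \<comment> \<open>A moved letter cannot be back with its own sign after one step; this rules out
      \<open>TypeA 0\<close>.\<close>
    then have "m \<noteq> 1" using x(2) by auto
    then have "cyc_at w (TypeA (m - 1)) x" using m(1) inj a unfolding cyc_at_def by simp
    then show ?thesis ..
  next
    assume "(w ^^ m) x = - x"
    then have "cyc_at w (TypeB m) x" using m(1) inj unfolding cyc_at_def by simp
    then show ?thesis ..
  qed
qed

end

text \<open>Only empty sets can be repeated in a disjoint list; once they are excluded, disjointness
  is independent of the order.\<close>

lemma disj_list_iff:
  "\<forall>S\<in>set Ss. S \<noteq> {} \<Longrightarrow> disj_list Ss \<longleftrightarrow> distinct Ss \<and> pairwise disjnt (set Ss)"
  by (induction Ss) (auto simp: pairwise_insert disjnt_def)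

lemma disj_list_mset_eq:
  assumes "mset Ss = mset Ts" "\<forall>S\<in>set Ss. S \<noteq> {}" "disj_list Ss"
  shows "disj_list Ts"
  using assms disj_list_iff[of Ss] disj_list_iff[of Ts] mset_eq_setD[OF assms(1)]
    mset_eq_imp_distinct_iff[OF assms(1)] by simp

text \<open>Cycles given by starting letters, whereas \<open>cyc_family\<close> gives them by lists.
  Both forms are kept: lists are easy to count in total, starting letters are easy to count for a
  fixed \<open>w\<close>.\<close>

definition cyc_decomp :: "nat \<Rightarrow> (int \<Rightarrow> int) \<Rightarrow> (component \<times> int) list \<Rightarrow> bool" where
  "cyc_decomp n w qs \<longleftrightarrow> (\<forall>(C, x)\<in>set qs. x \<in> letters n \<and> cyc_at w C x) \<and>
     disj_list (map (\<lambda>(C, x). cyc_set w C x) qs) \<and>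
     (\<forall>y\<in>letters n. w y \<noteq> y \<longrightarrow> (\<exists>(C, x)\<in>set qs. \<bar>y\<bar> \<in> cyc_set w C x))"

definition cyc_family :: "nat \<Rightarrow> (component \<times> int list) list \<Rightarrow> bool" where
  "cyc_family n ps \<longleftrightarrow>
     (\<forall>(C, xs)\<in>set ps. proper_comp C \<and> length xs = comp_len C \<and> set xs \<subseteq> letters n \<and> distinct (map abs xs)) \<and>
     disj_list (map (\<lambda>(C, xs). abs ` set xs) ps)"

definition family_prod :: "(component \<times> int list) list \<Rightarrow> int \<Rightarrow> int" where
  "family_prod ps = perm_prod (map (\<lambda>(C, xs). comp_cycle C xs) ps)"

lemma family_prod_Cons: "family_prod ((C, xs) # ps) y = comp_cycle C xs (family_prod ps y)"
  by (simp add: family_prod_def perm_prod_Cons)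

lemma cyc_family_Cons:
  "cyc_family n ((C, xs) # ps) \<longleftrightarrow> proper_comp C \<and> length xs = comp_len C \<and> set xs \<subseteq> letters n \<and>
     distinct (map abs xs) \<and> (\<forall>(D, ys)\<in>set ps. abs ` set xs \<inter> abs ` set ys = {}) \<and> cyc_family n ps"
proof -
  have *: "abs ` set xs \<inter> \<Union>(set (map (\<lambda>(C, xs). abs ` set xs) ps)) = {} \<longleftrightarrow>
      (\<forall>(D, ys)\<in>set ps. abs ` set xs \<inter> abs ` set ys = {})"
    unfolding set_map case_prod_beta by blast
  show ?thesis
    unfolding cyc_family_def list.map disj_list.simps prod.case * list.set ball_simps by blast
qed

lemma cyc_familyD:
  assumes "cyc_family n ps" "(C, xs) \<in> set ps"
  shows "proper_comp C" "length xs = comp_len C" "set xs \<subseteq> letters n" "distinct (map abs xs)" "0 \<notin> set xs"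
  using assms letters_nonzero unfolding cyc_family_def by fastforce+

lemma family_prod_outside:
  "cyc_family n ps \<Longrightarrow> \<forall>(C, xs)\<in>set ps. \<bar>y\<bar> \<notin> abs ` set xs \<Longrightarrow> family_prod ps y = y"
proof (induction ps)
  case Nil
  then show ?case by (simp add: family_prod_def)
next
  case (Cons p ps)
  obtain C xs where p: "p = (C, xs)" by fastforce
  have "family_prod ps y = y" using Cons unfolding p cyc_family_Cons by simp
  moreover have "comp_cycle C xs y = y"
    using Cons.prems cyc_familyD[OF Cons.prems(1), of C xs] unfolding p
    by (intro comp_cycle_outside) auto
  ultimately show ?case by (simp add: p family_prod_Cons)
qed

lemma family_prod_inside:
  "cyc_family n ps \<Longrightarrow> (C, xs) \<in> set ps \<Longrightarrow> \<bar>y\<bar> \<in> abs ` set xs \<Longrightarrow> family_prod ps y = comp_cycle C xs y"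
proof (induction ps)
  case Nil
  then show ?case by simp
next
  case (Cons p ps)
  obtain D ys where p: "p = (D, ys)" by fastforce
  have f: "cyc_family n ps" and dj: "\<forall>(E, zs)\<in>set ps. abs ` set ys \<inter> abs ` set zs = {}"
    using Cons.prems(1) unfolding p cyc_family_Cons by auto
  note cx = cyc_familyD[OF Cons.prems(1,2)]
  have "(D, ys) \<in> set (p # ps)" by (simp add: p)
  note cy = cyc_familyD[OF Cons.prems(1) this]
  show ?case
  proof (cases "(C, xs) \<in> set ps")
    case True
    have "family_prod ps y = comp_cycle C xs y" using Cons.IH[OF f True Cons.prems(3)] .
    moreover have "\<bar>comp_cycle C xs y\<bar> \<in> abs ` set xs"
      by (rule comp_cycle_abs_in[OF cx(4,5,2) Cons.prems(3)])
    then have "\<bar>comp_cycle C xs y\<bar> \<notin> abs ` set ys" using dj True by blast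
    then have "comp_cycle D ys (comp_cycle C xs y) = comp_cycle C xs y"
      by (rule comp_cycle_outside[OF cy(4,5)])
    ultimately show ?thesis by (simp add: p family_prod_Cons)
  next
    case False
    then have e: "C = D" "xs = ys" using Cons.prems(2) p by auto
    have "family_prod ps y = y"
      by (rule family_prod_outside[OF f]) (use dj Cons.prems(3) e in blast)
    then show ?thesis by (simp add: p family_prod_Cons e)
  qed
qed

lemma family_prod_W_B: "cyc_family n ps \<Longrightarrow> family_prod ps \<in> W_B n"
  unfolding family_prod_def
proof (rule W_B_perm_prod)
  assume f: "cyc_family n ps"
  show "set (map (\<lambda>(C, xs). comp_cycle C xs) ps) \<subseteq> W_B n"
    using comp_cycle_W_B cyc_familyD[OF f] by (auto simp del: abs_list_distinct)
qed

lemma family_prod_cycle: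
  assumes f: "cyc_family n ps" and p: "(C, xs) \<in> set ps"
  shows "cyc_at (family_prod ps) C (hd xs)" "cyc_list (family_prod ps) C (hd xs) = xs"
proof -
  note c = cyc_familyD[OF f p]
  have pos: "0 < length xs" using comp_len_pos[OF c(1)] c(2) by simp
  have step: "family_prod ps (xs ! i) = (if Suc i < length xs then xs ! Suc i else comp_sgn C * xs ! 0)"
    if "i < length xs" for i
    using family_prod_inside[OF f p, of "xs ! i"] comp_cycle_nth(1)[OF c(4,5,2) that] that by simp
  have pow: "(family_prod ps ^^ i) (hd xs) = xs ! i" if "i < length xs" for i
    using that
  proof (induction i)
    case 0
    then show ?case by (simp add: hd_conv_nth)
  next
    case (Suc i)
    then show ?case using step[of i] by simp
  qed
  show l: "cyc_list (family_prod ps) C (hd xs) = xs"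
    unfolding cyc_list_def c(2)[symmetric] by (rule nth_equalityI) (auto simp: pow)
  have "inj_on (\<lambda>i. \<bar>(family_prod ps ^^ i) (hd xs)\<bar>) {..<comp_len C}"
  proof (rule inj_onI)
    fix i j assume ij: "i \<in> {..<comp_len C}" "j \<in> {..<comp_len C}"
      "\<bar>(family_prod ps ^^ i) (hd xs)\<bar> = \<bar>(family_prod ps ^^ j) (hd xs)\<bar>"
    then have "map abs xs ! i = map abs xs ! j" using pow c(2) by simp
    moreover have "i < length (map abs xs)" "j < length (map abs xs)" using ij(1,2) c(2) by simp_all
    ultimately show "i = j" using nth_eq_iff_index_eq[OF c(4)] by blast
  qed
  moreover have "(family_prod ps ^^ comp_len C) (hd xs) = comp_sgn C * hd xs"
  proof -
    have h: "hd xs = xs ! 0" using pos by (simp add: hd_conv_nth)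
    obtain m where m: "length xs = Suc m" using pos by (cases "length xs") auto
    have "(family_prod ps ^^ Suc m) (hd xs) = family_prod ps (xs ! m)" using pow[of m] m by simp
    also have "\<dots> = comp_sgn C * xs ! 0" using step[of m] m by simp
    finally show ?thesis unfolding h m c(2)[symmetric] .
  qed
  ultimately show "cyc_at (family_prod ps) C (hd xs)" using c(1) unfolding cyc_at_def by simp
qed

definition heads :: "(component \<times> int list) list \<Rightarrow> (component \<times> int) list" where
  "heads ps = map (\<lambda>(C, xs). (C, hd xs)) ps"

definition expand :: "(int \<Rightarrow> int) \<Rightarrow> (component \<times> int) list \<Rightarrow> (component \<times> int list) list" where
  "expand w qs = map (\<lambda>(C, x). (C, cyc_list w C x)) qs"

text \<open>Together with \<open>decomp_family\<close> this identifies families of disjoint cycle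
  lists with elements that carry a starting letter for each of their cycles; \<open>heads\<close>
  and \<open>expand\<close> are the two directions.\<close>

lemma family_prod_decomp:
  assumes f: "cyc_family n ps"
  shows "cyc_decomp n (family_prod ps) (heads ps)" "expand (family_prod ps) (heads ps) = ps"
proof -
  have s: "cyc_set (family_prod ps) C (hd xs) = abs ` set xs" if "(C, xs) \<in> set ps" for C xs
    unfolding cyc_set_eq_list using family_prod_cycle(2)[OF f that] by simp
  show "expand (family_prod ps) (heads ps) = ps"
    unfolding expand_def heads_def map_map
    by (rule map_idI) (use family_prod_cycle(2)[OF f] in auto)
  have "map (\<lambda>(C, x). cyc_set (family_prod ps) C x) (heads ps) = map (\<lambda>(C, xs). abs ` set xs) ps"
    unfolding heads_def map_map by (rule map_cong[OF refl]) (use s in auto)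
  then have "disj_list (map (\<lambda>(C, x). cyc_set (family_prod ps) C x) (heads ps))"
    using f unfolding cyc_family_def by simp
  moreover have "x \<in> letters n \<and> cyc_at (family_prod ps) C x" if "(C, x) \<in> set (heads ps)" for C x
  proof -
    from that obtain xs where p: "(C, xs) \<in> set ps" and x: "x = hd xs" unfolding heads_def by auto
    have "xs \<noteq> []" using comp_len_pos cyc_familyD(1,2)[OF f p] by fastforce
    then have "x \<in> letters n" using cyc_familyD(3)[OF f p] x by auto
    then show ?thesis using family_prod_cycle(1)[OF f p] x by simp
  qed
  moreover have "\<exists>(C, x)\<in>set (heads ps). \<bar>y\<bar> \<in> cyc_set (family_prod ps) C x" if "family_prod ps y \<noteq> y" for y
  proof -
    have "\<not> (\<forall>q\<in>set ps. \<bar>y\<bar> \<notin> abs ` set (snd q))"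
    proof
      assume "\<forall>q\<in>set ps. \<bar>y\<bar> \<notin> abs ` set (snd q)"
      then have "family_prod ps y = y" by (intro family_prod_outside[OF f]) (simp add: case_prod_beta)
      then show False using that by simp
    qed
    then obtain q where q: "q \<in> set ps" "\<bar>y\<bar> \<in> abs ` set (snd q)" by blast
    obtain C xs where e: "q = (C, xs)" by fastforce
    have p: "(C, xs) \<in> set ps" "\<bar>y\<bar> \<in> abs ` set xs" using q unfolding e by simp_all
    then have "(C, hd xs) \<in> set (heads ps)" unfolding heads_def by force
    moreover have "\<bar>y\<bar> \<in> cyc_set (family_prod ps) C (hd xs)" unfolding s[OF p(1)] by (rule p(2))
    ultimately show ?thesis by (intro bexI[of _ "(C, hd xs)"]) simp_all
  qed
  ultimately show "cyc_decomp n (family_prod ps) (heads ps)" unfolding cyc_decomp_def by blast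
qed

lemma cyc_decompD:
  assumes "cyc_decomp n w qs" "(C, x) \<in> set qs"
  shows "x \<in> letters n" "cyc_at w C x"
  using assms unfolding cyc_decomp_def by blast+

lemma decomp_family:
  assumes w: "w \<in> W_B n" and d: "cyc_decomp n w qs"
  shows "cyc_family n (expand w qs)" "family_prod (expand w qs) = w"
proof -
  have "disj_list (map (\<lambda>(C, xs). abs ` set xs) (expand w qs))"
  proof -
    have "map (\<lambda>(C, xs). abs ` set xs) (expand w qs) = map (\<lambda>(C, x). cyc_set w C x) qs"
      unfolding expand_def by (auto simp: cyc_set_eq_list)
    then show ?thesis using d unfolding cyc_decomp_def by simp
  qed
  moreover have "proper_comp C \<and> length xs = comp_len C \<and> set xs \<subseteq> letters n \<and> distinct (map abs xs)"
    if "(C, xs) \<in> set (expand w qs)" for C xs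
  proof -
    from that obtain x where q: "(C, x) \<in> set qs" and xs: "xs = cyc_list w C x" unfolding expand_def by auto
    note c = cyc_decompD[OF d q]
    have "distinct (map abs xs)" using c(2) unfolding xs cyc_list_def cyc_at_def
      by (auto simp: distinct_map o_def atLeast0LessThan)
    moreover have "set xs \<subseteq> letters n" using funpow_in_letters[OF w c(1)] unfolding xs cyc_list_def by auto
    ultimately show ?thesis using c(2) xs unfolding cyc_at_def by simp
  qed
  ultimately show f: "cyc_family n (expand w qs)" unfolding cyc_family_def by blast
  show "family_prod (expand w qs) = w"
  proof
    fix y
    show "family_prod (expand w qs) y = w y"
    proof (cases "\<exists>(C, x)\<in>set qs. \<bar>y\<bar> \<in> cyc_set w C x")
      case True
      then obtain C x where q: "(C, x) \<in> set qs" and y: "\<bar>y\<bar> \<in> cyc_set w C x" by blast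
      let ?xs = "cyc_list w C x"
      have p: "(C, ?xs) \<in> set (expand w qs)" using q unfolding expand_def by force
      note c = cyc_familyD[OF f p] and c' = cyc_decompD[OF d q]
      have y': "\<bar>y\<bar> \<in> abs ` set ?xs" using y unfolding cyc_set_eq_list .
      have cl: "?xs ! i = (w ^^ i) x" if "i < comp_len C" for i
        using that by (simp add: cyc_list_def)
      \<comment> \<open>Along its list \<open>w\<close> moves to the next entry, and from the last
        one back to the first with the sign of the component, exactly as the cycle does.\<close>
      have nx: "w (?xs ! i) = (if Suc i < length ?xs then ?xs ! Suc i else comp_sgn C * ?xs ! 0)"
        if i: "i < length ?xs" for i
      proof (cases "Suc i < length ?xs")
        case True
        then show ?thesis using cl[of i] cl[of "Suc i"] by simp
      next
        case False
        then have "comp_len C = Suc i" using i by simp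
        moreover have "(w ^^ comp_len C) x = comp_sgn C * x" using c'(2) unfolding cyc_at_def by blast
        ultimately have "w ((w ^^ i) x) = comp_sgn C * x" by simp
        then show ?thesis using False i cl[of i] cl[of 0] by simp
      qed
      have "comp_cycle C ?xs y = w y"
        using y'
        by (rule abs_in_abs_set_cases[OF c(4,5)])
          (use comp_cycle_nth[OF c(4,5,2)] nx W_B_uminus[OF w] in auto)
      then show ?thesis using family_prod_inside[OF f p y'] by simp
    next
      case False
      then have "family_prod (expand w qs) y = y"
        by (intro family_prod_outside[OF f]) (auto simp: expand_def cyc_set_eq_list)
      moreover have "w y = y"
      proof (cases "y \<in> letters n")
        case True
        then show ?thesis using d False unfolding cyc_decomp_def by blast
      next
        case False
        then show ?thesis using W_B_permutes[OF w] by (simp add: permutes_def)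
      qed
      ultimately show ?thesis by simp
    qed
  qed
qed

lemma cyc_decomp_mset_eq:
  assumes w: "w \<in> W_B n" and d: "cyc_decomp n w qs" and m: "mset rs = mset qs"
  shows "cyc_decomp n w rs"
proof -
  have s: "set rs = set qs" using m by (rule mset_eq_setD)
  have "disj_list (map (\<lambda>(C, x). cyc_set w C x) rs)"
  proof (rule disj_list_mset_eq)
    show "mset (map (\<lambda>(C, x). cyc_set w C x) qs) = mset (map (\<lambda>(C, x). cyc_set w C x) rs)"
      using m by (metis mset_map)
    show "disj_list (map (\<lambda>(C, x). cyc_set w C x) qs)" using d unfolding cyc_decomp_def by blast
    show "\<forall>S\<in>set (map (\<lambda>(C, x). cyc_set w C x) qs). S \<noteq> {}"
      using cyc_set_self[OF w] cyc_decompD(2)[OF d] by fastforce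
  qed
  then show ?thesis using d unfolding cyc_decomp_def s by blast
qed

lemma distinct_abs_concat_iff:
  "distinct (map abs (concat xss)) \<longleftrightarrow>
     (\<forall>xs\<in>set xss. distinct (map abs xs)) \<and> disj_list (map (\<lambda>xs. abs ` set xs) xss)" for xss :: "int list list"
  by (induction xss) (auto simp: image_iff disjoint_iff)

text \<open>Passes between the lists of the given definition, sorted into \<open>A\<close> and
  \<open>B\<close> cycles, and decompositions by starting letters.\<close>

lemma has_comb_type_iff:
  "has_comb_type n w T \<longleftrightarrow> w \<in> W_B n \<and> (\<exists>qs. cyc_decomp n w qs \<and> mset (map fst qs) = T)"
proof
  assume "has_comb_type n w T"
  then obtain as bs where as: "\<forall>xs\<in>set as. length xs \<ge> 2" and bs: "\<forall>xs\<in>set bs. length xs \<ge> 1"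
    and sub: "set (concat (as @ bs)) \<subseteq> letters n" and dist: "distinct (map abs (concat (as @ bs)))"
    and w: "w = perm_prod (map A_cycle as @ map B_cycle bs)"
    and T: "T = mset (map (\<lambda>xs. TypeA (length xs - 1)) as) + mset (map (\<lambda>xs. TypeB (length xs)) bs)"
    unfolding has_comb_type_def by blast
  define ps where "ps = map (\<lambda>xs. (TypeA (length xs - 1), xs)) as @ map (\<lambda>xs. (TypeB (length xs), xs)) bs"
  have e: "map (\<lambda>(C, xs). abs ` set xs) ps = map (\<lambda>xs. abs ` set xs) (as @ bs)"
    unfolding ps_def by simp
  have "cyc_family n ps"
    unfolding cyc_family_def e
  proof
    show "disj_list (map (\<lambda>xs. abs ` set xs) (as @ bs))" using dist unfolding distinct_abs_concat_iff by blast
    have "\<forall>xs\<in>set (as @ bs). distinct (map abs xs)" using dist unfolding distinct_abs_concat_iff by blast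
    then show "\<forall>(C, xs)\<in>set ps. proper_comp C \<and> length xs = comp_len C \<and> set xs \<subseteq> letters n \<and> distinct (map abs xs)"
      using as bs sub unfolding ps_def by auto
  qed
  moreover have "w = family_prod ps"
    unfolding w family_prod_def ps_def by (simp add: o_def)
  moreover have "mset (map fst (heads ps)) = T"
    unfolding heads_def ps_def T by (simp add: o_def)
  ultimately show "w \<in> W_B n \<and> (\<exists>qs. cyc_decomp n w qs \<and> mset (map fst qs) = T)"
    using family_prod_W_B family_prod_decomp(1) by blast
next
  assume "w \<in> W_B n \<and> (\<exists>qs. cyc_decomp n w qs \<and> mset (map fst qs) = T)"
  then obtain qs where w: "w \<in> W_B n" and d: "cyc_decomp n w qs" and T: "mset (map fst qs) = T" by blast
  define isA where "isA q = (case fst q of TypeA k \<Rightarrow> True | TypeB k \<Rightarrow> False)" for q :: "component \<times> int"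
  \<comment> \<open>The \<open>A\<close> cycles are moved to the front, as
    \<open>has_comb_type\<close> demands; a decomposition may be permuted freely.\<close>
  define rs where "rs = filter isA qs @ filter (\<lambda>q. \<not> isA q) qs"
  have m: "mset rs = mset qs" unfolding rs_def by simp
  note d' = cyc_decomp_mset_eq[OF w d m]
  note f = decomp_family[OF w d']
  define as where "as = map (\<lambda>(C, x). cyc_list w C x) (filter isA qs)"
  define bs where "bs = map (\<lambda>(C, x). cyc_list w C x) (filter (\<lambda>q. \<not> isA q) qs)"
  have e: "map (\<lambda>(C, xs). abs ` set xs) (expand w rs) = map (\<lambda>xs. abs ` set xs) (as @ bs)"
    unfolding expand_def rs_def as_def bs_def by auto
  have mem: "\<exists>C. (C, xs) \<in> set (expand w rs)" if "xs \<in> set (as @ bs)" for xs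
    using that unfolding expand_def rs_def as_def bs_def by force
  have "2 \<le> comp_len C" if "(C, x) \<in> set qs" "isA (C, x)" for C x
    using cyc_decompD(2)[OF d that(1)] that(2) unfolding isA_def cyc_at_def by (cases C) auto
  then have "\<forall>xs\<in>set as. length xs \<ge> 2" unfolding as_def by auto
  moreover have "1 \<le> comp_len C" if "(C, x) \<in> set qs" for C x
    using cyc_decompD(2)[OF d that(1)] comp_len_pos unfolding cyc_at_def by blast
  then have "\<forall>xs\<in>set bs. length xs \<ge> 1" unfolding bs_def by auto
  moreover have "set (concat (as @ bs)) \<subseteq> letters n"
    using mem cyc_familyD(3)[OF f(1)] unfolding set_concat by blast
  moreover have "distinct (map abs (concat (as @ bs)))"
    unfolding distinct_abs_concat_iff e[symmetric]
    using mem cyc_familyD(4)[OF f(1)] f(1) unfolding cyc_family_def by blast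
  moreover have "w = perm_prod (map A_cycle as @ map B_cycle bs)"
  proof -
    have "map (\<lambda>(C, xs). comp_cycle C xs) (expand w rs) = map A_cycle as @ map B_cycle bs"
      unfolding expand_def rs_def as_def bs_def isA_def by (auto split: component.splits)
    then show ?thesis using f(2) unfolding family_prod_def by simp
  qed
  moreover have "T = mset (map (\<lambda>xs. TypeA (length xs - 1)) as) + mset (map (\<lambda>xs. TypeB (length xs)) bs)"
  proof -
    have "map (\<lambda>xs. TypeA (length xs - 1)) as = map fst (filter isA qs)"
      "map (\<lambda>xs. TypeB (length xs)) bs = map fst (filter (\<lambda>q. \<not> isA q) qs)"
      unfolding as_def bs_def isA_def by (auto split: component.splits)
    then show ?thesis using T m unfolding rs_def by (metis map_append mset_append mset_map)
  qed
  ultimately show "has_comb_type n w T" unfolding has_comb_type_def by blast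
qed

text \<open>A longest list of disjoint cycles exists, because their nonempty sets are disjoint
  inside \<open>{1..int n}\<close>. A moved letter outside of it would lie on a cycle disjoint from
  all listed ones, and the list could be extended.\<close>

lemma cyc_decomp_exists:
  assumes w: "w \<in> W_B n"
  shows "\<exists>qs. cyc_decomp n w qs"
proof -
  define P where "P qs \<longleftrightarrow> (\<forall>(C, x)\<in>set qs. x \<in> letters n \<and> cyc_at w C x) \<and>
     disj_list (map (\<lambda>(C, x). cyc_set w C x) qs)" for qs
  have bound: "length qs \<le> n" if Pq: "P qs" for qs
  proof -
    let ?Ss = "map (\<lambda>(C, x). cyc_set w C x) qs"
    have sub: "\<Union>(set ?Ss) \<subseteq> {1..int n}" using Pq cyc_set_subset[OF w] unfolding P_def by fastforce
    have fin: "\<forall>S\<in>set ?Ss. finite S"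
    proof
      fix S assume "S \<in> set ?Ss"
      then have "S \<subseteq> {1..int n}" using sub by blast
      then show "finite S" by (rule finite_subset) simp
    qed
    have ge: "card S \<ge> 1" if S: "S \<in> set ?Ss" for S
    proof -
      obtain C x where Cx: "(C, x) \<in> set qs" "S = cyc_set w C x" using S by auto
      then have "cyc_at w C x" using Pq unfolding P_def by auto
      then have "S \<noteq> {}" using cyc_set_self[OF w] Cx(2) by auto
      moreover have "finite S" using fin S by blast
      ultimately show ?thesis by (simp add: Suc_le_eq card_gt_0_iff)
    qed
    have "length qs = (\<Sum>S\<leftarrow>?Ss. 1)" by (subst sum_list_triv) simp
    also have "\<dots> \<le> (\<Sum>S\<leftarrow>?Ss. card S)" using ge by (intro sum_list_mono) auto
    also have "\<dots> = card (\<Union>(set ?Ss))"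
      using Pq fin unfolding P_def by (intro card_Union_disj_list[symmetric]) auto
    also have "\<dots> \<le> card {1..int n}" by (rule card_mono[OF _ sub]) simp
    finally show ?thesis by simp
  qed
  have "P []" unfolding P_def by simp
  then obtain qs where qs: "P qs" and max: "\<And>rs. P rs \<Longrightarrow> length rs \<le> length qs"
    using ex_has_greatest_nat[of P "[]" length "Suc n"] bound by (auto simp: less_Suc_eq_le)
  have "\<exists>(C, x)\<in>set qs. \<bar>y\<bar> \<in> cyc_set w C x" if y: "y \<in> letters n" "w y \<noteq> y" for y
  proof (rule ccontr)
    assume no: "\<not> (\<exists>(C, x)\<in>set qs. \<bar>y\<bar> \<in> cyc_set w C x)"
    obtain C where C: "cyc_at w C y" using cyc_at_exists[OF w y] by blast
    have "cyc_set w C y \<inter> cyc_set w D x = {}" if "(D, x) \<in> set qs" for D x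
    proof (rule ccontr)
      assume "cyc_set w C y \<inter> cyc_set w D x \<noteq> {}"
      then obtain z where z: "z \<in> cyc_set w C y" "z \<in> cyc_set w D x" by blast
      have "cyc_at w D x" using qs that unfolding P_def by auto
      then have "cyc_set w C y = cyc_set w D x"
        using cyc_set_disjoint(2)[OF w C _ y(1) z] by simp
      then show False using no that cyc_set_self[OF w C] by auto
    qed
    then have "cyc_set w C y \<inter> \<Union>(set (map (\<lambda>(C, x). cyc_set w C x) qs)) = {}"
      by (fastforce simp: disjoint_iff)
    then have "P ((C, y) # qs)" using qs y C unfolding P_def list.map disj_list.simps prod.case by simp
    then show False using max by fastforce
  qed
  then show ?thesis using qs unfolding cyc_decomp_def P_def by blast
qed

corollary has_comb_type_exists: "w \<in> W_B n \<Longrightarrow> \<exists>T. has_comb_type n w T"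
  unfolding has_comb_type_iff using cyc_decomp_exists by blast

subsection \<open>Counting the elements of a given type\<close>

definition edges :: "nat \<Rightarrow> (int \<Rightarrow> int) \<Rightarrow> int set set" where
  "edges n w = (\<lambda>x. {x, \<bar>w x\<bar>}) ` {1..int n}"

lemma edges_subset: "w \<in> W_B n \<Longrightarrow> edges n w \<subseteq> Pow {1..int n}"
proof -
  assume w: "w \<in> W_B n"
  have "\<bar>w x\<bar> \<in> {1..int n}" if "x \<in> {1..int n}" for x
    using W_B_in_letters[OF w, of x] that unfolding letters_iff_abs by auto
  then show ?thesis unfolding edges_def by blast
qed

text \<open>Invariance in one direction is enough: on the finite set \<open>A\<close> the injective
  map \<open>\<lambda>x. \<bar>w x\<bar>\<close> is onto, so no point outside \<open>A\<close> is
  sent into \<open>A\<close>.\<close>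

lemma closed_edges_iff:
  assumes w: "w \<in> W_B n" and A: "A \<subseteq> {1..int n}"
  shows "closed_under (edges n w) A \<longleftrightarrow> (\<forall>x\<in>A. \<bar>w x\<bar> \<in> A)"
proof
  assume c: "closed_under (edges n w) A"
  show "\<forall>x\<in>A. \<bar>w x\<bar> \<in> A"
  proof
    fix x assume x: "x \<in> A"
    then have "{x, \<bar>w x\<bar>} \<in> edges n w" using A unfolding edges_def by blast
    then have "{x, \<bar>w x\<bar>} \<inter> A \<noteq> {} \<longrightarrow> {x, \<bar>w x\<bar>} \<subseteq> A"
      by (rule bspec[OF c[unfolded closed_under_def]])
    then show "\<bar>w x\<bar> \<in> A" using x by simp
  qed
next
  assume *: "\<forall>x\<in>A. \<bar>w x\<bar> \<in> A"
  have fA: "finite A" using A finite_subset by blast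
  have inj: "inj_on (\<lambda>x. \<bar>w x\<bar>) A"
  proof (rule inj_onI)
    fix x y assume xy: "x \<in> A" "y \<in> A" "\<bar>w x\<bar> = \<bar>w y\<bar>"
    then have "\<bar>x\<bar> = \<bar>y\<bar>" using W_B_abs_eq[OF w] by blast
    moreover have "x > 0" "y > 0" using xy A by auto
    ultimately show "x = y" by simp
  qed
  have "(\<lambda>x. \<bar>w x\<bar>) ` A \<subseteq> A" using * by blast
  then have im: "(\<lambda>x. \<bar>w x\<bar>) ` A = A" using endo_inj_surj[OF fA _ inj] by blast
  have hit: "{x, \<bar>w x\<bar>} \<subseteq> A" if x: "x \<in> {1..int n}" and hit: "{x, \<bar>w x\<bar>} \<inter> A \<noteq> {}" for x
  proof (cases "x \<in> A")
    case True
    then show ?thesis using * by blast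
  next
    case False
    then have wx: "\<bar>w x\<bar> \<in> A" using hit by blast
    then obtain a where a: "a \<in> A" "\<bar>w x\<bar> = \<bar>w a\<bar>" using im by (metis imageE)
    then have "\<bar>x\<bar> = \<bar>a\<bar>" using W_B_abs_eq[OF w] by blast
    moreover have "x > 0" "a > 0" using x a(1) A by auto
    ultimately have "x = a" by simp
    then show ?thesis using a(1) wx by simp
  qed
  show "closed_under (edges n w) A"
    unfolding closed_under_def
  proof (intro ballI impI)
    fix S assume "S \<in> edges n w" and S: "S \<inter> A \<noteq> {}"
    then obtain x where x: "x \<in> {1..int n}" "S = {x, \<bar>w x\<bar>}" unfolding edges_def by blast
    show "S \<subseteq> A" using hit[OF x(1)] S unfolding x(2) .
  qed
qed

abbreviation cyc_sets :: "(int \<Rightarrow> int) \<Rightarrow> (component \<times> int) list \<Rightarrow> int set list" where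
  "cyc_sets w qs \<equiv> map (\<lambda>(C, x). cyc_set w C x) qs"

text \<open>Replaces the edges of \<open>w\<close> by the sets of its cycles, so that connectivity
  becomes a question about disjoint tuples of sets.\<close>

lemma closed_edges_decomp:
  assumes w: "w \<in> W_B n" and d: "cyc_decomp n w qs" and A: "A \<subseteq> {1..int n}"
  shows "closed_under (edges n w) A \<longleftrightarrow> closed_under (set (cyc_sets w qs)) A"
proof
  assume c: "closed_under (edges n w) A"
  then have step: "\<bar>w x\<bar> \<in> A" if "x \<in> A" for x using closed_edges_iff[OF w A] that by blast
  show "closed_under (set (cyc_sets w qs)) A"
    unfolding closed_under_def
  proof (intro ballI impI)
    fix S assume S: "S \<in> set (cyc_sets w qs)" and hit: "S \<inter> A \<noteq> {}"
    then obtain C x where q: "(C, x) \<in> set qs" and e: "S = cyc_set w C x" by auto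
    note cd = cyc_decompD[OF d q]
    obtain z where z: "z \<in> S" "z \<in> A" using hit by blast
    have "\<bar>z\<bar> = z" using z(2) A by auto
    then have zs: "cyc_set w C z = S" using cyc_at_in_cyc_set(2)[OF w cd(2)] z(1) e by metis
    have "\<bar>(w ^^ i) z\<bar> \<in> A" for i
    proof (induction i)
      case 0
      then show ?case using z(2) \<open>\<bar>z\<bar> = z\<close> by simp
    next
      case (Suc i)
      have "\<bar>w \<bar>(w ^^ i) z\<bar>\<bar> = \<bar>w ((w ^^ i) z)\<bar>" using W_B_abs_eq[OF w] by simp
      then show ?case using step[OF Suc] by simp
    qed
    then show "S \<subseteq> A" unfolding zs[symmetric] cyc_set_def by blast
  qed
next
  assume c: "closed_under (set (cyc_sets w qs)) A"
  show "closed_under (edges n w) A"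
    unfolding closed_edges_iff[OF w A]
  proof
    fix y assume y: "y \<in> A"
    then have yl: "y \<in> letters n" "\<bar>y\<bar> = y" using A unfolding letters_iff_abs by auto
    show "\<bar>w y\<bar> \<in> A"
    proof (cases "w y = y")
      case True
      then show ?thesis using y yl by simp
    next
      case False
      then have "\<exists>(C, x)\<in>set qs. \<bar>y\<bar> \<in> cyc_set w C x" using d yl(1) unfolding cyc_decomp_def by blast
      then obtain C x where q: "(C, x) \<in> set qs" and yC: "\<bar>y\<bar> \<in> cyc_set w C x" by blast
      have "\<bar>w y\<bar> \<in> cyc_set w C x"
        using cyc_set_closed[OF w cyc_decompD(2)[OF d q] yC] .
      moreover have "cyc_set w C x \<in> set (cyc_sets w qs)" using q by force
      then have "cyc_set w C x \<subseteq> A" using c yC y yl(2) unfolding closed_under_def by auto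
      ultimately show ?thesis by blast
    qed
  qed
qed

text \<open>The points of a set disjoint from the others are still singleton blocks when the set is
  added, so it merges exactly \<open>card S\<close> blocks.\<close>

lemma card_comps_disj_list:
  assumes U: "finite U"
  shows "set Ss \<subseteq> Pow U \<Longrightarrow> {} \<notin> set Ss \<Longrightarrow> disj_list Ss \<Longrightarrow>
    card (comps U (set Ss)) + (\<Sum>S\<leftarrow>Ss. card S - 1) = card U"
proof (induction Ss)
  case Nil
  then show ?case by (simp add: card_comps_empty)
next
  case (Cons S Ss)
  have F: "set Ss \<subseteq> Pow U" and S: "S \<subseteq> U" "S \<noteq> {}" and dj: "S \<inter> \<Union>(set Ss) = {}"
    using Cons.prems by auto
  have single: "component_of U (set Ss) x = {x}" if x: "x \<in> S" for x
  proof -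
    have "closed_under (set Ss) {x}" using dj x unfolding closed_under_def by auto
    then have "component_of U (set Ss) x \<subseteq> {x}"
      using component_of_least[OF F] S x by blast
    then show ?thesis using component_of_self[OF F] by blast
  qed
  have "{X\<in>comps U (set Ss). X \<inter> S \<noteq> {}} = (\<lambda>x. {x}) ` S"
  proof
    show "{X\<in>comps U (set Ss). X \<inter> S \<noteq> {}} \<subseteq> (\<lambda>x. {x}) ` S"
    proof
      fix X assume X: "X \<in> {X\<in>comps U (set Ss). X \<inter> S \<noteq> {}}"
      then obtain x where x: "x \<in> X" "x \<in> S" by blast
      then have "X = {x}" using comps_eq_component[OF F, of X x] X single by simp
      then show "X \<in> (\<lambda>x. {x}) ` S" using x by blast
    qed
    show "(\<lambda>x. {x}) ` S \<subseteq> {X\<in>comps U (set Ss). X \<inter> S \<noteq> {}}"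
      using component_in_comps[OF F] single S(1) by fastforce
  qed
  then have "card {X\<in>comps U (set Ss). X \<inter> S \<noteq> {}} = card S" by (simp add: card_image)
  moreover have "card S \<ge> 1" using S U finite_subset by (auto simp: Suc_le_eq card_gt_0_iff)
  ultimately show ?case
    using card_comps_insert[OF F U S] Cons by simp
qed

text \<open>The rank after forgetting signs: a \<open>B\<close> cycle of length \<open>k\<close>
  merges \<open>k\<close> points just as an \<open>A\<close> cycle of length \<open>k\<close> does,
  and contributes \<open>k - 1\<close>.\<close>

definition A_rank :: "cox_type \<Rightarrow> nat" where
  "A_rank T = (\<Sum>C\<in>#T. comp_len C - 1)"

lemma A_rank_mset: "A_rank (mset Cs) = (\<Sum>C\<leftarrow>Cs. comp_len C - 1)"
  unfolding A_rank_def by (metis mset_map sum_mset_sum_list)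

lemma card_cyc_sets:
  assumes w: "w \<in> W_B n" and d: "cyc_decomp n w qs"
  shows "map card (cyc_sets w qs) = map (comp_len \<circ> fst) qs"
  using card_cyc_set[OF w] cyc_decompD(2)[OF d] by (auto simp: o_def)

lemma cyc_sets_props:
  assumes w: "w \<in> W_B n" and d: "cyc_decomp n w qs"
  shows "set (cyc_sets w qs) \<subseteq> Pow {1..int n}" "{} \<notin> set (cyc_sets w qs)" "disj_list (cyc_sets w qs)"
    "(\<Sum>S\<leftarrow>cyc_sets w qs. card S - 1) = A_rank (mset (map fst qs))"
proof -
  show "set (cyc_sets w qs) \<subseteq> Pow {1..int n}"
    using cyc_set_subset[OF w cyc_decompD(1)[OF d]] by fastforce
  show "{} \<notin> set (cyc_sets w qs)"
    using cyc_set_self[OF w cyc_decompD(2)[OF d]] by fastforce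
  show "disj_list (cyc_sets w qs)" using d unfolding cyc_decomp_def by blast
  have "(\<Sum>S\<leftarrow>cyc_sets w qs. card S - 1) = (\<Sum>k\<leftarrow>map card (cyc_sets w qs). k - 1)" by (simp add: o_def)
  also have "\<dots> = (\<Sum>C\<leftarrow>map fst qs. comp_len C - 1)" unfolding card_cyc_sets[OF w d] by (simp add: o_def)
  finally show "(\<Sum>S\<leftarrow>cyc_sets w qs. card S - 1) = A_rank (mset (map fst qs))" unfolding A_rank_mset .
qed

lemma comps_edges_decomp:
  assumes w: "w \<in> W_B n" and d: "cyc_decomp n w qs"
  shows "comps {1..int n} (edges n w \<union> F) = comps {1..int n} (set (cyc_sets w qs) \<union> F)"
  by (rule comps_cong) (simp add: closed_edges_decomp[OF w d])

lemma card_comps_edges: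
  assumes "has_comb_type n w T"
  shows "card (comps {1..int n} (edges n w)) + A_rank T = n"
proof -
  obtain qs where w: "w \<in> W_B n" and d: "cyc_decomp n w qs" and T: "mset (map fst qs) = T"
    using assms unfolding has_comb_type_iff by blast
  have "comps {1..int n} (edges n w) = comps {1..int n} (set (cyc_sets w qs))"
    using comps_edges_decomp[OF w d, of "{}"] by simp
  then show ?thesis
    using card_comps_disj_list[of "{1..int n}" "cyc_sets w qs"] cyc_sets_props[OF w d] T by simp
qed

lemma card_comps_edges_Un_ge:
  assumes "has_comb_type n w T" and F: "F \<subseteq> Pow {1..int n}"
  shows "card (comps {1..int n} F) \<le> card (comps {1..int n} (edges n w \<union> F)) + A_rank T"
proof -
  obtain qs where w: "w \<in> W_B n" and d: "cyc_decomp n w qs" and T: "mset (map fst qs) = T"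
    using assms unfolding has_comb_type_iff by blast
  show ?thesis
    unfolding comps_edges_decomp[OF w d]
    using card_comps_Un_list_le[of "{1..int n}", OF _ F cyc_sets_props(1)[OF w d]]
      cyc_sets_props(4)[OF w d] T by simp
qed

lemma card_letters_over:
  assumes S: "S \<subseteq> {1..int n}"
  shows "card {y \<in> letters n. \<bar>y\<bar> \<in> S} = 2 * card S"
proof -
  have fS: "finite S" using S finite_subset by blast
  have pos: "x > 0" if "x \<in> S" for x using S that by auto
  have "{y \<in> letters n. \<bar>y\<bar> \<in> S} = S \<union> uminus ` S"
  proof
    show "{y \<in> letters n. \<bar>y\<bar> \<in> S} \<subseteq> S \<union> uminus ` S"
    proof
      fix y assume "y \<in> {y \<in> letters n. \<bar>y\<bar> \<in> S}"
      then have "y \<in> S \<or> - y \<in> S" by (auto simp: abs_if split: if_splits)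
      then show "y \<in> S \<union> uminus ` S" by force
    qed
    show "S \<union> uminus ` S \<subseteq> {y \<in> letters n. \<bar>y\<bar> \<in> S}"
      using S pos unfolding letters_def by fastforce
  qed
  moreover have "S \<inter> uminus ` S = {}"
  proof (rule ccontr)
    assume "S \<inter> uminus ` S \<noteq> {}"
    then obtain y where "y \<in> S" "- y \<in> S" by auto
    then show False using pos[of y] pos[of "- y"] by simp
  qed
  ultimately show ?thesis using fS by (simp add: card_Un_disjoint card_image)
qed

lemma disj_list_map_filter: "disj_list (map f xs) \<Longrightarrow> disj_list (map f (filter P xs))"
  by (induction xs) auto

section \<open>Choices of starting letters for the cycles of a fixed element\<close>

context
  fixes n :: nat and w :: "int \<Rightarrow> int"
  assumes w: "w \<in> W_B n"
begin

text \<open>Decompositions in which cycles may still be missing, so that lists of starting letters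
  can be built one cycle at a time.\<close>

definition partial_decomp :: "(component \<times> int) list \<Rightarrow> bool" where
  "partial_decomp qs \<longleftrightarrow> (\<forall>(C, x)\<in>set qs. x \<in> letters n \<and> cyc_at w C x) \<and> disj_list (cyc_sets w qs)"

definition cyc_heads :: "component \<Rightarrow> int set" where
  "cyc_heads C = {x \<in> letters n. cyc_at w C x}"

definition covered :: "component \<Rightarrow> (component \<times> int) list \<Rightarrow> int set" where
  "covered C qs = {y \<in> letters n. \<bar>y\<bar> \<in> \<Union>(set (cyc_sets w (filter (\<lambda>q. fst q = C) qs)))}"

lemma card_covered:
  assumes "partial_decomp qs"
  shows "card (covered C qs) = 2 * comp_len C * count (mset (map fst qs)) C"
proof -
  let ?qs = "filter (\<lambda>q. fst q = C) qs"
  have at: "x \<in> letters n" "cyc_at w D x" if "(D, x) \<in> set qs" for D x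
    using assms that unfolding partial_decomp_def by blast+
  have sub: "\<Union>(set (cyc_sets w ?qs)) \<subseteq> {1..int n}" using cyc_set_subset[OF w at(1)] by fastforce
  have fin: "\<forall>S\<in>set (cyc_sets w ?qs). finite S"
  proof
    fix S assume "S \<in> set (cyc_sets w ?qs)"
    then have "S \<subseteq> {1..int n}" using sub by blast
    then show "finite S" by (rule finite_subset) simp
  qed
  have "card (covered C qs) = 2 * card (\<Union>(set (cyc_sets w ?qs)))"
    unfolding covered_def by (rule card_letters_over[OF sub])
  also have "card (\<Union>(set (cyc_sets w ?qs))) = (\<Sum>S\<leftarrow>cyc_sets w ?qs. card S)"
    using assms fin unfolding partial_decomp_def by (intro card_Union_disj_list disj_list_map_filter) auto
  also have "\<dots> = (\<Sum>q\<leftarrow>?qs. comp_len C)"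
  proof -
    have "map card (cyc_sets w ?qs) = map (\<lambda>q. comp_len C) ?qs"
      using card_cyc_set[OF w at(2)] by auto
    then show ?thesis by (rule arg_cong[where f=sum_list])
  qed
  also have "\<dots> = comp_len C * length ?qs" by (simp add: sum_list_triv)
  also have "length ?qs = count (mset (map fst qs)) C"
    by (induction qs) auto
  finally show ?thesis by simp
qed

lemma finite_cyc_heads: "finite (cyc_heads C)"
  unfolding cyc_heads_def by (rule finite_subset[OF _ finite_letters[of n]]) auto

lemma covered_subset_heads:
  assumes "partial_decomp qs"
  shows "covered C qs \<subseteq> cyc_heads C"
proof
  fix y assume y: "y \<in> covered C qs"
  then obtain x where "(C, x) \<in> set qs" "\<bar>y\<bar> \<in> cyc_set w C x" unfolding covered_def by auto
  then show "y \<in> cyc_heads C"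
    using assms cyc_at_in_cyc_set(1)[OF w] y unfolding partial_decomp_def covered_def cyc_heads_def by auto
qed

text \<open>Cycles are equal or disjoint, so a new starting letter collides with the list exactly
  when its own cycle is already present.\<close>

lemma covered_iff:
  assumes p: "partial_decomp qs" and y: "y \<in> cyc_heads C"
  shows "y \<in> covered C qs \<longleftrightarrow> cyc_set w C y \<inter> \<Union>(set (cyc_sets w qs)) \<noteq> {}"
proof
  have yl: "y \<in> letters n" "cyc_at w C y" using y unfolding cyc_heads_def by auto
  assume "y \<in> covered C qs"
  then obtain x where x: "(C, x) \<in> set qs" "\<bar>y\<bar> \<in> cyc_set w C x" unfolding covered_def by auto
  then have "\<bar>y\<bar> \<in> \<Union>(set (cyc_sets w qs))" by force
  then show "cyc_set w C y \<inter> \<Union>(set (cyc_sets w qs)) \<noteq> {}" using cyc_set_self[OF w yl(2)] by blast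
next
  have yl: "y \<in> letters n" "cyc_at w C y" using y unfolding cyc_heads_def by auto
  assume "cyc_set w C y \<inter> \<Union>(set (cyc_sets w qs)) \<noteq> {}"
  then obtain z S where z: "z \<in> cyc_set w C y" "z \<in> S" and "S \<in> set (cyc_sets w qs)" by blast
  then obtain D x where q: "(D, x) \<in> set qs" and S: "S = cyc_set w D x" by auto
  have at: "cyc_at w D x" using p q unfolding partial_decomp_def by blast
  note e = cyc_set_disjoint[OF w yl(2) at yl(1) z(1) z(2)[unfolded S]]
  have "\<bar>y\<bar> \<in> cyc_set w C x" using cyc_set_self[OF w yl(2)] e by simp
  moreover have "(C, x) \<in> set (filter (\<lambda>q. fst q = C) qs)" using q e(1) by simp
  then have "cyc_set w C x \<in> set (cyc_sets w (filter (\<lambda>q. fst q = C) qs))" by force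
  ultimately show "y \<in> covered C qs" unfolding covered_def using yl(1) by blast
qed

lemma cyc_heads_moved:
  assumes "y \<in> cyc_heads C"
  shows "w y \<noteq> y"
proof
  assume f: "w y = y"
  have y: "y \<in> letters n" "cyc_at w C y" using assms unfolding cyc_heads_def by auto
  have i: "(w ^^ i) y = y" for i by (induction i) (auto simp: f)
  have inj: "inj_on (\<lambda>i. \<bar>(w ^^ i) y\<bar>) {..<comp_len C}" and s: "(w ^^ comp_len C) y = comp_sgn C * y"
    and pr: "proper_comp C" using y(2) unfolding cyc_at_def by auto
  show False
  proof (cases C)
    case (TypeA k)
    then have "(0::nat) = 1" by (intro inj_onD[OF inj]) (use pr i f in auto)
    then show False by simp
  next
    case (TypeB k)
    then show False using s letters_nonzero[OF y(1)] unfolding i by simp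
  qed
qed

lemma cyc_decomp_partial: "cyc_decomp n w qs \<Longrightarrow> partial_decomp qs"
  unfolding cyc_decomp_def partial_decomp_def by blast

lemma covered_full:
  assumes d: "cyc_decomp n w qs"
  shows "covered C qs = cyc_heads C"
proof
  show "covered C qs \<subseteq> cyc_heads C" by (rule covered_subset_heads[OF cyc_decomp_partial[OF d]])
  show "cyc_heads C \<subseteq> covered C qs"
  proof
    fix y assume y: "y \<in> cyc_heads C"
    then have yl: "y \<in> letters n" "cyc_at w C y" unfolding cyc_heads_def by auto
    have "\<exists>(C, x)\<in>set qs. \<bar>y\<bar> \<in> cyc_set w C x"
      using d cyc_heads_moved[OF y] yl(1) unfolding cyc_decomp_def by blast
    then have "\<bar>y\<bar> \<in> \<Union>(set (cyc_sets w qs))" by auto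
    then show "y \<in> covered C qs"
      using covered_iff[OF cyc_decomp_partial[OF d] y] cyc_set_self[OF w yl(2)] by blast
  qed
qed

lemma card_cyc_heads:
  "cyc_decomp n w qs \<Longrightarrow> card (cyc_heads C) = 2 * comp_len C * count (mset (map fst qs)) C"
  using card_covered[OF cyc_decomp_partial] covered_full by metis

text \<open>For each \<open>C\<close> the listed cycles use as many letters as a full decomposition
  does, so none can be missing.\<close>

lemma partial_decomp_full:
  assumes d: "cyc_decomp n w qs" and p: "partial_decomp rs"
    and m: "mset (map fst rs) = mset (map fst qs)"
  shows "cyc_decomp n w rs"
proof -
  have cov: "covered C rs = cyc_heads C" for C
    using card_subset_eq[OF finite_cyc_heads covered_subset_heads[OF p]]
      card_covered[OF p] card_cyc_heads[OF d] m by simp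
  have "\<exists>(C, x)\<in>set rs. \<bar>y\<bar> \<in> cyc_set w C x" if y: "y \<in> letters n" "w y \<noteq> y" for y
  proof -
    obtain C where "cyc_at w C y" using cyc_at_exists[OF w y] by blast
    then have "y \<in> covered C rs" using cov y(1) unfolding cyc_heads_def by blast
    then obtain x where "(C, x) \<in> set rs" "\<bar>y\<bar> \<in> cyc_set w C x" unfolding covered_def by auto
    then show ?thesis by blast
  qed
  then show ?thesis using p unfolding partial_decomp_def cyc_decomp_def by blast
qed

definition head_lists :: "component list \<Rightarrow> int list set" where
  "head_lists Cs = {hs. length hs = length Cs \<and> partial_decomp (zip Cs hs)}"

lemma finite_head_lists: "finite (head_lists Cs)"
proof (rule finite_subset)
  show "head_lists Cs \<subseteq> {hs. set hs \<subseteq> letters n \<and> length hs = length Cs}"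
  proof
    fix hs assume h: "hs \<in> head_lists Cs"
    have "x \<in> letters n" if x: "x \<in> set hs" for x
    proof -
      have "x \<in> set (map snd (zip Cs hs))" using h x unfolding head_lists_def by simp
      then obtain C where "(C, x) \<in> set (zip Cs hs)" by auto
      then show ?thesis using h unfolding head_lists_def partial_decomp_def by blast
    qed
    then show "hs \<in> {hs. set hs \<subseteq> letters n \<and> length hs = length Cs}"
      using h unfolding head_lists_def by auto
  qed
  show "finite {hs. set hs \<subseteq> letters n \<and> length hs = length Cs}"
    by (rule finite_lists_length_eq) simp
qed

text \<open>Starting letters are chosen one after the other. For the next \<open>C\<close> there are
  \<open>2 * comp_len C\<close> letters in each \<open>C\<close> cycle not yet listed. The
  multiplicities produce falling factorials, expressed through the factorials of what is
  left.\<close>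

lemma card_head_lists:
  assumes d: "cyc_decomp n w qs" and T: "mset (map fst qs) = T"
  shows "mset Cs \<subseteq># T \<Longrightarrow>
     card (head_lists Cs) * (\<Prod>C\<in>set_mset T. fact (count T C - count (mset Cs) C)) =
     (\<Prod>C\<leftarrow>Cs. 2 * comp_len C) * (\<Prod>C\<in>set_mset T. fact (count T C))"
proof (induction Cs)
  case Nil
  have "head_lists [] = {[]}" unfolding head_lists_def partial_decomp_def by auto
  then show ?case by simp
next
  case (Cons C Cs)
  have sub: "mset Cs \<subseteq># T" 
  proof -
    have "mset Cs \<subseteq># mset (C # Cs)" by simp
    then show ?thesis using Cons.prems by (rule subset_mset.order_trans)
  qed
  have lt: "count (mset Cs) C < count T C"
    using mset_subset_eq_count[OF Cons.prems, of C] by simp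
  have CT: "C \<in># T" 
  proof (rule ccontr)
    assume "C \<notin># T"
    then have "count T C = 0" by (simp add: not_in_iff)
    then show False using lt by simp
  qed
  have "bij_betw (\<lambda>(hs, x). x # hs) (SIGMA hs:head_lists Cs. cyc_heads C - covered C (zip Cs hs)) (head_lists (C # Cs))"
  proof (rule bij_betwI[where g="\<lambda>hs. (tl hs, hd hs)"])
    have mem: "x # hs \<in> head_lists (C # Cs) \<longleftrightarrow> hs \<in> head_lists Cs \<and> x \<in> cyc_heads C - covered C (zip Cs hs)" for x hs
    proof (cases "length hs = length Cs \<and> partial_decomp (zip Cs hs)")
      case True
      have "x # hs \<in> head_lists (C # Cs) \<longleftrightarrow> x \<in> cyc_heads C \<and> cyc_set w C x \<inter> \<Union>(set (cyc_sets w (zip Cs hs))) = {}"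
        using True unfolding head_lists_def partial_decomp_def cyc_heads_def by simp
      also have "\<dots> \<longleftrightarrow> x \<in> cyc_heads C - covered C (zip Cs hs)"
        using covered_iff[of "zip Cs hs" x C] True by blast
      finally show ?thesis using True unfolding head_lists_def by blast
    next
      case False
      then show ?thesis unfolding head_lists_def partial_decomp_def by auto
    qed
    show "(\<lambda>(hs, x). x # hs) \<in> (SIGMA hs:head_lists Cs. cyc_heads C - covered C (zip Cs hs)) \<rightarrow> head_lists (C # Cs)"
      using mem by auto
    show "(\<lambda>hs. (tl hs, hd hs)) \<in> head_lists (C # Cs) \<rightarrow> (SIGMA hs:head_lists Cs. cyc_heads C - covered C (zip Cs hs))"
    proof
      fix ys assume ys: "ys \<in> head_lists (C # Cs)"
      then obtain x hs where e: "ys = x # hs" unfolding head_lists_def by (cases ys) auto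
      show "(tl ys, hd ys) \<in> (SIGMA hs:head_lists Cs. cyc_heads C - covered C (zip Cs hs))"
        using ys mem unfolding e by simp
    qed
    show "(\<lambda>(hs, x). x # hs) (tl ys, hd ys) = ys" if "ys \<in> head_lists (C # Cs)" for ys
      using that unfolding head_lists_def by (cases ys) auto
  qed auto
  then have "card (head_lists (C # Cs)) = card (SIGMA hs:head_lists Cs. cyc_heads C - covered C (zip Cs hs))"
    by (rule bij_betw_same_card[symmetric])
  also have "\<dots> = (\<Sum>hs\<in>head_lists Cs. card (cyc_heads C - covered C (zip Cs hs)))"
    using finite_head_lists finite_cyc_heads by (intro card_SigmaI) auto
  also have "\<dots> = (\<Sum>hs\<in>head_lists Cs. 2 * comp_len C * (count T C - count (mset Cs) C))"
  proof (rule sum.cong[OF refl])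
    fix hs assume hs: "hs \<in> head_lists Cs"
    then have p: "partial_decomp (zip Cs hs)" and l: "length hs = length Cs" unfolding head_lists_def by auto
    have "card (cyc_heads C - covered C (zip Cs hs)) = card (cyc_heads C) - card (covered C (zip Cs hs))"
      using covered_subset_heads[OF p] finite_cyc_heads finite_subset by (intro card_Diff_subset) blast+
    also have "\<dots> = 2 * comp_len C * count T C - 2 * comp_len C * count (mset Cs) C"
      unfolding card_covered[OF p] card_cyc_heads[OF d] T using l by simp
    finally show "card (cyc_heads C - covered C (zip Cs hs)) = 2 * comp_len C * (count T C - count (mset Cs) C)"
      by (simp only: diff_mult_distrib2)
  qed
  finally have c: "card (head_lists (C # Cs)) = card (head_lists Cs) * (2 * comp_len C * (count T C - count (mset Cs) C))"
    by simp
  let ?f = "\<lambda>Ds D. fact (count T D - count (mset Ds) D) :: nat"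
  have fT: "finite (set_mset T)" by simp
  have rest: "(\<Prod>D\<in>set_mset T - {C}. ?f (C # Cs) D) = (\<Prod>D\<in>set_mset T - {C}. ?f Cs D)"
    by (rule prod.cong) auto
  have "(count T C - count (mset Cs) C) * ?f (C # Cs) C = ?f Cs C"
  proof -
    obtain k where "count T C - count (mset Cs) C = Suc k" using lt by (cases "count T C - count (mset Cs) C") auto
    moreover from this have "count T C - count (mset (C # Cs)) C = k" by simp
    ultimately show ?thesis by simp
  qed
  then have e: "(count T C - count (mset Cs) C) * (\<Prod>D\<in>set_mset T. ?f (C # Cs) D) = (\<Prod>D\<in>set_mset T. ?f Cs D)"
    unfolding prod.remove[OF fT CT] rest by (simp only: mult.assoc[symmetric])
  have "card (head_lists (C # Cs)) * (\<Prod>D\<in>set_mset T. ?f (C # Cs) D) =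
      2 * comp_len C * (card (head_lists Cs) * (\<Prod>D\<in>set_mset T. ?f Cs D))"
    unfolding c e[symmetric] by (simp only: mult_ac)
  then show ?case using Cons.IH[OF sub] by (simp add: mult_ac)
qed

end

text \<open>The number of letters on cycles of type \<open>C\<close> depends only on
  \<open>w\<close> and determines the multiplicity of \<open>C\<close>. Improper components, for
  which \<open>comp_len\<close> may vanish, do not occur.\<close>

lemma has_comb_type_unique:
  assumes "has_comb_type n w T" "has_comb_type n w T'"
  shows "T = T'"
proof (rule multiset_eqI)
  fix C
  obtain qs rs where w: "w \<in> W_B n" and q: "cyc_decomp n w qs" "mset (map fst qs) = T"
    and r: "cyc_decomp n w rs" "mset (map fst rs) = T'"
    using assms unfolding has_comb_type_iff by blast
  have e: "comp_len C * count T C = comp_len C * count T' C"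
    using card_cyc_heads[OF w q(1), of C, unfolded q(2)]
      card_cyc_heads[OF w r(1), of C, unfolded r(2)] by linarith
  show "count T C = count T' C"
  proof (cases "proper_comp C")
    case True
    then show ?thesis using e comp_len_pos by fastforce
  next
    case False
    then have "C \<notin># mset (map fst qs)" "C \<notin># mset (map fst rs)"
      using cyc_decompD(2)[OF q(1)] cyc_decompD(2)[OF r(1)] unfolding cyc_at_def by auto
    then show ?thesis unfolding q(2) r(2) not_in_iff by simp
  qed
qed

lemma has_comb_type_proper: "has_comb_type n w T \<Longrightarrow> C \<in># T \<Longrightarrow> proper_comp C"
  unfolding has_comb_type_iff using cyc_decompD(2) unfolding cyc_at_def by fastforce

section \<open>Lists of signed cycles that connect a partition\<close>

lemma card_sign_choices:
  fixes ys :: "int list"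
  assumes "\<forall>y\<in>set ys. y > 0"
  shows "finite {xs. map abs xs = ys} \<and> card {xs. map abs xs = ys} = 2 ^ length ys"
  using assms
proof (induction ys)
  case Nil
  then show ?case by simp
next
  case (Cons y ys)
  have "{xs. map abs xs = y # ys} = (\<lambda>(x, xs). x # xs) ` ({y, - y} \<times> {xs. map abs xs = ys})"
  proof
    show "{xs. map abs xs = y # ys} \<subseteq> (\<lambda>(x, xs). x # xs) ` ({y, - y} \<times> {xs. map abs xs = ys})"
    proof
      fix zs assume "zs \<in> {xs. map abs xs = y # ys}"
      then obtain x xs where z: "zs = x # xs" "\<bar>x\<bar> = y" "map abs xs = ys" by (auto simp: map_eq_Cons_conv)
      then have "x = y \<or> x = - y" by auto
      then show "zs \<in> (\<lambda>(x, xs). x # xs) ` ({y, - y} \<times> {xs. map abs xs = ys})" using z by force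
    qed
    show "(\<lambda>(x, xs). x # xs) ` ({y, - y} \<times> {xs. map abs xs = ys}) \<subseteq> {xs. map abs xs = y # ys}"
      using Cons.prems by auto
  qed
  moreover have "inj_on (\<lambda>(x, xs). x # xs) ({y, - y} \<times> {xs. map abs xs = ys})"
    by (auto simp: inj_on_def)
  moreover have "card {y, - y} = 2" using Cons.prems by auto
  ultimately show ?case using Cons by (simp add: card_image card_cartesian_product)
qed

definition arrangements :: "int set \<Rightarrow> int list set" where
  "arrangements S = {xs. distinct (map abs xs) \<and> abs ` set xs = S}"

lemma card_arrangements:
  assumes S: "finite S" "\<forall>x\<in>S. x > 0"
  shows "finite (arrangements S)" "card (arrangements S) = fact (card S) * 2 ^ card S"
proof -
  have e: "arrangements S = (\<Union>ys\<in>permutations_of_set S. {xs. map abs xs = ys})"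
    unfolding arrangements_def permutations_of_set_def by auto
  have len: "length ys = card S" if "ys \<in> permutations_of_set S" for ys
    using that distinct_card[of ys] unfolding permutations_of_set_def by auto
  have *: "finite {xs. map abs xs = ys}" "card {xs. map abs xs = ys} = 2 ^ card S"
    if "ys \<in> permutations_of_set S" for ys
  proof -
    have "\<forall>y\<in>set ys. y > 0" using that S unfolding permutations_of_set_def by auto
    then show "finite {xs. map abs xs = ys}" "card {xs. map abs xs = ys} = 2 ^ card S"
      using card_sign_choices[of ys] len[OF that] by auto
  qed
  have fin: "finite (permutations_of_set S)" by simp
  show "finite (arrangements S)" unfolding e using fin *(1) by blast
  have "card (arrangements S) = (\<Sum>ys\<in>permutations_of_set S. card {xs. map abs xs = ys})"
    unfolding e by (rule card_UN_disjoint) (use fin *(1) in auto)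
  also have "\<dots> = fact (card S) * 2 ^ card S" using *(2) S by simp
  finally show "card (arrangements S) = fact (card S) * 2 ^ card S" .
qed

definition list_arrangements :: "int set list \<Rightarrow> int list list set" where
  "list_arrangements Ss = {xss. map (\<lambda>xs. abs ` set xs) xss = Ss \<and> (\<forall>xs\<in>set xss. distinct (map abs xs))}"

lemma card_list_arrangements:
  assumes "\<forall>S\<in>set Ss. finite S \<and> (\<forall>x\<in>S. x > 0)"
  shows "finite (list_arrangements Ss) \<and>
    card (list_arrangements Ss) = (\<Prod>S\<leftarrow>Ss. fact (card S) * 2 ^ card S)"
  using assms
proof (induction Ss)
  case Nil
  have "list_arrangements [] = {[]}" unfolding list_arrangements_def by auto
  then show ?case by simp
next
  case (Cons S Ss)
  have "list_arrangements (S # Ss) = (\<lambda>(x, xs). x # xs) ` (arrangements S \<times> list_arrangements Ss)"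
    unfolding list_arrangements_def arrangements_def by (auto simp: map_eq_Cons_conv image_iff)
  moreover have "inj_on (\<lambda>(x, xs). x # xs) (arrangements S \<times> list_arrangements Ss)"
    by (auto simp: inj_on_def)
  ultimately show ?case
    using Cons card_arrangements[of S] by (simp add: card_image card_cartesian_product)
qed

definition conn_families :: "nat \<Rightarrow> component list \<Rightarrow> int set set \<Rightarrow> int list list set" where
  "conn_families n Cs F = {xss. length xss = length Cs \<and> cyc_family n (zip Cs xss) \<and>
     conn {1..int n} (set (map (\<lambda>xs. abs ` set xs) xss) \<union> F)}"

lemma conn_families_iff:
  assumes Cs: "\<forall>C\<in>set Cs. proper_comp C"
  shows "xss \<in> conn_families n Cs F \<longleftrightarrow>
    map (\<lambda>xs. abs ` set xs) xss \<in> conn_tuples {1..int n} (map comp_len Cs) F \<and>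
    (\<forall>xs\<in>set xss. distinct (map abs xs))"
proof -
  have sub: "set xs \<subseteq> letters n \<longleftrightarrow> abs ` set xs \<subseteq> {1..int n}" for xs
    unfolding subset_iff letters_iff_abs by auto
  have cd: "card (abs ` set xs) = length xs" if "distinct (map abs xs)" for xs :: "int list"
    using distinct_card[OF that] by simp
  have fam: "cyc_family n (zip Cs xss) \<longleftrightarrow> map length xss = map comp_len Cs \<and>
      (\<forall>xs\<in>set xss. abs ` set xs \<subseteq> {1..int n} \<and> distinct (map abs xs)) \<and> disj_list (map (\<lambda>xs. abs ` set xs) xss)"
    if l: "length xss = length Cs"
  proof -
    have m: "map (\<lambda>(C, xs). abs ` set xs) (zip Cs xss) = map (\<lambda>xs. abs ` set xs) xss"
      using l by (intro nth_equalityI) auto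
    have "(\<forall>(C, xs)\<in>set (zip Cs xss). proper_comp C \<and> length xs = comp_len C \<and> set xs \<subseteq> letters n \<and> distinct (map abs xs))
      \<longleftrightarrow> (\<forall>i<length Cs. length (xss ! i) = comp_len (Cs ! i) \<and> abs ` set (xss ! i) \<subseteq> {1..int n} \<and> distinct (map abs (xss ! i)))"
      using l Cs unfolding sub by (fastforce simp: set_zip)
    also have "\<dots> \<longleftrightarrow> map length xss = map comp_len Cs \<and> (\<forall>xs\<in>set xss. abs ` set xs \<subseteq> {1..int n} \<and> distinct (map abs xs))"
      using l by (auto simp: list_eq_iff_nth_eq all_set_conv_all_nth)
    finally show ?thesis unfolding cyc_family_def m by blast
  qed
  have len: "length xss = length Cs" if "map length xss = map comp_len Cs"
    using that by (metis length_map)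
  have crd: "map card (map (\<lambda>xs. abs ` set xs) xss) = map length xss" if "\<forall>xs\<in>set xss. distinct (map abs xs)"
    using that cd by simp
  show ?thesis
  proof
    assume a: "xss \<in> conn_families n Cs F"
    then have l: "length xss = length Cs" and f: "cyc_family n (zip Cs xss)"
      and c: "conn {1..int n} (set (map (\<lambda>xs. abs ` set xs) xss) \<union> F)" unfolding conn_families_def by auto
    have d: "\<forall>xs\<in>set xss. distinct (map abs xs)" using f fam[OF l] by blast
    have "map card (map (\<lambda>xs. abs ` set xs) xss) = map comp_len Cs" unfolding crd[OF d] using f fam[OF l] by blast
    moreover have "set (map (\<lambda>xs. abs ` set xs) xss) \<subseteq> Pow {1..int n}" using f fam[OF l] by auto
    ultimately show "map (\<lambda>xs. abs ` set xs) xss \<in> conn_tuples {1..int n} (map comp_len Cs) F \<and>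
      (\<forall>xs\<in>set xss. distinct (map abs xs))"
      using c d f fam[OF l] unfolding conn_tuples_def disj_tuples_def by blast
  next
    assume a: "map (\<lambda>xs. abs ` set xs) xss \<in> conn_tuples {1..int n} (map comp_len Cs) F \<and>
      (\<forall>xs\<in>set xss. distinct (map abs xs))"
    then have m: "map length xss = map comp_len Cs" and dj: "disj_list (map (\<lambda>xs. abs ` set xs) xss)"
      and s: "set (map (\<lambda>xs. abs ` set xs) xss) \<subseteq> Pow {1..int n}"
      and c: "conn {1..int n} (set (map (\<lambda>xs. abs ` set xs) xss) \<union> F)"
      using crd unfolding conn_tuples_def disj_tuples_def by (simp_all del: map_map)
    have "\<forall>xs\<in>set xss. abs ` set xs \<subseteq> {1..int n} \<and> distinct (map abs xs)" using a s by auto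
    then show "xss \<in> conn_families n Cs F"
      unfolding conn_families_def using len[OF m] fam[OF len[OF m]] m dj c by blast
  qed
qed

text \<open>A set of \<open>k\<close> absolute values can be written as a cycle list in
  \<open>fact k\<close> orders with \<open>2 ^ k\<close> choices of signs.\<close>

lemma card_conn_families:
  assumes Cs: "\<forall>C\<in>set Cs. proper_comp C"
  shows "card (conn_families n Cs F) =
    card (conn_tuples {1..int n} (map comp_len Cs) F) * (\<Prod>C\<leftarrow>Cs. fact (comp_len C) * 2 ^ comp_len C)"
proof -
  let ?T = "conn_tuples {1..int n} (map comp_len Cs) F"
  have e: "conn_families n Cs F = (\<Union>Ss\<in>?T. list_arrangements Ss)"
    using conn_families_iff[OF Cs] unfolding list_arrangements_def by blast
  have fT: "finite ?T" unfolding conn_tuples_def by (simp add: finite_disj_tuples)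
  have c: "finite (list_arrangements Ss) \<and>
      card (list_arrangements Ss) = (\<Prod>C\<leftarrow>Cs. fact (comp_len C) * 2 ^ comp_len C)" if Ss: "Ss \<in> ?T" for Ss
  proof -
    have m: "map card Ss = map comp_len Cs" and s: "set Ss \<subseteq> Pow {1..int n}"
      using Ss unfolding conn_tuples_def disj_tuples_def by auto
    have "finite S \<and> (\<forall>x\<in>S. x > 0)" if "S \<in> set Ss" for S
    proof -
      have "S \<subseteq> {1..int n}" using s that by blast
      then show ?thesis using finite_subset by fastforce
    qed
    then have "finite (list_arrangements Ss) \<and>
      card (list_arrangements Ss) = (\<Prod>S\<leftarrow>Ss. fact (card S) * 2 ^ card S)" using card_list_arrangements by blast
    moreover have "(\<Prod>S\<leftarrow>Ss. fact (card S) * 2 ^ card S) = (\<Prod>k\<leftarrow>map card Ss. fact k * 2 ^ k :: nat)"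
      by (simp add: o_def)
    ultimately show ?thesis unfolding m by (simp add: o_def)
  qed
  have "card (conn_families n Cs F) = (\<Sum>Ss\<in>?T. card (list_arrangements Ss))"
    unfolding e by (rule card_UN_disjoint[OF fT]) (use c in \<open>auto simp: list_arrangements_def\<close>)
  also have "\<dots> = (\<Sum>Ss\<in>?T. \<Prod>C\<leftarrow>Cs. fact (comp_len C) * 2 ^ comp_len C)"
    by (rule sum.cong) (use c in auto)
  finally show ?thesis by simp
qed

definition typed_conn :: "nat \<Rightarrow> cox_type \<Rightarrow> int set set \<Rightarrow> (int \<Rightarrow> int) set" where
  "typed_conn n T F = {w. has_comb_type n w T \<and> conn {1..int n} (edges n w \<union> F)}"

lemma conn_edges_decomp:
  "w \<in> W_B n \<Longrightarrow> cyc_decomp n w qs \<Longrightarrow>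
    conn {1..int n} (edges n w \<union> F) \<longleftrightarrow> conn {1..int n} (set (cyc_sets w qs) \<union> F)"
  unfolding conn_def using comps_edges_decomp by metis

lemma has_comb_type_W_B: "has_comb_type n w T \<Longrightarrow> w \<in> W_B n"
  by (simp add: has_comb_type_iff)

lemma finite_typed_conn: "finite (typed_conn n T F)"
  by (rule finite_subset[OF _ finite_W_B[of n]]) (auto simp: typed_conn_def has_comb_type_W_B)

text \<open>Connecting lists of cycles are counted twice: by their tuples of sets, and by their
  product \<open>w\<close> together with the first entries. Each \<open>w\<close> occurs once for
  every admissible list of starting letters.\<close>

lemma card_typed_conn:
  assumes Cs: "\<forall>C\<in>set Cs. proper_comp C"
  shows "card (typed_conn n (mset Cs) F) * ((\<Prod>C\<leftarrow>Cs. 2 * comp_len C) * (\<Prod>C\<in>set Cs. fact (count (mset Cs) C))) =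
    card (conn_tuples {1..int n} (map comp_len Cs) F) * (\<Prod>C\<leftarrow>Cs. fact (comp_len C) * 2 ^ comp_len C)"
proof -
  let ?R = "SIGMA w:typed_conn n (mset Cs) F. head_lists n w Cs"
  have dec: "hs \<in> head_lists n w Cs \<longleftrightarrow> length hs = length Cs \<and> cyc_decomp n w (zip Cs hs)"
    if T: "has_comb_type n w (mset Cs)" for w hs
  proof -
    obtain qs where w: "w \<in> W_B n" and q: "cyc_decomp n w qs" "mset (map fst qs) = mset Cs"
      using T unfolding has_comb_type_iff by blast
    have "mset (map fst (zip Cs hs)) = mset (map fst qs)" if "length hs = length Cs"
      unfolding q(2) using that by (metis map_fst_zip)
    then show ?thesis
      unfolding head_lists_def[OF w]
      using partial_decomp_full[OF w q(1), of "zip Cs hs"] cyc_decomp_partial[OF w, of "zip Cs hs"] by blast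
  qed
  have "bij_betw (\<lambda>xss. (family_prod (zip Cs xss), map hd xss)) (conn_families n Cs F) ?R"
  proof (rule bij_betwI[where g="\<lambda>(w, hs). map snd (expand w (zip Cs hs))"])
    show "(\<lambda>xss. (family_prod (zip Cs xss), map hd xss)) \<in> conn_families n Cs F \<rightarrow> ?R"
    proof
      fix xss assume "xss \<in> conn_families n Cs F"
      then have l: "length xss = length Cs" and f: "cyc_family n (zip Cs xss)"
        and c: "conn {1..int n} (set (map (\<lambda>xs. abs ` set xs) xss) \<union> F)" unfolding conn_families_def by auto
      let ?w = "family_prod (zip Cs xss)"
      have w: "?w \<in> W_B n" by (rule family_prod_W_B[OF f])
      have h: "heads (zip Cs xss) = zip Cs (map hd xss)"
        unfolding heads_def using l by (intro nth_equalityI) auto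
      note d = family_prod_decomp[OF f, unfolded h]
      have T: "has_comb_type n ?w (mset Cs)"
        unfolding has_comb_type_iff using w d(1) l by (metis length_map map_fst_zip)
      have "cyc_sets ?w (zip Cs (map hd xss)) = map (\<lambda>(C, xs). abs ` set xs) (expand ?w (zip Cs (map hd xss)))"
        unfolding expand_def by (auto simp: cyc_set_eq_list)
      also have "\<dots> = map (\<lambda>xs. abs ` set xs) xss"
        unfolding d(2) using l by (intro nth_equalityI) auto
      finally have "conn {1..int n} (edges n ?w \<union> F)"
        using conn_edges_decomp[OF w d(1)] c by simp
      then show "(?w, map hd xss) \<in> ?R"
        unfolding typed_conn_def using T dec[OF T] d(1) l by simp
    qed
    show "(\<lambda>(w, hs). map snd (expand w (zip Cs hs))) \<in> ?R \<rightarrow> conn_families n Cs F"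
    proof
      fix p assume "p \<in> ?R"
      then obtain w hs where p: "p = (w, hs)" and T: "has_comb_type n w (mset Cs)"
        and c: "conn {1..int n} (edges n w \<union> F)" and h: "hs \<in> head_lists n w Cs"
        unfolding typed_conn_def by auto
      have w: "w \<in> W_B n" using has_comb_type_W_B[OF T] .
      have l: "length hs = length Cs" and d: "cyc_decomp n w (zip Cs hs)" using dec[OF T] h by auto
      note f = decomp_family[OF w d]
      have z: "zip Cs (map snd (expand w (zip Cs hs))) = expand w (zip Cs hs)"
        unfolding expand_def using l by (intro nth_equalityI) auto
      have "map (\<lambda>xs. abs ` set xs) (map snd (expand w (zip Cs hs))) = cyc_sets w (zip Cs hs)"
        unfolding expand_def by (auto simp: cyc_set_eq_list)
      then have "conn {1..int n} (set (map (\<lambda>xs. abs ` set xs) (map snd (expand w (zip Cs hs)))) \<union> F)"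
        using conn_edges_decomp[OF w d] c by metis
      moreover have "length (map snd (expand w (zip Cs hs))) = length Cs" unfolding expand_def using l by simp
      ultimately have "map snd (expand w (zip Cs hs)) \<in> conn_families n Cs F"
        unfolding conn_families_def mem_Collect_eq z using f(1) by blast
      then show "(case p of (w, hs) \<Rightarrow> map snd (expand w (zip Cs hs))) \<in> conn_families n Cs F"
        unfolding p by simp
    qed
    show "(case (family_prod (zip Cs xss), map hd xss) of (w, hs) \<Rightarrow> map snd (expand w (zip Cs hs))) = xss"
      if "xss \<in> conn_families n Cs F" for xss
    proof -
      have l: "length xss = length Cs" and f: "cyc_family n (zip Cs xss)" using that unfolding conn_families_def by auto
      have h: "heads (zip Cs xss) = zip Cs (map hd xss)"
        unfolding heads_def using l by (intro nth_equalityI) auto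
      show ?thesis using family_prod_decomp(2)[OF f, unfolded h] l by simp
    qed
    show "(family_prod (zip Cs (case p of (w, hs) \<Rightarrow> map snd (expand w (zip Cs hs)))),
        map hd (case p of (w, hs) \<Rightarrow> map snd (expand w (zip Cs hs)))) = p" if "p \<in> ?R" for p
    proof -
      obtain w hs where p: "p = (w, hs)" and T: "has_comb_type n w (mset Cs)"
        and h: "hs \<in> head_lists n w Cs"
        using \<open>p \<in> ?R\<close> unfolding typed_conn_def by auto
      have w: "w \<in> W_B n" using has_comb_type_W_B[OF T] .
      have l: "length hs = length Cs" and d: "cyc_decomp n w (zip Cs hs)" using dec[OF T] h by auto
      have z: "zip Cs (map snd (expand w (zip Cs hs))) = expand w (zip Cs hs)"
        unfolding expand_def using l by (intro nth_equalityI) auto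
      have "hd (cyc_list w (Cs ! i) x) = x" if "i < length Cs" for i x
        using Cs comp_len_pos that unfolding cyc_list_def by (simp add: hd_map hd_upt Suc_le_eq)
      then have "map hd (map snd (expand w (zip Cs hs))) = hs"
        unfolding expand_def using l by (intro nth_equalityI) auto
      then show ?thesis unfolding p using z decomp_family(2)[OF w d] by simp
    qed
  qed
  then have "card (conn_families n Cs F) = card ?R" by (rule bij_betw_same_card)
  also have "\<dots> = (\<Sum>w\<in>typed_conn n (mset Cs) F. card (head_lists n w Cs))"
    using finite_head_lists has_comb_type_W_B unfolding typed_conn_def
    by (intro card_SigmaI finite_typed_conn[unfolded typed_conn_def]) auto
  also have "\<dots> = (\<Sum>w\<in>typed_conn n (mset Cs) F. (\<Prod>C\<leftarrow>Cs. 2 * comp_len C) * (\<Prod>C\<in>set Cs. fact (count (mset Cs) C)))"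
  proof (rule sum.cong[OF refl])
    fix w assume "w \<in> typed_conn n (mset Cs) F"
    then obtain qs where w: "w \<in> W_B n" and q: "cyc_decomp n w qs" "mset (map fst qs) = mset Cs"
      unfolding typed_conn_def has_comb_type_iff by blast
    show "card (head_lists n w Cs) = (\<Prod>C\<leftarrow>Cs. 2 * comp_len C) * (\<Prod>C\<in>set Cs. fact (count (mset Cs) C))"
      using card_head_lists[OF w q, of Cs] by simp
  qed
  finally show ?thesis unfolding card_conn_families[OF Cs] by simp
qed

definition total_len :: "cox_type \<Rightarrow> nat" where
  "total_len T = (\<Sum>C\<in>#T. comp_len C)"

lemma total_len_mset: "total_len (mset Cs) = sum_list (map comp_len Cs)"
  unfolding total_len_def by (metis mset_map sum_mset_sum_list)

text \<open>The quotient of the two counts. A set of size \<open>k\<close> carries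
  \<open>fact k * 2 ^ k\<close> lists, of which \<open>2 * k\<close> describe the same cycle. The
  remaining \<open>fact (k - 1)\<close> cancels against the number of connecting tuples, and the
  \<open>2 ^ (k - 1)\<close> multiply to \<open>2 ^ A_rank T\<close>. Cycles of total length above
  \<open>n\<close> do not fit, hence the zero.\<close>

definition type_coeff :: "nat \<Rightarrow> cox_type \<Rightarrow> real" where
  "type_coeff n T = (if total_len T \<le> n
     then 2 ^ A_rank T * fact (A_rank T) * fact (n - 1 - A_rank T) /
       (fact (n - total_len T) * (\<Prod>C\<in>set_mset T. fact (count T C)))
     else 0)"

lemma conn_tuples_too_long:
  assumes "finite U" "card U < sum_list Ls"
  shows "conn_tuples U Ls F = {}"
proof -
  have "sum_list Ls \<le> card U" if Ss: "Ss \<in> disj_tuples U Ls" for Ss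
  proof -
    have sub: "\<Union>(set Ss) \<subseteq> U" and dj: "disj_list Ss" and m: "map card Ss = Ls"
      using Ss unfolding disj_tuples_def by auto
    have fin: "\<forall>S\<in>set Ss. finite S"
    proof
      fix S assume "S \<in> set Ss"
      then have "S \<subseteq> U" using sub by blast
      then show "finite S" using assms(1) by (rule finite_subset)
    qed
    have "sum_list Ls = card (\<Union>(set Ss))" using card_Union_disj_list[OF dj fin] m by simp
    then show ?thesis using card_mono[OF assms(1) sub] by simp
  qed
  then show ?thesis using assms(2) unfolding conn_tuples_def by fastforce
qed

lemma prod_fact_split:
  assumes "\<forall>C\<in>set Cs. proper_comp C"
  shows "(\<Prod>C\<leftarrow>Cs. fact (comp_len C) * 2 ^ comp_len C) =
    (\<Prod>C\<leftarrow>Cs. 2 * comp_len C) * ((\<Prod>L\<leftarrow>map comp_len Cs. fact (L - 1)) * 2 ^ (\<Sum>C\<leftarrow>Cs. comp_len C - 1) :: nat)"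
  using assms
proof (induction Cs)
  case (Cons C Cs)
  obtain k where k: "comp_len C = Suc k" using comp_len_pos[of C] Cons.prems by (cases "comp_len C") auto
  have "fact (comp_len C) * 2 ^ comp_len C = (2 * comp_len C) * (fact (comp_len C - 1) * 2 ^ (comp_len C - 1) :: nat)"
    by (simp add: k algebra_simps)
  then show ?case using Cons by (simp add: power_add mult_ac)
qed simp

lemma card_typed_conn_eq:
  assumes n: "n \<ge> 1" and T: "\<forall>C\<in>#T. proper_comp C" and F: "F \<subseteq> Pow {1..int n}"
    and k: "card (comps {1..int n} F) = Suc (A_rank T)"
  shows "real (card (typed_conn n T F)) = type_coeff n T * weight {1..int n} F"
proof -
  let ?U = "{1..int n}"
  obtain Cs where Cs: "mset Cs = T" using ex_mset by blast
  have pr: "\<forall>C\<in>set Cs. proper_comp C" using T Cs by auto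
  define p where "p = (\<Prod>C\<leftarrow>Cs. 2 * comp_len C)"
  define q where "q = (\<Prod>L\<leftarrow>map comp_len Cs. fact (L - 1) :: nat)"
  define f where "f = (\<Prod>C\<in>set Cs. fact (count (mset Cs) C) :: nat)"
  have p0: "p > 0" unfolding p_def using pr comp_len_pos by (induction Cs) (auto simp: Suc_le_eq)
  have q0: "q > 0" unfolding q_def by (induction Cs) auto
  have f0: "f > 0" unfolding f_def by (rule prod_pos) simp
  have r: "(\<Sum>C\<leftarrow>Cs. comp_len C - 1) = A_rank T" unfolding Cs[symmetric] A_rank_mset ..
  have "card (typed_conn n T F) * (p * f) = card (conn_tuples ?U (map comp_len Cs) F) * (p * (q * 2 ^ A_rank T))"
    using card_typed_conn[OF pr, of n F] unfolding prod_fact_split[OF pr] Cs r p_def q_def f_def .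
  then have main: "card (typed_conn n T F) * f = card (conn_tuples ?U (map comp_len Cs) F) * q * 2 ^ A_rank T"
    using p0 by (simp add: mult_ac)
  have f: "(\<Prod>C\<in>set_mset T. fact (count T C)) = real f" unfolding f_def Cs[symmetric] by simp
  have len: "total_len T = sum_list (map comp_len Cs)" unfolding Cs[symmetric] total_len_mset ..
  show ?thesis
  proof (cases "total_len T \<le> n")
    case False
    then have "conn_tuples ?U (map comp_len Cs) F = {}" by (intro conn_tuples_too_long) (auto simp: len)
    then have "card (typed_conn n T F) * f = 0" using main by simp
    then show ?thesis using False f0 by (simp add: type_coeff_def)
  next
    case True
    have ne: "?U \<noteq> {}" using n by simp
    have "card (conn_tuples ?U (map comp_len Cs) F) * q * fact (n - total_len T) =
        fact (A_rank T) * fact (n - 1 - A_rank T) * (\<Prod>X\<in>comps ?U F. card X)"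
    \<comment> \<open>The merging induction ends with one set, so the identity, with its empty list
      of cycles, is treated apart: \<open>F\<close> is already connected and the claim is
      \<open>fact n = n * fact (n - 1)\<close>.\<close>
    proof (cases "Cs = []")
      case True
      have "A_rank T = 0" unfolding r[symmetric] True by simp
      then have c: "conn ?U F" using conn_iff_card[OF ne F] k by simp
      then have "conn_tuples ?U (map comp_len Cs) F = {[]}"
        unfolding True conn_tuples_def disj_tuples_def by auto
      moreover have "(\<Prod>X\<in>comps ?U F. card X) = n" using c unfolding conn_def by simp
      moreover have "fact n = n * (fact (n - 1) :: nat)" using n by (metis fact_reduce less_eq_Suc_le One_nat_def of_nat_id)
      ultimately show ?thesis using \<open>A_rank T = 0\<close> unfolding q_def len True by simp
    next
      case False
      have s: "(\<Sum>L\<leftarrow>map comp_len Cs. L - 1) = A_rank T" unfolding r[symmetric] by (simp add: o_def)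
      show ?thesis
        using card_conn_tuples[OF F _ ne, of "map comp_len Cs"] k False pr comp_len_pos True
        unfolding s q_def len by simp
    qed
    then have "real (card (typed_conn n T F)) * real f * fact (n - total_len T) =
        2 ^ A_rank T * (fact (A_rank T) * fact (n - 1 - A_rank T) * weight ?U F)"
    proof -
      assume a: "card (conn_tuples ?U (map comp_len Cs) F) * q * fact (n - total_len T) =
        fact (A_rank T) * fact (n - 1 - A_rank T) * (\<Prod>X\<in>comps ?U F. card X)"
      have "card (typed_conn n T F) * f * fact (n - total_len T) =
          2 ^ A_rank T * (card (conn_tuples ?U (map comp_len Cs) F) * q * fact (n - total_len T))"
        unfolding main by (simp only: mult_ac)
      also note a
      finally have "real (card (typed_conn n T F) * f * fact (n - total_len T)) =
          real (2 ^ A_rank T * (fact (A_rank T) * fact (n - 1 - A_rank T) * (\<Prod>X\<in>comps ?U F. card X)))"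
        by (rule arg_cong[where f=real])
      then show ?thesis unfolding weight_def by (simp only: of_nat_mult of_nat_power of_nat_fact of_nat_numeral)
    qed
    then show ?thesis unfolding type_coeff_def f using True f0 by (simp add: field_simps)
  qed
qed

lemma connecting_type:
  assumes n: "n \<ge> 1" and T: "\<forall>C\<in>#T. proper_comp C"
  shows "connecting {1..int n} (edges n) {w. has_comb_type n w T} (A_rank T) (type_coeff n T)"
proof (rule connectingI)
  show "finite {w. has_comb_type n w T}"
    by (rule finite_subset[OF _ finite_W_B[of n]]) (auto simp: has_comb_type_W_B)
  show "w \<in> {w. has_comb_type n w T} \<Longrightarrow> edges n w \<subseteq> Pow {1..int n}" for w
    by (rule edges_subset) (simp add: has_comb_type_W_B)
  show "w \<in> {w. has_comb_type n w T} \<Longrightarrow> F \<subseteq> Pow {1..int n} \<Longrightarrow>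
      card (comps {1..int n} F) \<le> card (comps {1..int n} (edges n w \<union> F)) + A_rank T" for w F
    using card_comps_edges_Un_ge by simp
  show "F \<subseteq> Pow {1..int n} \<Longrightarrow> card (comps {1..int n} F) = Suc (A_rank T) \<Longrightarrow>
      real (card {w \<in> {w. has_comb_type n w T}. conn {1..int n} (edges n w \<union> F)}) = type_coeff n T * weight {1..int n} F" for F
    using card_typed_conn_eq[OF n T] by (simp add: typed_conn_def)
qed

subsection \<open>Products of permutations with few blocks\<close>

definition perm_edges :: "'a set \<Rightarrow> ('a \<Rightarrow> 'a) \<Rightarrow> 'a set set" where
  "perm_edges U p = (\<lambda>x. {x, p x}) ` U"

lemma perm_edges_subset: "p permutes U \<Longrightarrow> perm_edges U p \<subseteq> Pow U"
  unfolding perm_edges_def using permutes_in_image by fastforce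

lemma closed_perm_edges_iff:
  assumes U: "finite U" and p: "p permutes U" and A: "A \<subseteq> U"
  shows "closed_under (perm_edges U p) A \<longleftrightarrow> (\<forall>x\<in>A. p x \<in> A)"
proof
  assume c: "closed_under (perm_edges U p) A"
  show "\<forall>x\<in>A. p x \<in> A"
  proof
    fix x assume x: "x \<in> A"
    then have "{x, p x} \<in> perm_edges U p" using A unfolding perm_edges_def by blast
    then have "{x, p x} \<inter> A \<noteq> {} \<longrightarrow> {x, p x} \<subseteq> A" by (rule bspec[OF c[unfolded closed_under_def]])
    then show "p x \<in> A" using x by simp
  qed
next
  assume *: "\<forall>x\<in>A. p x \<in> A"
  have im: "p ` A = A"
    by (rule endo_inj_surj) (use * finite_subset[OF A U] permutes_inj_on[OF p] in auto)
  show "closed_under (perm_edges U p) A"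
    unfolding closed_under_def
  proof (intro ballI impI)
    fix S assume "S \<in> perm_edges U p" and S: "S \<inter> A \<noteq> {}"
    then obtain x where x: "S = {x, p x}" unfolding perm_edges_def by blast
    have "x \<in> A \<or> p x \<in> A" using S x by blast
    moreover have "x \<in> A" if "p x \<in> A"
    proof -
      have "p x \<in> p ` A" unfolding im by (rule that)
      then obtain a where a: "a \<in> A" "p x = p a" by blast
      have "x = a" by (rule injD[OF permutes_inj[OF p] a(2)])
      then show ?thesis using a(1) by simp
    qed
    ultimately show "S \<subseteq> A" using * x by blast
  qed
qed

text \<open>
  Multiplying by a transposition of points from different orbits merges these orbits: if a set
  invariant under the product contained \<open>x\<close> but not \<open>y\<close>, then \<open>q\<close> would map its intersection
  with the orbit of \<open>y\<close>, enlarged by \<open>y\<close>, injectively into the intersection itself.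
\<close>

lemma closed_transpose_merge:
  assumes U: "finite U" and q: "q permutes U" and x: "x \<in> U" and y: "y \<in> U"
    and ne: "component_of U (perm_edges U q) x \<noteq> component_of U (perm_edges U q) y" and A: "A \<subseteq> U"
  shows "closed_under (perm_edges U (q \<circ> transpose x y)) A \<longleftrightarrow>
     closed_under (insert {x, y} (perm_edges U q)) A"
proof -
  have qt: "q \<circ> transpose x y permutes U" using permutes_compose[OF permutes_swap_id[OF x y] q] .
  note sub = perm_edges_subset[OF q]
  have main: False
    if xy: "x \<in> U" "y \<in> U" "x \<in> B" "y \<notin> B" and B: "B \<subseteq> U" and c: "\<forall>z\<in>B. (q \<circ> transpose x y) z \<in> B"
      and ne: "component_of U (perm_edges U q) x \<noteq> component_of U (perm_edges U q) y" for x y B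
  proof -
    let ?Y = "component_of U (perm_edges U q) y"
    have Y: "?Y \<subseteq> U" using component_of_subset[OF sub xy(2)] .
    have qY: "q z \<in> ?Y" if "z \<in> ?Y" for z
      using closed_component_of[OF sub] closed_perm_edges_iff[OF U q Y] that by blast
    have yY: "y \<in> ?Y" by (rule component_of_self[OF sub])
    have xY: "x \<notin> ?Y" using component_of_eq[OF sub xy(2)] ne by blast
    have fin: "finite (B \<inter> ?Y)" using B U finite_subset by blast
    have "q z \<in> B \<inter> ?Y" if z: "z \<in> insert y (B \<inter> ?Y)" for z
    proof (cases "z = y")
      case True
      have "(q \<circ> transpose x y) x \<in> B" using c xy(3) by blast
      then show ?thesis using True qY[OF yY] by simp
    next
      case False
      then have "z \<in> B" "z \<in> ?Y" "z \<noteq> x" using z xY by auto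
      moreover from this have "(q \<circ> transpose x y) z = q z" using False by simp
      ultimately show ?thesis using c qY by (metis IntI)
    qed
    then have "q ` insert y (B \<inter> ?Y) \<subseteq> B \<inter> ?Y" by blast
    then have "card (insert y (B \<inter> ?Y)) \<le> card (B \<inter> ?Y)"
      using card_inj_on_le[OF permutes_inj_on[OF q] _ fin] by blast
    then show False using xy(4) fin by simp
  qed
  show ?thesis
  proof
    assume c: "closed_under (perm_edges U (q \<circ> transpose x y)) A"
    then have step: "\<forall>z\<in>A. (q \<circ> transpose x y) z \<in> A" using closed_perm_edges_iff[OF U qt A] by blast
    have 1: "y \<in> A" if "x \<in> A" using main[OF x y that _ A step ne] by blast
    have 2: "x \<in> A" if "y \<in> A"
    proof (rule ccontr)
      assume "x \<notin> A"
      moreover have "\<forall>z\<in>A. (q \<circ> transpose y x) z \<in> A" using step by (simp add: transpose_commute)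
      ultimately show False using main[OF y x that _ A _ ne[symmetric]] by blast
    qed
    have "q z \<in> A" if z: "z \<in> A" for z
    proof -
      have "transpose x y z \<in> A" using z 1 2 by (cases "z = x"; cases "z = y") auto
      then have "(q \<circ> transpose x y) (transpose x y z) \<in> A" using step by blast
      then show ?thesis by simp
    qed
    then show "closed_under (insert {x, y} (perm_edges U q)) A"
      using 1 2 closed_perm_edges_iff[OF U q A] by auto
  next
    assume c: "closed_under (insert {x, y} (perm_edges U q)) A"
    then have xy: "x \<in> A \<longleftrightarrow> y \<in> A" and "\<forall>z\<in>A. q z \<in> A"
      using closed_perm_edges_iff[OF U q A] by auto
    then have "(q \<circ> transpose x y) z \<in> A" if "z \<in> A" for z
      using that by (cases "z = x"; cases "z = y") auto
    then show "closed_under (perm_edges U (q \<circ> transpose x y)) A"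
      using closed_perm_edges_iff[OF U qt A] by blast
  qed
qed

section \<open>The rank of a permutation and splitting off transpositions\<close>

definition perm_rank :: "'a set \<Rightarrow> ('a \<Rightarrow> 'a) \<Rightarrow> nat" where
  "perm_rank U p = card U - card (comps U (perm_edges U p))"

lemma perm_rank_eq:
  "finite U \<Longrightarrow> p permutes U \<Longrightarrow> card (comps U (perm_edges U p)) + perm_rank U p = card U"
  unfolding perm_rank_def using card_comps_le[OF perm_edges_subset] by fastforce

text \<open>With \<open>y = p x\<close>, the remaining permutation \<open>p'\<close> fixes
  \<open>y\<close>. So it moves fewer points and has \<open>y\<close> as an orbit of its own;
  multiplying the transposition back merges two different orbits and raises the rank by one.\<close>

lemma transposition_split:
  assumes U: "finite U" and p: "p permutes U" and ne: "p \<noteq> id"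
  obtains x y p' where "x \<in> U" "y \<in> U" "p' permutes U" "p = p' \<circ> transpose x y"
    "card {z. p' z \<noteq> z} < card {z. p z \<noteq> z}"
    "\<forall>A. A \<subseteq> U \<longrightarrow> closed_under (perm_edges U p) A = closed_under (insert {x, y} (perm_edges U p')) A"
    "perm_rank U p = Suc (perm_rank U p')"
proof -
  obtain x where x: "p x \<noteq> x" using ne by (auto simp: fun_eq_iff)
  then have xU: "x \<in> U" using p by (auto simp: permutes_def)
  define y where "y = p x"
  have yU: "y \<in> U" using xU p unfolding y_def by (simp add: permutes_in_image)
  define p' where "p' = p \<circ> transpose x y"
  have p'U: "p' permutes U" unfolding p'_def using permutes_compose[OF permutes_swap_id[OF xU yU] p] .
  have pp: "p = p' \<circ> transpose x y" unfolding p'_def by (simp add: fun_eq_iff)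
  have fix_y: "p' y = y" unfolding p'_def y_def by simp
  have py: "p y \<noteq> y" using x permutes_inj[OF p] unfolding y_def by (metis injD)
  have mv: "{z. p' z \<noteq> z} \<subseteq> {z. p z \<noteq> z} - {y}"
  proof
    fix z assume z: "z \<in> {z. p' z \<noteq> z}"
    then have "z \<noteq> y" using fix_y by auto
    moreover have "p z \<noteq> z"
      using z x \<open>z \<noteq> y\<close> unfolding p'_def by (cases "z = x") auto
    ultimately show "z \<in> {z. p z \<noteq> z} - {y}" by simp
  qed
  have fm: "finite {z. p z \<noteq> z}" by (rule finite_subset[OF _ U]) (use p in \<open>auto simp: permutes_def\<close>)
  have lt: "card {z. p' z \<noteq> z} < card {z. p z \<noteq> z}"
    by (rule psubset_card_mono[OF fm]) (use mv py in auto)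
  note sub = perm_edges_subset[OF p'U]
  have cy: "component_of U (perm_edges U p') y \<subseteq> {y}"
    by (rule component_of_least[OF sub]) (use yU fix_y closed_perm_edges_iff[OF U p'U, of "{y}"] in auto)
  have nc: "component_of U (perm_edges U p') x \<noteq> component_of U (perm_edges U p') y"
  proof
    assume "component_of U (perm_edges U p') x = component_of U (perm_edges U p') y"
    then have "x \<in> {y}" using component_of_self[OF sub, of x] cy by blast
    then show False using x y_def by simp
  qed
  have cl: "closed_under (perm_edges U p) A \<longleftrightarrow> closed_under (insert {x, y} (perm_edges U p')) A"
    if "A \<subseteq> U" for A
    using closed_transpose_merge[OF U p'U xU yU nc that] pp by simp
  have "comps U (perm_edges U p) = comps U (insert {x, y} (perm_edges U p'))"
    by (rule comps_cong) (rule cl)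
  then have "card (comps U (perm_edges U p')) = card (comps U (perm_edges U p)) + 1"
    using card_comps_insert_pair[OF U sub xU yU] nc by simp
  then have "perm_rank U p = Suc (perm_rank U p')"
    using perm_rank_eq[OF U p] perm_rank_eq[OF U p'U] by simp
  then show ?thesis using that[OF xU yU p'U pp lt] cl by blast
qed

text \<open>Each transposition that is split off merges at most two blocks, and there are
  \<open>perm_rank U p\<close> of them.\<close>

lemma card_comps_perm_edges_Un_ge:
  assumes U: "finite U" and F: "F \<subseteq> Pow U"
  shows "p permutes U \<Longrightarrow> card (comps U F) \<le> card (comps U (perm_edges U p \<union> F)) + perm_rank U p"
proof (induction "card {z. p z \<noteq> z}" arbitrary: p rule: less_induct)
  case less
  show ?case
  proof (cases "p = id")
    case True
    have "comps U (perm_edges U p \<union> F) = comps U F"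
      by (rule comps_cong) (use closed_perm_edges_iff[OF U less.prems] True in auto)
    then show ?thesis by simp
  next
    case False
    obtain x y p' where xy: "x \<in> U" "y \<in> U" and p': "p' permutes U" and pp: "p = p' \<circ> transpose x y"
      and lt: "card {z. p' z \<noteq> z} < card {z. p z \<noteq> z}"
      and cl: "\<forall>A. A \<subseteq> U \<longrightarrow> closed_under (perm_edges U p) A = closed_under (insert {x, y} (perm_edges U p')) A"
      and r: "perm_rank U p = Suc (perm_rank U p')"
      by (rule transposition_split[OF U less.prems False])
    have sub: "perm_edges U p' \<union> F \<subseteq> Pow U" using perm_edges_subset[OF p'] F by blast
    have "comps U (perm_edges U p \<union> F) = comps U (insert {x, y} (perm_edges U p' \<union> F))"
      by (rule comps_cong) (use cl in auto)
    then have "card (comps U (perm_edges U p' \<union> F)) \<le> card (comps U (perm_edges U p \<union> F)) + 1"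
      using card_comps_insert_pair[OF U sub xy] by simp
    then show ?thesis using less.hyps[OF lt p'] r by simp
  qed
qed

text \<open>The assumption says that \<open>p\<close> lowers the number of blocks as far as its rank
  permits, so each of its transpositions merges two blocks of what is already there. By induction
  \<open>q \<circ> p'\<close> has the joint blocks as orbits, and the last transposition merges two
  of these orbits.\<close>

lemma closed_compose_tree:
  assumes U: "finite U" and q: "q permutes U"
  shows "p permutes U \<Longrightarrow>
    card (comps U (perm_edges U q)) = card (comps U (perm_edges U p \<union> perm_edges U q)) + perm_rank U p \<Longrightarrow>
    A \<subseteq> U \<Longrightarrow> closed_under (perm_edges U (q \<circ> p)) A \<longleftrightarrow> closed_under (perm_edges U p \<union> perm_edges U q) A"
proof (induction "card {z. p z \<noteq> z}" arbitrary: p A rule: less_induct)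
  case less
  show ?case
  proof (cases "p = id")
    case True
    then show ?thesis using closed_perm_edges_iff[OF U less.prems(1) less.prems(3)] by auto
  next
    case False
    obtain x y p' where xy: "x \<in> U" "y \<in> U" and p': "p' permutes U" and pp: "p = p' \<circ> transpose x y"
      and lt: "card {z. p' z \<noteq> z} < card {z. p z \<noteq> z}"
      and cl: "\<forall>A. A \<subseteq> U \<longrightarrow> closed_under (perm_edges U p) A = closed_under (insert {x, y} (perm_edges U p')) A"
      and r: "perm_rank U p = Suc (perm_rank U p')"
      by (rule transposition_split[OF U less.prems(1) False])
    let ?G = "perm_edges U p' \<union> perm_edges U q"
    have sub: "?G \<subseteq> Pow U" using perm_edges_subset[OF p'] perm_edges_subset[OF q] by blast
    have e: "comps U (perm_edges U p \<union> perm_edges U q) = comps U (insert {x, y} ?G)"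
      by (rule comps_cong) (use cl in auto)
    have "card (comps U (perm_edges U q)) \<le> card (comps U ?G) + perm_rank U p'"
      by (rule card_comps_perm_edges_Un_ge[OF U perm_edges_subset[OF q] p'])
    moreover have "card (comps U ?G) = card (comps U (insert {x, y} ?G)) +
        (if component_of U ?G x = component_of U ?G y then 0 else 1)"
      by (rule card_comps_insert_pair[OF U sub xy])
    \<comment> \<open>The total drop is \<open>perm_rank U p' + 1\<close>; the transposition
      accounts for at most one and \<open>p'\<close> for at most its rank, so both bounds are
      attained.\<close>
    ultimately have eq: "card (comps U (perm_edges U q)) = card (comps U ?G) + perm_rank U p'"
      and nc: "component_of U ?G x \<noteq> component_of U ?G y"
      using less.prems(2) r e by (auto split: if_splits)
    have IH: "closed_under (perm_edges U (q \<circ> p')) B \<longleftrightarrow> closed_under ?G B" if "B \<subseteq> U" for B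
      by (rule less.hyps[OF lt p' eq that])
    have qp': "q \<circ> p' permutes U" by (rule permutes_compose[OF p' q])
    have ce: "component_of U (perm_edges U (q \<circ> p')) z = component_of U ?G z" for z
      by (rule component_of_cong) (rule IH)
    have "closed_under (perm_edges U (q \<circ> p' \<circ> transpose x y)) A \<longleftrightarrow>
        closed_under (insert {x, y} (perm_edges U (q \<circ> p'))) A"
      by (rule closed_transpose_merge[OF U qp' xy _ less.prems(3)]) (use nc ce in simp)
    then show ?thesis using IH[OF less.prems(3)] cl less.prems(3) pp by (simp add: comp_assoc)
  qed
qed

section \<open>Products of lists of permutations\<close>

definition list_edges :: "'a set \<Rightarrow> ('a \<Rightarrow> 'a) list \<Rightarrow> 'a set set" where
  "list_edges U ps = (\<Union>p\<in>set ps. perm_edges U p)"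

lemma list_edges_Cons: "list_edges U (p # ps) = perm_edges U p \<union> list_edges U ps"
  by (simp add: list_edges_def)

lemma list_edges_subset: "\<forall>p\<in>set ps. p permutes U \<Longrightarrow> list_edges U ps \<subseteq> Pow U"
  unfolding list_edges_def using perm_edges_subset by blast

definition comp_list :: "('a \<Rightarrow> 'a) list \<Rightarrow> 'a \<Rightarrow> 'a" where
  "comp_list ps = foldr (\<circ>) ps id"

lemma comp_list_Nil [simp]: "comp_list [] = id"
  by (simp add: comp_list_def)

lemma comp_list_Cons [simp]: "comp_list (p # ps) = p \<circ> comp_list ps"
  by (simp add: comp_list_def)

lemma comp_list_permutes: "\<forall>p\<in>set ps. p permutes U \<Longrightarrow> comp_list ps permutes U"
  by (induction ps) (auto intro: permutes_compose)

lemma card_comps_list_edges_ge: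
  assumes U: "finite U"
  shows "\<forall>p\<in>set ps. p permutes U \<Longrightarrow>
    card U \<le> card (comps U (list_edges U ps)) + (\<Sum>p\<leftarrow>ps. perm_rank U p)"
proof (induction ps)
  case Nil
  then show ?case by (simp add: list_edges_def card_comps_empty)
next
  case (Cons p ps)
  have "list_edges U ps \<subseteq> Pow U" by (rule list_edges_subset) (use Cons.prems in simp)
  then have "card (comps U (list_edges U ps)) \<le> card (comps U (list_edges U (p # ps))) + perm_rank U p"
    unfolding list_edges_Cons using card_comps_perm_edges_Un_ge[OF U] Cons.prems by simp
  then show ?case using Cons by simp
qed

lemma closed_comp_list:
  assumes U: "finite U" and A: "A \<subseteq> U"
  shows "\<forall>p\<in>set ps. p permutes U \<Longrightarrow> closed_under (list_edges U ps) A \<Longrightarrow>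
    closed_under (perm_edges U (comp_list ps)) A"
proof (induction ps)
  case Nil
  show ?case unfolding comp_list_Nil closed_perm_edges_iff[OF U permutes_id A] by simp
next
  case (Cons p ps)
  have p: "p permutes U" and q: "comp_list ps permutes U" using comp_list_permutes[of ps U] Cons.prems by auto
  have "\<forall>x\<in>A. p x \<in> A" "\<forall>x\<in>A. comp_list ps x \<in> A"
    using Cons closed_perm_edges_iff[OF U p A] closed_perm_edges_iff[OF U q A] unfolding list_edges_Cons by auto
  then show ?case
    unfolding comp_list_Cons closed_perm_edges_iff[OF U permutes_compose[OF q p] A] by simp
qed

text \<open>A set invariant under all factors is invariant under the product, so the product has at
  least as many orbits as there are joint blocks.\<close>

lemma perm_rank_comp_list_le:
  assumes U: "finite U" and ps: "\<forall>p\<in>set ps. p permutes U"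
  shows "perm_rank U (comp_list ps) \<le> (\<Sum>p\<leftarrow>ps. perm_rank U p)"
proof -
  note q = comp_list_permutes[OF ps]
  have "card (comps U (list_edges U ps)) \<le> card (comps U (perm_edges U (comp_list ps)))"
    by (rule card_comps_mono(1)[OF U perm_edges_subset[OF q] list_edges_subset[OF ps]])
      (rule closed_comp_list[OF U _ ps])
  then show ?thesis using card_comps_list_edges_ge[OF U ps] perm_rank_eq[OF U q] by simp
qed

text \<open>Tightness passes to the tail of the list, whose product then has the joint blocks of the
  tail as orbits; one application of \<open>closed_compose_tree\<close> brings in the first
  factor.\<close>

lemma closed_comp_list_tree:
  assumes U: "finite U"
  shows "\<forall>p\<in>set ps. p permutes U \<Longrightarrow>
    card U = card (comps U (list_edges U ps)) + (\<Sum>p\<leftarrow>ps. perm_rank U p) \<Longrightarrow> A \<subseteq> U \<Longrightarrow>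
    closed_under (perm_edges U (comp_list ps)) A \<longleftrightarrow> closed_under (list_edges U ps) A"
proof (induction ps arbitrary: A)
  case Nil
  show ?case unfolding comp_list_Nil closed_perm_edges_iff[OF U permutes_id Nil(3)] by (simp add: list_edges_def)
next
  case (Cons p ps)
  let ?q = "comp_list ps"
  have ps: "\<forall>p\<in>set ps. p permutes U" and p: "p permutes U" using Cons.prems by auto
  note q = comp_list_permutes[OF ps]
  have "card (comps U (list_edges U ps)) \<le> card (comps U (list_edges U (p # ps))) + perm_rank U p"
    unfolding list_edges_Cons by (rule card_comps_perm_edges_Un_ge[OF U list_edges_subset[OF ps] p])
  then have t: "card U = card (comps U (list_edges U ps)) + (\<Sum>p\<leftarrow>ps. perm_rank U p)"
    using card_comps_list_edges_ge[OF U ps] Cons.prems(2) by simp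
  have IH: "closed_under (perm_edges U ?q) B \<longleftrightarrow> closed_under (list_edges U ps) B" if "B \<subseteq> U" for B
    by (rule Cons.IH[OF ps t that])
  have e1: "comps U (perm_edges U ?q) = comps U (list_edges U ps)" by (rule comps_cong) (rule IH)
  have e2: "comps U (perm_edges U ?q \<union> perm_edges U p) = comps U (list_edges U (p # ps))"
    by (rule comps_cong) (use IH in \<open>auto simp: list_edges_Cons\<close>)
  \<comment> \<open>The roles are exchanged here: \<open>p\<close> counts as already present and the
    tail \<open>?q\<close> is the one split into transpositions, because these come off at the right
    of \<open>p \<circ> ?q\<close>.\<close>
  have "card (comps U (perm_edges U p)) = card (comps U (perm_edges U ?q \<union> perm_edges U p)) + perm_rank U ?q"
    using perm_rank_eq[OF U p] perm_rank_eq[OF U q] t Cons.prems(2) unfolding e1 e2 by simp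
  from closed_compose_tree[OF U p q this Cons.prems(3)]
  show ?case using IH[OF Cons.prems(3)] unfolding comp_list_Cons list_edges_Cons closed_under_Un by blast
qed

subsection \<open>Absolute length, signs and Coxeter elements\<close>

definition abs_perm :: "nat \<Rightarrow> (int \<Rightarrow> int) \<Rightarrow> int \<Rightarrow> int" where
  "abs_perm n w x = (if x \<in> {1..int n} then \<bar>w x\<bar> else x)"

lemma abs_perm_outside: "x \<notin> {1..int n} \<Longrightarrow> abs_perm n w x = x"
  unfolding abs_perm_def by (rule if_not_P)

lemma abs_perm_in: "w \<in> W_B n \<Longrightarrow> x \<in> {1..int n} \<Longrightarrow> \<bar>w x\<bar> \<in> {1..int n}"
  using W_B_in_letters[of w n x] unfolding letters_iff_abs by auto

lemma abs_perm_permutes: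
  assumes w: "w \<in> W_B n"
  shows "abs_perm n w permutes {1..int n}"
proof (rule bij_imp_permutes)
  have inj: "inj_on (abs_perm n w) {1..int n}"
  proof (rule inj_onI)
    fix x y assume xy: "x \<in> {1..int n}" "y \<in> {1..int n}" "abs_perm n w x = abs_perm n w y"
    then have "\<bar>x\<bar> = \<bar>y\<bar>" using W_B_abs_eq[OF w] by (simp add: abs_perm_def)
    then show "x = y" using xy by simp
  qed
  have "abs_perm n w ` {1..int n} \<subseteq> {1..int n}" using abs_perm_in[OF w] by (auto simp: abs_perm_def)
  then have "abs_perm n w ` {1..int n} = {1..int n}" by (intro endo_inj_surj inj) simp_all
  then show "bij_betw (abs_perm n w) {1..int n} {1..int n}" using inj by (simp add: bij_betw_def)
  show "x \<notin> {1..int n} \<Longrightarrow> abs_perm n w x = x" for x by (rule abs_perm_outside)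
qed

lemma abs_perm_compose:
  assumes "v \<in> W_B n" "w \<in> W_B n"
  shows "abs_perm n (v \<circ> w) = abs_perm n v \<circ> abs_perm n w"
proof
  fix x
  show "abs_perm n (v \<circ> w) x = (abs_perm n v \<circ> abs_perm n w) x"
  proof (cases "x \<in> {1..int n}")
    case True
    have "\<bar>v (w x)\<bar> = \<bar>v \<bar>w x\<bar>\<bar>" using W_B_abs_eq[OF assms(1)] by simp
    then show ?thesis using True abs_perm_in[OF assms(2) True] by (simp add: abs_perm_def)
  next
    case False
    then show ?thesis unfolding comp_apply abs_perm_outside[OF False] by simp
  qed
qed

lemma abs_perm_perm_prod:
  "set ws \<subseteq> W_B n \<Longrightarrow> comp_list (map (abs_perm n) ws) = abs_perm n (perm_prod ws)"
proof (induction ws)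
  case Nil
  have "abs_perm n id = id" by (rule ext) (simp add: abs_perm_def)
  then show ?case by (simp only: list.map comp_list_Nil perm_prod_Nil)
next
  case (Cons w ws)
  then have "w \<in> W_B n" "perm_prod ws \<in> W_B n" using W_B_perm_prod by auto
  then show ?case using Cons unfolding perm_prod_Cons by (simp only: abs_perm_compose list.map comp_list_Cons set_simps insert_subset)
qed

lemma edges_eq_perm_edges: "edges n w = perm_edges {1..int n} (abs_perm n w)"
  unfolding edges_def perm_edges_def by (rule image_cong) (auto simp: abs_perm_def)

definition edges_list :: "nat \<Rightarrow> (int \<Rightarrow> int) list \<Rightarrow> int set set" where
  "edges_list n ws = (\<Union>w\<in>set ws. edges n w)"

lemma edges_list_eq: "edges_list n ws = list_edges {1..int n} (map (abs_perm n) ws)"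
  unfolding edges_list_def list_edges_def edges_eq_perm_edges by simp

definition abs_rank :: "nat \<Rightarrow> (int \<Rightarrow> int) \<Rightarrow> nat" where
  "abs_rank n w = perm_rank {1..int n} (abs_perm n w)"

lemma card_comps_abs_rank:
  "w \<in> W_B n \<Longrightarrow> card (comps {1..int n} (edges n w)) + abs_rank n w = n"
  using perm_rank_eq[OF _ abs_perm_permutes] unfolding abs_rank_def edges_eq_perm_edges by fastforce

lemma abs_rank_type: "has_comb_type n w T \<Longrightarrow> abs_rank n w = A_rank T"
  using card_comps_abs_rank[OF has_comb_type_W_B] card_comps_edges by fastforce

context
  fixes n :: nat and ws :: "(int \<Rightarrow> int) list"
  assumes ws: "set ws \<subseteq> W_B n"
begin

lemma abs_perms_permute: "\<forall>p\<in>set (map (abs_perm n) ws). p permutes {1..int n}"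
  using ws abs_perm_permutes by auto

lemma edges_list_subset: "edges_list n ws \<subseteq> Pow {1..int n}"
  unfolding edges_list_eq by (rule list_edges_subset[OF abs_perms_permute])

lemma sum_abs_rank: "(\<Sum>p\<leftarrow>map (abs_perm n) ws. perm_rank {1..int n} p) = (\<Sum>w\<leftarrow>ws. abs_rank n w)"
  by (simp add: abs_rank_def o_def)

text \<open>A set invariant under every factor is invariant under the product, so transitivity of
  the product leaves no proper joint block.\<close>

lemma conn_edges_list_of_prod:
  assumes n: "n \<ge> 1" and c: "conn {1..int n} (edges n (perm_prod ws))"
  shows "conn {1..int n} (edges_list n ws)"
proof -
  have ne: "{1..int n} \<noteq> {}" using n by simp
  have "A = {} \<or> A = {1..int n}" if A: "A \<subseteq> {1..int n}" "closed_under (edges_list n ws) A" for A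
  proof -
    have "closed_under (edges n (perm_prod ws)) A"
      using closed_comp_list[OF _ A(1) abs_perms_permute] A(2)
      unfolding edges_list_eq edges_eq_perm_edges abs_perm_perm_prod[OF ws] by simp
    then show ?thesis
      using c A(1) conn_iff_closed[OF ne edges_subset[OF W_B_perm_prod[OF ws]]] by blast
  qed
  then show ?thesis using conn_iff_closed[OF ne edges_list_subset] by blast
qed

lemma sum_abs_rank_ge:
  assumes n: "n \<ge> 1" and c: "conn {1..int n} (edges_list n ws)"
  shows "n \<le> 1 + (\<Sum>w\<leftarrow>ws. abs_rank n w)"
proof -
  have "card (comps {1..int n} (edges_list n ws)) = 1" using c by (simp add: conn_def)
  then show ?thesis
    using card_comps_list_edges_ge[OF _ abs_perms_permute] unfolding sum_abs_rank edges_list_eq by simp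
qed

text \<open>The equation for the ranks makes the factors tight, so the orbits of the product are the
  joint blocks, of which there is only one.\<close>

lemma conn_edges_prod:
  assumes n: "n \<ge> 1" and c: "conn {1..int n} (edges_list n ws)" and r: "n = 1 + (\<Sum>w\<leftarrow>ws. abs_rank n w)"
  shows "conn {1..int n} (edges n (perm_prod ws))"
proof -
  have "card (comps {1..int n} (edges_list n ws)) = 1" using c by (simp add: conn_def)
  then have t: "card {1..int n} = card (comps {1..int n} (list_edges {1..int n} (map (abs_perm n) ws))) +
      (\<Sum>p\<leftarrow>map (abs_perm n) ws. perm_rank {1..int n} p)"
    using r unfolding sum_abs_rank edges_list_eq by simp
  have "closed_under (edges n (perm_prod ws)) A \<longleftrightarrow> closed_under (edges_list n ws) A" if "A \<subseteq> {1..int n}" for A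
    using closed_comp_list_tree[OF _ abs_perms_permute t that]
    unfolding edges_list_eq edges_eq_perm_edges abs_perm_perm_prod[OF ws] by simp
  then show ?thesis using c conn_cong[of "{1..int n}" "edges n (perm_prod ws)"] by blast
qed

lemma abs_rank_perm_prod_le: "abs_rank n (perm_prod ws) \<le> (\<Sum>w\<leftarrow>ws. abs_rank n w)"
  using perm_rank_comp_list_le[OF _ abs_perms_permute]
  unfolding abs_rank_def[of n "perm_prod ws"] abs_perm_perm_prod[OF ws] sum_abs_rank by simp

lemma letters_rank_perm_prod_le:
  "perm_rank (letters n) (perm_prod ws) \<le> (\<Sum>w\<leftarrow>ws. perm_rank (letters n) w)"
  using perm_rank_comp_list_le[OF finite_letters, of ws n] ws W_B_permutes
  unfolding comp_list_def perm_prod_def by blast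

end

section \<open>Type B cycles, signs and words in reflections\<close>

definition num_B :: "cox_type \<Rightarrow> nat" where
  "num_B T = size (filter_mset (\<lambda>C. comp_sgn C = - 1) T)"

lemma num_B_add [simp]: "num_B (add_mset C T) = (if comp_sgn C = - 1 then 1 else 0) + num_B T"
  by (simp add: num_B_def)

lemma num_B_empty [simp]: "num_B {#} = 0"
  by (simp add: num_B_def)

lemma A_rank_add [simp]: "A_rank (add_mset C T) = (comp_len C - 1) + A_rank T"
  by (simp add: A_rank_def)

lemma A_rank_empty [simp]: "A_rank {#} = 0"
  by (simp add: A_rank_def)

lemma rk_eq_A_rank:
  "\<forall>C\<in>#T. proper_comp C \<Longrightarrow> rk T = A_rank T + num_B T"
proof (induction T)
  case empty
  then show ?case by (simp add: rk_def)
next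
  case (add C T)
  then show ?case by (cases C) (auto simp: rk_def)
qed

lemma W_B_permutation: "w \<in> W_B n \<Longrightarrow> permutation w"
  using W_B_permutes finite_letters permutation_permutes by blast

lemma sign_cycle_of_list: "distinct cs \<Longrightarrow> sign (cycle_of_list cs) = (- 1) ^ (length cs - 1)"
proof (induction cs rule: cycle_of_list.induct)
  case (1 i j cs)
  then have "sign (cycle_of_list (j # cs)) = (- 1) ^ length cs" "i \<noteq> j" by auto
  then show ?case
    unfolding cycle_of_list.simps(1) sign_compose[OF permutation_swap_id permutation_of_cycle] sign_swap_id
    by simp
qed simp_all

text \<open>An \<open>A\<close> cycle is a product of two cycles of equal length, whose signs
  cancel; a \<open>B\<close> cycle is a single cycle of even length.\<close>

lemma sign_comp_cycle:
  assumes "distinct (map abs xs)" "0 \<notin> set xs" "length xs = comp_len C" "proper_comp C"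
  shows "sign (comp_cycle C xs) = comp_sgn C"
proof (cases C)
  case (TypeA k)
  then show ?thesis
    using abs_list_distinct[OF assms(1,2)]
    by (simp add: A_cycle_def sign_compose permutation_of_cycle sign_cycle_of_list power_mult_distrib[symmetric])
next
  case (TypeB k)
  have d: "distinct (xs @ map uminus xs)" using abs_list_distinct[OF assms(1,2)] uminus_notin[OF assms(1,2)] by auto
  have "length (xs @ map uminus xs) - 1 = Suc (2 * (k - 1))" using assms(3,4) TypeB by simp
  then show ?thesis using TypeB sign_cycle_of_list[OF d] by (simp add: B_cycle_def)
qed

lemma sign_perm_prod:
  "set ws \<subseteq> W_B n \<Longrightarrow> sign (perm_prod ws) = (\<Prod>w\<leftarrow>ws. sign w)"
proof (induction ws)
  case (Cons w ws)
  then have "permutation w" "permutation (perm_prod ws)"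
    using W_B_permutation W_B_perm_prod[of ws n] by auto
  then show ?case using Cons unfolding perm_prod_Cons by (simp only: sign_compose) simp
qed (simp add: sign_id)

lemma sign_type:
  assumes "has_comb_type n w T"
  shows "sign w = (- 1) ^ num_B T"
proof -
  obtain qs where w: "w \<in> W_B n" and d: "cyc_decomp n w qs" and T: "mset (map fst qs) = T"
    using assms unfolding has_comb_type_iff by blast
  note f = decomp_family[OF w d]
  define ps where "ps = expand w qs"
  have fam: "\<forall>(C, xs)\<in>set ps. proper_comp C \<and> length xs = comp_len C \<and> set xs \<subseteq> letters n \<and> distinct (map abs xs)"
    using f(1) unfolding cyc_family_def ps_def by blast
  have m: "mset (map fst ps) = T" using T unfolding ps_def expand_def by (simp add: o_def case_prod_beta)
  have "set (map (\<lambda>(C, xs). comp_cycle C xs) ps) \<subseteq> W_B n"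
    using comp_cycle_W_B cyc_familyD[OF f(1)] unfolding ps_def by auto
  then have "sign w = (\<Prod>v\<leftarrow>map (\<lambda>(C, xs). comp_cycle C xs) ps. sign v)"
    using sign_perm_prod f(2) unfolding family_prod_def ps_def by metis
  also have "\<dots> = (\<Prod>C\<leftarrow>map fst ps. comp_sgn C)"
  proof -
    have "map sign (map (\<lambda>(C, xs). comp_cycle C xs) ps) = map comp_sgn (map fst ps)"
      using sign_comp_cycle cyc_familyD[OF f(1)] unfolding ps_def by auto
    then show ?thesis by (rule arg_cong[where f=prod_list])
  qed
  also have "\<dots> = (- 1) ^ num_B (mset (map fst ps))"
  proof (induction ps)
    case (Cons p ps)
    then show ?case by (cases "fst p") auto
  qed simp
  finally show ?thesis unfolding m .
qed

lemma A_cycle_Cons: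
  assumes "distinct (map abs (x # y # zs))" "0 \<notin> set (x # y # zs)"
  shows "A_cycle (x # y # zs) = A_cycle [x, y] \<circ> A_cycle (y # zs)"
proof -
  note d = abs_list_distinct[OF assms]
  have "distinct [- x, - y]" using d(2) by auto
  moreover have "set (y # zs) \<inter> set [- x, - y] = {}"
    using uminus_notin[OF assms, of x] uminus_notin[OF assms, of y] by auto
  ultimately have "cycle_of_list (y # zs) \<circ> cycle_of_list [- x, - y] = cycle_of_list [- x, - y] \<circ> cycle_of_list (y # zs)"
    using d(1) by (intro cycles_commute) simp_all
  then have c: "cycle_of_list (y # zs) \<circ> transpose (- x) (- y) = transpose (- x) (- y) \<circ> cycle_of_list (y # zs)"
    by simp
  have "A_cycle (x # y # zs) = transpose x y \<circ> (cycle_of_list (y # zs) \<circ> transpose (- x) (- y)) \<circ> cycle_of_list (map uminus (y # zs))"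
    unfolding A_cycle_def by (simp add: comp_assoc)
  also have "\<dots> = A_cycle [x, y] \<circ> A_cycle (y # zs)"
    unfolding c A_cycle_def by (simp add: comp_assoc)
  finally show ?thesis .
qed

text \<open>Flipping the sign of the last letter first makes the \<open>A\<close> cycle close up
  with a sign. Hence a \<open>B\<close> cycle of length \<open>k\<close> needs one reflection more
  than the \<open>k - 1\<close> of the \<open>A\<close> cycle.\<close>

lemma B_cycle_split:
  assumes d: "distinct (map abs xs)" and z: "0 \<notin> set xs" and ne: "xs \<noteq> []"
  shows "B_cycle xs = A_cycle xs \<circ> B_cycle [last xs]"
proof
  fix y
  have l: "last xs = xs ! (length xs - 1)" using ne by (rule last_conv_nth)
  have lx: "last xs \<in> set xs" using ne by simp
  have B1: "B_cycle [last xs] y = (if \<bar>y\<bar> = \<bar>last xs\<bar> then - y else y)" for y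
    using lx z unfolding B_cycle_def by (auto simp: transpose_def abs_eq_iff)
  show "B_cycle xs y = (A_cycle xs \<circ> B_cycle [last xs]) y"
  proof (cases "\<bar>y\<bar> \<in> abs ` set xs")
    case True
    then show ?thesis
    proof (rule abs_in_abs_set_cases[OF d z])
      fix i assume i: "i < length xs" "y = xs ! i"
      show ?thesis
      proof (cases "Suc i < length xs")
        case True
        have "map abs xs ! i \<noteq> map abs xs ! (length xs - 1)"
          using nth_eq_iff_index_eq[OF d, of i "length xs - 1"] True by simp
        then have "\<bar>y\<bar> \<noteq> \<bar>last xs\<bar>" using i True l by simp
        then show ?thesis using B1 A_cycle_nth[OF d z i(1)] B_cycle_nth[OF d z i(1)] True i by simp
      next
        case False
        then have e: "Suc i = length xs" using i by simp
        then have "y = last xs" using l i by (metis diff_Suc_1)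
        then show ?thesis using B1 A_cycle_nth[OF d z i(1)] B_cycle_nth[OF d z i(1)] e i by simp
      qed
    next
      fix i assume i: "i < length xs" "y = - xs ! i"
      show ?thesis
      proof (cases "Suc i < length xs")
        case True
        have "map abs xs ! i \<noteq> map abs xs ! (length xs - 1)"
          using nth_eq_iff_index_eq[OF d, of i "length xs - 1"] True by simp
        then have "\<bar>y\<bar> \<noteq> \<bar>last xs\<bar>" using i True l by simp
        then show ?thesis using B1 A_cycle_nth[OF d z i(1)] B_cycle_nth[OF d z i(1)] True i by simp
      next
        case False
        then have e: "Suc i = length xs" using i by simp
        then have "y = - last xs" using l i by (metis diff_Suc_1)
        then show ?thesis using B1 A_cycle_nth[OF d z i(1)] B_cycle_nth[OF d z i(1)] e i by simp
      qed
    qed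
  next
    case False
    then have "\<bar>y\<bar> \<noteq> \<bar>last xs\<bar>" using lx by (metis imageI)
    then show ?thesis
      using B1 comp_cycle_outside[OF d z False, of "TypeA 0"] comp_cycle_outside[OF d z False, of "TypeB 0"] by simp
  qed
qed

lemma A_cycle_reflections:
  "distinct (map abs xs) \<Longrightarrow> set xs \<subseteq> letters n \<Longrightarrow> xs \<noteq> [] \<Longrightarrow>
    \<exists>ts. set ts \<subseteq> reflections n \<and> length ts = length xs - 1 \<and> A_cycle xs = perm_prod ts"
proof (induction xs rule: cycle_of_list.induct)
  case (1 x y zs)
  then obtain ts where ts: "set ts \<subseteq> reflections n" "length ts = length (y # zs) - 1" "A_cycle (y # zs) = perm_prod ts"
    by auto
  have "0 \<notin> set (x # y # zs)" using 1(3) letters_nonzero by blast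
  then have "A_cycle (x # y # zs) = perm_prod (A_cycle [x, y] # ts)"
    using A_cycle_Cons[OF 1(2)] ts(3) by (simp add: perm_prod_Cons)
  moreover have "A_cycle [x, y] \<in> reflections n"
    using 1(2,3) unfolding reflections_def by auto
  ultimately show ?case using ts(1,2) by (intro exI[of _ "A_cycle [x, y] # ts"]) simp
next
  case "2_1"
  then show ?case by simp
next
  case ("2_2" x)
  then show ?case by (intro exI[of _ "[]"]) (simp add: A_cycle_def)
qed

lemma comp_cycle_reflections:
  assumes "distinct (map abs xs)" "set xs \<subseteq> letters n" "length xs = comp_len C" "proper_comp C"
  shows "\<exists>ts. set ts \<subseteq> reflections n \<and> length ts = component_rank C \<and> comp_cycle C xs = perm_prod ts"
proof -
  have ne: "xs \<noteq> []" using assms(3,4) comp_len_pos by fastforce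
  obtain ts where ts: "set ts \<subseteq> reflections n" "length ts = length xs - 1" "A_cycle xs = perm_prod ts"
    using A_cycle_reflections[OF assms(1,2) ne] by blast
  show ?thesis
  proof (cases C)
    case (TypeA k)
    then show ?thesis using ts assms(3) by auto
  next
    case (TypeB k)
    have z: "0 \<notin> set xs" using assms(2) letters_nonzero by blast
    have "last xs \<in> letters n" using assms(2) ne by auto
    then have "B_cycle [last xs] \<in> reflections n" unfolding reflections_def by auto
    moreover have "B_cycle xs = perm_prod (ts @ [B_cycle [last xs]])"
      using B_cycle_split[OF assms(1) z ne] ts(3) by (simp add: perm_prod_append perm_prod_Cons)
    ultimately show ?thesis using TypeB ts(1,2) assms(3,4)
      by (intro exI[of _ "ts @ [B_cycle [last xs]]"]) simp
  qed
qed

lemma type_reflections: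
  assumes "has_comb_type n w T"
  shows "\<exists>ts. set ts \<subseteq> reflections n \<and> length ts = rk T \<and> w = perm_prod ts"
proof -
  obtain qs where w: "w \<in> W_B n" and d: "cyc_decomp n w qs" and T: "mset (map fst qs) = T"
    using assms unfolding has_comb_type_iff by blast
  note f = decomp_family[OF w d]
  have "\<exists>ts. set ts \<subseteq> reflections n \<and> length ts = rk (mset (map fst ps)) \<and> family_prod ps = perm_prod ts"
    if "\<forall>(C, xs)\<in>set ps. proper_comp C \<and> length xs = comp_len C \<and> set xs \<subseteq> letters n \<and> distinct (map abs xs)" for ps
    using that
  proof (induction ps)
    case Nil
    then show ?case by (intro exI[of _ "[]"]) (simp add: rk_def family_prod_def)
  next
    case (Cons p ps)
    obtain C xs where p: "p = (C, xs)" by fastforce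
    obtain ts where ts: "set ts \<subseteq> reflections n" "length ts = rk (mset (map fst ps))" "family_prod ps = perm_prod ts"
      using Cons by auto
    obtain us where us: "set us \<subseteq> reflections n" "length us = component_rank C" "comp_cycle C xs = perm_prod us"
      using comp_cycle_reflections[of xs n C] Cons.prems unfolding p by auto
    have "family_prod (p # ps) = perm_prod (us @ ts)"
      using ts(3) us(3) by (auto simp: p family_prod_Cons perm_prod_append fun_eq_iff)
    then show ?case using ts us by (intro exI[of _ "us @ ts"]) (simp add: p rk_def)
  qed
  from this[of "expand w qs"] show ?thesis
    using f T unfolding cyc_family_def by (simp add: expand_def o_def case_prod_beta)
qed

text \<open>The \<open>LEAST\<close> is attained because the cycles of \<open>w\<close> provide a
  word in reflections; its length \<open>rk T\<close> bounds the minimum.\<close>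

lemma absolute_length_props:
  assumes "has_comb_type n w T"
  shows "absolute_length n w \<le> rk T"
    "\<exists>ts. length ts = absolute_length n w \<and> set ts \<subseteq> reflections n \<and> w = perm_prod ts"
proof -
  obtain ts where ts: "set ts \<subseteq> reflections n" "length ts = rk T" "w = perm_prod ts"
    using type_reflections[OF assms] by blast
  let ?P = "\<lambda>k. \<exists>ts. length ts = k \<and> set ts \<subseteq> reflections n \<and> w = perm_prod ts"
  have P: "?P (rk T)" using ts by blast
  show "absolute_length n w \<le> rk T" unfolding absolute_length_def by (rule Least_le[of ?P, OF P])
  show "\<exists>ts. length ts = absolute_length n w \<and> set ts \<subseteq> reflections n \<and> w = perm_prod ts"
    unfolding absolute_length_def by (rule LeastI[of ?P, OF P])
qed

lemma reflection_types:
  assumes "t \<in> reflections n"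
  shows "has_comb_type n t {#TypeA 1#} \<or> has_comb_type n t {#TypeB 1#}"
proof -
  from assms consider i j where "t = A_cycle [i, j]" "i \<in> letters n" "j \<in> letters n" "\<bar>i\<bar> \<noteq> \<bar>j\<bar>"
    | i where "t = B_cycle [i]" "i \<in> letters n" unfolding reflections_def by blast
  then show ?thesis
  proof cases
    case 1
    then have "has_comb_type n t {#TypeA 1#}"
      unfolding has_comb_type_def by (intro exI[of _ "[[i, j]]"] exI[of _ "[]"]) (auto simp: perm_prod_Cons)
    then show ?thesis ..
  next
    case 2
    then have "has_comb_type n t {#TypeB 1#}"
      unfolding has_comb_type_def by (intro exI[of _ "[[i]]"] exI[of _ "[]"]) (auto simp: perm_prod_Cons)
    then show ?thesis ..
  qed
qed

text \<open>
  On the \<open>2n\<close> letters a type \<open>A\<close> cycle has two orbits and a type \<open>B\<close> cycle only one; comparing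
  the ranks on the letters and on their absolute values separates the two kinds of cycles.
\<close>

definition orbit_part :: "(int \<Rightarrow> int) \<Rightarrow> component \<Rightarrow> int \<Rightarrow> int set" where
  "orbit_part w C x = set (cyc_list w C x)"

fun letter_orbits :: "(int \<Rightarrow> int) \<Rightarrow> component \<times> int \<Rightarrow> int set list" where
  "letter_orbits w (TypeA k, x) = [orbit_part w (TypeA k) x, uminus ` orbit_part w (TypeA k) x]"
| "letter_orbits w (TypeB k, x) = [orbit_part w (TypeB k) x \<union> uminus ` orbit_part w (TypeB k) x]"

context
  fixes n :: nat and w :: "int \<Rightarrow> int"
  assumes w: "w \<in> W_B n"
begin

lemma orbit_part_eq: "orbit_part w C x = (\<lambda>i. (w ^^ i) x) ` {..<comp_len C}"
  by (auto simp: orbit_part_def cyc_list_def)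

lemma orbit_part_letters: "x \<in> letters n \<Longrightarrow> orbit_part w C x \<subseteq> letters n"
  unfolding orbit_part_eq using funpow_in_letters[OF w] by blast

lemma card_orbit_part: "cyc_at w C x \<Longrightarrow> card (orbit_part w C x) = comp_len C"
proof -
  assume "cyc_at w C x"
  then have "inj_on (\<lambda>i. \<bar>(w ^^ i) x\<bar>) {..<comp_len C}" unfolding cyc_at_def by blast
  then have "inj_on (\<lambda>i. (w ^^ i) x) {..<comp_len C}" by (auto simp: inj_on_def)
  then show ?thesis unfolding orbit_part_eq by (simp add: card_image)
qed

lemma orbit_part_uminus_disjoint:
  assumes x: "x \<in> letters n" and c: "cyc_at w C x"
  shows "orbit_part w C x \<inter> uminus ` orbit_part w C x = {}"
proof (rule ccontr)
  assume "orbit_part w C x \<inter> uminus ` orbit_part w C x \<noteq> {}"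
  then obtain i j where ij: "i < comp_len C" "j < comp_len C" "(w ^^ i) x = - (w ^^ j) x"
    unfolding orbit_part_eq by auto
  then have "\<bar>(w ^^ i) x\<bar> = \<bar>(w ^^ j) x\<bar>" by simp
  then have "i = j" using c ij unfolding cyc_at_def inj_on_def by blast
  then show False using ij(3) letters_nonzero[OF funpow_in_letters[OF w x]] by simp
qed

lemma Union_letter_orbits: "\<Union>(set (letter_orbits w (C, x))) = orbit_part w C x \<union> uminus ` orbit_part w C x"
  by (cases C) auto

lemma abs_Union_letter_orbits: "abs ` \<Union>(set (letter_orbits w (C, x))) = cyc_set w C x"
  unfolding Union_letter_orbits cyc_set_def orbit_part_eq image_Un image_image by simp

lemma letter_orbits_props:
  assumes x: "x \<in> letters n" and c: "cyc_at w C x"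
  shows "disj_list (letter_orbits w (C, x))" "{} \<notin> set (letter_orbits w (C, x))"
    "set (letter_orbits w (C, x)) \<subseteq> Pow (letters n)"
    "(\<Sum>S\<leftarrow>letter_orbits w (C, x). card S - 1) = 2 * (comp_len C - 1) + (if comp_sgn C = - 1 then 1 else 0)"
proof -
  have pos: "comp_len C \<ge> 1" using c comp_len_pos unfolding cyc_at_def by blast
  have cd: "card (orbit_part w C x) = comp_len C" using card_orbit_part[OF c] .
  have fin: "finite (orbit_part w C x)" unfolding orbit_part_def by simp
  have ne: "orbit_part w C x \<noteq> {}" using cd pos by auto
  have l: "orbit_part w C x \<subseteq> letters n" by (rule orbit_part_letters[OF x])
  then have l': "uminus ` orbit_part w C x \<subseteq> letters n" by auto
  note dj = orbit_part_uminus_disjoint[OF x c]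
  show "disj_list (letter_orbits w (C, x))" using dj by (cases C) auto
  show "{} \<notin> set (letter_orbits w (C, x))" using ne by (cases C) auto
  show "set (letter_orbits w (C, x)) \<subseteq> Pow (letters n)" using l l' by (cases C) auto
  have cu: "card (uminus ` orbit_part w C x) = comp_len C" using cd by (simp add: card_image)
  have cun: "card (orbit_part w C x \<union> uminus ` orbit_part w C x) = 2 * comp_len C"
    using card_Un_disjoint[OF fin _ dj] fin cd cu by simp
  show "(\<Sum>S\<leftarrow>letter_orbits w (C, x). card S - 1) = 2 * (comp_len C - 1) + (if comp_sgn C = - 1 then 1 else 0)"
    using cd cu cun pos by (cases C) auto
qed

lemma closed_letter_orbits:
  assumes d: "cyc_decomp n w qs" and A: "A \<subseteq> letters n"
  shows "closed_under (perm_edges (letters n) w) A \<longleftrightarrow>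
    closed_under (set (concat (map (letter_orbits w) qs))) A"
proof
  assume c: "closed_under (perm_edges (letters n) w) A"
  then have fwd: "w y \<in> A" if "y \<in> A" for y
    using closed_perm_edges_iff[OF finite_letters W_B_permutes[OF w] A] that by blast
  have bwd: "y \<in> A" if "w y \<in> A" for y
  proof -
    have "y \<in> letters n" using that A W_B_in_letters[OF w] by blast
    then have "{y, w y} \<in> perm_edges (letters n) w" unfolding perm_edges_def by blast
    then have "{y, w y} \<inter> A \<noteq> {} \<longrightarrow> {y, w y} \<subseteq> A" by (rule bspec[OF c[unfolded closed_under_def]])
    then show ?thesis using that by simp
  qed
  have pow: "(w ^^ i) y \<in> A \<longleftrightarrow> y \<in> A" for i y
  proof (induction i)
    case (Suc i)
    have "(w ^^ Suc i) y \<in> A \<longleftrightarrow> (w ^^ i) y \<in> A"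
      using fwd[of "(w ^^ i) y"] bwd[of "(w ^^ i) y"] by auto
    then show ?case using Suc by simp
  qed simp
  have orb: "z \<in> A \<longleftrightarrow> x \<in> A" if "z \<in> orbit_part w C x" for z C x
    using that pow unfolding orbit_part_eq by auto
  have norb: "- z \<in> A \<longleftrightarrow> - x \<in> A" if "z \<in> orbit_part w C x" for z C x
    using that pow[of _ "- x"] unfolding orbit_part_eq funpow_uminus[OF w] by auto
  show "closed_under (set (concat (map (letter_orbits w) qs))) A"
    unfolding closed_under_def
  proof (intro ballI impI)
    fix S assume S: "S \<in> set (concat (map (letter_orbits w) qs))" and hit: "S \<inter> A \<noteq> {}"
    then obtain C x where q: "(C, x) \<in> set qs" and SC: "S \<in> set (letter_orbits w (C, x))" by auto
    note at = cyc_decompD(2)[OF d q]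
    show "S \<subseteq> A"
    proof (cases C)
      case (TypeA k)
      then have "S = orbit_part w C x \<or> S = uminus ` orbit_part w C x" using SC by auto
      then show ?thesis
      proof
        assume e: "S = orbit_part w C x"
        then have "x \<in> A" using hit orb by blast
        then show ?thesis using orb e by blast
      next
        assume e: "S = uminus ` orbit_part w C x"
        then have "- x \<in> A" using hit norb by blast
        then show ?thesis using norb e by blast
      qed
    next
      case (TypeB k)
      then have e: "S = orbit_part w C x \<union> uminus ` orbit_part w C x" using SC by auto
      \<comment> \<open>One full round of a \<open>B\<close> cycle leads from \<open>x\<close> to
        \<open>- x\<close>, so both signed copies lie in one orbit.\<close>
      have "(w ^^ comp_len C) x = - x" using at TypeB unfolding cyc_at_def by simp
      then have x: "- x \<in> A \<longleftrightarrow> x \<in> A" using pow[of "comp_len C" x] by simp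
      then have "x \<in> A" using hit orb norb e by blast
      then show ?thesis using x orb norb e by blast
    qed
  qed
next
  assume c: "closed_under (set (concat (map (letter_orbits w) qs))) A"
  have "w y \<in> A" if y: "y \<in> A" for y
  proof (cases "w y = y")
    case True
    then show ?thesis using y by simp
  next
    case False
    have "y \<in> letters n" using y A by blast
    then have "\<exists>(C, x)\<in>set qs. \<bar>y\<bar> \<in> cyc_set w C x" using d False unfolding cyc_decomp_def by blast
    then obtain C x where q: "(C, x) \<in> set qs" and yC: "\<bar>y\<bar> \<in> cyc_set w C x" by blast
    note at = cyc_decompD(2)[OF d q]
    have in_qs: "S \<in> set (concat (map (letter_orbits w) qs))" if "S \<in> set (letter_orbits w (C, x))" for S
      using q that by force
    have cl: "S \<subseteq> A" if "S \<in> set (letter_orbits w (C, x))" "y \<in> S" for S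
    proof -
      have "S \<inter> A \<noteq> {} \<longrightarrow> S \<subseteq> A" by (rule bspec[OF c[unfolded closed_under_def] in_qs[OF that(1)]])
      then show ?thesis using that(2) y by blast
    qed
    obtain i where i: "i < comp_len C" "y = (w ^^ i) x \<or> y = - (w ^^ i) x"
      using yC unfolding cyc_set_def by (auto simp: abs_eq_iff)
    have wrap: "(w ^^ comp_len C) x = comp_sgn C * x" using at unfolding cyc_at_def by blast
    let ?O = "orbit_part w C x"
    have x: "x \<in> ?O" using i unfolding orbit_part_eq by (intro image_eqI[of _ _ 0]) auto
    have nxt: "w ((w ^^ i) x) \<in> ?O \<or> (Suc i = comp_len C \<and> w ((w ^^ i) x) = comp_sgn C * x)"
    proof (cases "Suc i < comp_len C")
      case True
      then show ?thesis unfolding orbit_part_eq by (intro disjI1 image_eqI[of _ _ "Suc i"]) auto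
    next
      case False
      then have "Suc i = comp_len C" using i by simp
      then show ?thesis using wrap by (metis comp_apply funpow.simps(2))
    qed
    have yO: "(w ^^ i) x \<in> ?O" using i unfolding orbit_part_eq by blast
    show ?thesis
    proof (cases C)
      case (TypeA k)
      then have n': "w ((w ^^ i) x) \<in> ?O" using nxt x by auto
      from i(2) show ?thesis
      proof
        assume e: "y = (w ^^ i) x"
        then have "?O \<subseteq> A" using cl[of ?O] yO TypeA by simp
        then show ?thesis using n' e by blast
      next
        assume e: "y = - (w ^^ i) x"
        then have "uminus ` ?O \<subseteq> A" using cl[of "uminus ` ?O"] yO TypeA by simp
        moreover have "w y = - w ((w ^^ i) x)" using e W_B_uminus[OF w] by simp
        ultimately show ?thesis using n' by blast
      qed
    next
      case (TypeB k)
      have n': "w ((w ^^ i) x) \<in> ?O \<union> uminus ` ?O" using nxt x TypeB by auto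
      have "y \<in> ?O \<union> uminus ` ?O" using i(2) yO by auto
      then have "?O \<union> uminus ` ?O \<subseteq> A" using cl[of "?O \<union> uminus ` ?O"] TypeB by simp
      moreover have "w y \<in> ?O \<union> uminus ` ?O"
        using i(2) n' W_B_uminus[OF w] by auto
      ultimately show ?thesis by blast
    qed
  qed
  then show "closed_under (perm_edges (letters n) w) A"
    using closed_perm_edges_iff[OF finite_letters W_B_permutes[OF w] A] by blast
qed

lemma disj_list_append:
  "disj_list (Ss @ Ts) \<longleftrightarrow> disj_list Ss \<and> disj_list Ts \<and> \<Union>(set Ss) \<inter> \<Union>(set Ts) = {}"
  by (induction Ss) auto

lemma disj_list_letter_orbits:
  assumes d: "\<forall>(C, x)\<in>set qs. x \<in> letters n \<and> cyc_at w C x"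
  shows "disj_list (cyc_sets w qs) \<Longrightarrow> disj_list (concat (map (letter_orbits w) qs))"
  using d
proof (induction qs)
  case Nil
  then show ?case by simp
next
  case (Cons q qs)
  obtain C x where q: "q = (C, x)" by fastforce
  have at: "x \<in> letters n" "cyc_at w C x" using Cons.prems(2) q by auto
  have "\<Union>(set (letter_orbits w (C, x))) \<inter> \<Union>(set (concat (map (letter_orbits w) qs))) = {}"
  proof (rule ccontr)
    assume "\<Union>(set (letter_orbits w (C, x))) \<inter> \<Union>(set (concat (map (letter_orbits w) qs))) \<noteq> {}"
    then obtain z D y where z: "z \<in> \<Union>(set (letter_orbits w (C, x)))"
      and y: "(D, y) \<in> set qs" "z \<in> \<Union>(set (letter_orbits w (D, y)))" by auto
    have "\<bar>z\<bar> \<in> cyc_set w C x" "\<bar>z\<bar> \<in> cyc_set w D y"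
      using z y(2) unfolding abs_Union_letter_orbits[symmetric] by blast+
    moreover have "cyc_set w D y \<subseteq> \<Union>(set (cyc_sets w qs))" using y(1) by force
    moreover have "cyc_set w C x \<inter> \<Union>(set (cyc_sets w qs)) = {}"
      using Cons.prems(1) unfolding q by simp
    ultimately show False by blast
  qed
  then show ?case
    using Cons letter_orbits_props(1)[OF at] unfolding q list.map concat.simps disj_list_append by simp
qed

end

text \<open>A cycle of length \<open>k\<close> has two orbits of size \<open>k\<close> in type
  \<open>A\<close>, which merge away \<open>2 * (k - 1)\<close> blocks, and one orbit of size
  \<open>2 * k\<close> in type \<open>B\<close>, which merges away one more.\<close>

lemma letters_rank_type:
  assumes "has_comb_type n w T"
  shows "perm_rank (letters n) w = 2 * A_rank T + num_B T"
proof -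
  obtain qs where w: "w \<in> W_B n" and d: "cyc_decomp n w qs" and T: "mset (map fst qs) = T"
    using assms unfolding has_comb_type_iff by blast
  let ?L = "concat (map (letter_orbits w) qs)"
  have at: "\<forall>(C, x)\<in>set qs. x \<in> letters n \<and> cyc_at w C x" using d unfolding cyc_decomp_def by blast
  have "comps (letters n) (perm_edges (letters n) w) = comps (letters n) (set ?L)"
    by (rule comps_cong) (rule closed_letter_orbits[OF w d])
  moreover have "card (comps (letters n) (set ?L)) + (\<Sum>S\<leftarrow>?L. card S - 1) = card (letters n)"
  proof (rule card_comps_disj_list[OF finite_letters])
    show "set ?L \<subseteq> Pow (letters n)" using letter_orbits_props(3)[OF w] at by fastforce
    show "{} \<notin> set ?L" using letter_orbits_props(2)[OF w] at by fastforce
    show "disj_list ?L" using disj_list_letter_orbits[OF w at] d unfolding cyc_decomp_def by blast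
  qed
  moreover have "(\<Sum>S\<leftarrow>?L. card S - 1) = 2 * A_rank T + num_B T"
    unfolding T[symmetric] using at
  proof (induction qs)
    case Nil
    then show ?case by simp
  next
    case (Cons q qs)
    obtain C x where q: "q = (C, x)" by fastforce
    have "x \<in> letters n" "cyc_at w C x" using Cons.prems unfolding q by auto
    then show ?case using Cons letter_orbits_props(4)[OF w] unfolding q by simp
  qed
  ultimately show ?thesis
    using perm_rank_eq[OF finite_letters W_B_permutes[OF w]] by simp
qed

lemma reflections_subset: "reflections n \<subseteq> W_B n"
  using reflection_types has_comb_type_W_B by blast

text \<open>The witness \<open>b\<close> is the number of reflections in the word that flip the sign
  of a single letter.\<close>

lemma reflection_list_counts:
  assumes "set ts \<subseteq> reflections n"
  shows "\<exists>b \<le> length ts. (\<Sum>t\<leftarrow>ts. abs_rank n t) = length ts - b \<and>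
    (\<Sum>t\<leftarrow>ts. perm_rank (letters n) t) = 2 * (length ts - b) + b \<and> (\<Prod>t\<leftarrow>ts. sign t) = (- 1) ^ b"
  using assms
proof (induction ts)
  case Nil
  then show ?case by simp
next
  case (Cons t ts)
  then obtain b where b: "b \<le> length ts" "(\<Sum>t\<leftarrow>ts. abs_rank n t) = length ts - b"
    "(\<Sum>t\<leftarrow>ts. perm_rank (letters n) t) = 2 * (length ts - b) + b" "(\<Prod>t\<leftarrow>ts. sign t) = (- 1) ^ b"
    by auto
  from Cons.prems reflection_types[of t n]
  have "has_comb_type n t {#TypeA 1#} \<or> has_comb_type n t {#TypeB 1#}" by simp
  then show ?case
  proof
    assume t: "has_comb_type n t {#TypeA 1#}"
    show ?thesis
      using b abs_rank_type[OF t] letters_rank_type[OF t] sign_type[OF t]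
      by (intro exI[of _ b]) (simp add: Suc_diff_le)
  next
    assume t: "has_comb_type n t {#TypeB 1#}"
    show ?thesis
      using b abs_rank_type[OF t] letters_rank_type[OF t] sign_type[OF t]
      by (intro exI[of _ "Suc b"]) simp
  qed
qed

text \<open>Take a shortest word with \<open>b\<close> sign flips. The ranks on absolute values and
  on letters bound \<open>A_rank T\<close> and \<open>2 * A_rank T + num_B T\<close> from above, the
  sign fixes the parity of \<open>b\<close>, and the word built from the cycles bounds the length by
  \<open>rk T\<close>. All four claims are arithmetic consequences.\<close>

lemma absolute_length_type:
  assumes t: "has_comb_type n w T"
  shows "A_rank T \<le> absolute_length n w"
    and "absolute_length n w = A_rank T \<longleftrightarrow> num_B T = 0"
    and "absolute_length n w = Suc (A_rank T) \<Longrightarrow> odd (num_B T) \<Longrightarrow> num_B T = 1"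
    and "num_B T = 1 \<Longrightarrow> absolute_length n w = Suc (A_rank T)"
proof -
  obtain ts where len: "length ts = absolute_length n w" and ts: "set ts \<subseteq> reflections n" and w: "w = perm_prod ts"
    using absolute_length_props(2)[OF t] by blast
  have tsW: "set ts \<subseteq> W_B n" using ts reflections_subset by blast
  obtain b where b: "b \<le> length ts" "(\<Sum>t\<leftarrow>ts. abs_rank n t) = length ts - b"
    "(\<Sum>t\<leftarrow>ts. perm_rank (letters n) t) = 2 * (length ts - b) + b" "(\<Prod>t\<leftarrow>ts. sign t) = (- 1) ^ b"
    using reflection_list_counts[OF ts] by blast
  have r1: "A_rank T \<le> length ts - b"
    using abs_rank_perm_prod_le[OF tsW] b(2) abs_rank_type[OF t] w by simp
  have r2: "2 * A_rank T + num_B T \<le> 2 * (length ts - b) + b"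
    using letters_rank_perm_prod_le[OF tsW] b(3) letters_rank_type[OF t] w by simp
  have s: "(- 1 :: int) ^ num_B T = (- 1) ^ b"
    using sign_perm_prod[OF tsW] b(4) sign_type[OF t] w by simp
  have pr: "\<forall>C\<in>#T. proper_comp C" using has_comb_type_proper[OF t] by blast
  have up: "length ts \<le> A_rank T + num_B T"
    using absolute_length_props(1)[OF t] rk_eq_A_rank[OF pr] len by simp
  show "A_rank T \<le> absolute_length n w" using r1 len by simp
  show 2: "absolute_length n w = A_rank T \<longleftrightarrow> num_B T = 0" using r1 r2 up len b(1) by arith
  show "absolute_length n w = Suc (A_rank T) \<Longrightarrow> odd (num_B T) \<Longrightarrow> num_B T = 1"
  proof -
    assume a: "absolute_length n w = Suc (A_rank T)" and o: "odd (num_B T)"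
    have "odd b" using s o by (cases "even b") auto
    then have "b = 1" using a r1 len b(1) by (cases b) auto
    then show "num_B T = 1" using r2 a len o by (cases "num_B T") auto
  qed
  show "num_B T = 1 \<Longrightarrow> absolute_length n w = Suc (A_rank T)" using 2 up len r1 by linarith
qed

lemma total_len_le:
  assumes "has_comb_type n w T"
  shows "total_len T \<le> n"
proof -
  obtain qs where w: "w \<in> W_B n" and d: "cyc_decomp n w qs" and T: "mset (map fst qs) = T"
    using assms unfolding has_comb_type_iff by blast
  note p = cyc_sets_props[OF w d]
  have sub: "\<Union>(set (cyc_sets w qs)) \<subseteq> {1..int n}" using p(1) by blast
  have fin: "\<forall>S\<in>set (cyc_sets w qs). finite S"
  proof
    fix S assume "S \<in> set (cyc_sets w qs)"
    then have "S \<subseteq> {1..int n}" using sub by blast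
    then show "finite S" by (rule finite_subset) simp
  qed
  have "total_len T = sum_list (map (comp_len \<circ> fst) qs)"
    unfolding T[symmetric] total_len_mset by simp
  also have "\<dots> = sum_list (map card (cyc_sets w qs))" unfolding card_cyc_sets[OF w d] ..
  also have "\<dots> = card (\<Union>(set (cyc_sets w qs)))" by (rule card_Union_disj_list[OF p(3) fin, symmetric])
  also have "\<dots> \<le> card {1..int n}" by (rule card_mono[OF _ sub]) simp
  finally show ?thesis by simp
qed

lemma total_len_eq: "\<forall>C\<in>#T. proper_comp C \<Longrightarrow> total_len T = A_rank T + size T"
proof (induction T)
  case (add C T)
  then have "comp_len C \<ge> 1" using comp_len_pos by simp
  then show ?case using add by (simp add: total_len_def)
qed (simp add: total_len_def)

text \<open>Connectivity gives \<open>A_rank T = n - 1\<close>. The cycles occupy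
  \<open>A_rank T + size T\<close> points, at most \<open>n\<close>, so there is only one component.
  The sign demands a \<open>B\<close> cycle, and its length must be \<open>n\<close>.\<close>

lemma type_B_full_iff:
  assumes n: "n \<ge> 1"
  shows "has_comb_type n c {#TypeB n#} \<longleftrightarrow> c \<in> W_B n \<and> conn {1..int n} (edges n c) \<and> sign c = - 1"
proof
  assume t: "has_comb_type n c {#TypeB n#}"
  have w: "c \<in> W_B n" using has_comb_type_W_B[OF t] .
  have "card (comps {1..int n} (edges n c)) = 1" using card_comps_edges[OF t] n by simp
  then have "conn {1..int n} (edges n c)" using conn_iff_card[OF _ edges_subset[OF w]] n by simp
  moreover have "sign c = - 1" using sign_type[OF t] by simp
  ultimately show "c \<in> W_B n \<and> conn {1..int n} (edges n c) \<and> sign c = - 1" using w by blast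
next
  assume a: "c \<in> W_B n \<and> conn {1..int n} (edges n c) \<and> sign c = - 1"
  then obtain T where t: "has_comb_type n c T" using has_comb_type_exists by blast
  have pr: "\<forall>C\<in>#T. proper_comp C" using has_comb_type_proper[OF t] by blast
  have r: "A_rank T = n - 1" using card_comps_edges[OF t] a unfolding conn_def by simp
  have "num_B T \<noteq> 0"
  proof
    assume "num_B T = 0"
    then show False using sign_type[OF t] a by simp
  qed
  then obtain C where C: "C \<in># T" "comp_sgn C = - 1" unfolding num_B_def by (auto dest!: size_eq_Suc_imp_elem simp: gr0_conv_Suc)
  then obtain k where k: "C = TypeB k" by (cases C) auto
  obtain T' where T': "T = add_mset C T'" using C(1) by (metis mset_add)
  have "total_len T = n - 1 + size T" using total_len_eq[OF pr] r by simp
  then have "size T' = 0" using total_len_le[OF t] n T' by simp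
  then have "T = {#TypeB k#}" using T' k by simp
  moreover from this have "k = n" using r n pr by simp
  ultimately show "has_comb_type n c {#TypeB n#}" using t by simp
qed

section \<open>Conjugation by signed permutations\<close>

lemma W_B_bij: "g \<in> W_B n \<Longrightarrow> bij g"
  using W_B_permutes permutes_bij by blast

lemma W_B_inv_comp: "g \<in> W_B n \<Longrightarrow> inv g \<circ> g = id" "g \<in> W_B n \<Longrightarrow> g \<circ> inv g = id"
  using permutes_inv_o[OF W_B_permutes] by auto

definition conj_by :: "(int \<Rightarrow> int) \<Rightarrow> (int \<Rightarrow> int) \<Rightarrow> int \<Rightarrow> int" where
  "conj_by g w = g \<circ> w \<circ> inv g"

context
  fixes n :: nat and g :: "int \<Rightarrow> int"
  assumes g: "g \<in> W_B n"
begin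

lemma conj_by_compose: "conj_by g (v \<circ> w) = conj_by g v \<circ> conj_by g w"
  using W_B_inv_comp(1)[OF g] unfolding conj_by_def by (metis comp_assoc comp_id)

lemma conj_by_id: "conj_by g id = id"
  using W_B_inv_comp(2)[OF g] unfolding conj_by_def by simp

lemma conj_by_inv: "conj_by (inv g) (conj_by g w) = w"
proof -
  have "inv (inv g) = g" using W_B_bij[OF g] by (rule inv_inv_eq)
  then show ?thesis using W_B_inv_comp(1)[OF g] unfolding conj_by_def by (metis comp_assoc comp_id id_comp)
qed

lemma conj_by_inj: "conj_by g v = conj_by g w \<longleftrightarrow> v = w"
  using conj_by_inv by metis

lemma conj_by_W_B: "w \<in> W_B n \<Longrightarrow> conj_by g w \<in> W_B n"
  unfolding conj_by_def using W_B_compose W_B_inv[OF g] g by blast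

lemma conj_by_perm_prod: "perm_prod (map (conj_by g) ws) = conj_by g (perm_prod ws)"
  by (induction ws) (simp_all only: list.map perm_prod_Nil conj_by_id perm_prod_Cons conj_by_compose)

lemma conj_by_cycle_of_list: "distinct cs \<Longrightarrow> conj_by g (cycle_of_list cs) = cycle_of_list (map g cs)"
  unfolding conj_by_def by (rule conjugation_of_cycle[OF _ W_B_bij[OF g]])

lemma map_uminus_commute: "map uminus (map g xs) = map g (map uminus xs)"
  using W_B_uminus[OF g] by simp

lemma conj_by_A_cycle:
  assumes "distinct (map abs xs)" "0 \<notin> set xs"
  shows "conj_by g (A_cycle xs) = A_cycle (map g xs)"
  unfolding A_cycle_def conj_by_compose map_uminus_commute
  using conj_by_cycle_of_list abs_list_distinct[OF assms] by metis

lemma conj_by_B_cycle: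
  assumes "distinct (map abs xs)" "0 \<notin> set xs"
  shows "conj_by g (B_cycle xs) = B_cycle (map g xs)"
proof -
  have "distinct (xs @ map uminus xs)"
    using abs_list_distinct[OF assms] uminus_notin[OF assms] by auto
  then show ?thesis
    unfolding B_cycle_def map_uminus_commute using conj_by_cycle_of_list by (metis map_append)
qed

lemma distinct_abs_map: "distinct (map abs (map g xs)) \<longleftrightarrow> distinct (map abs xs)"
  using W_B_abs_eq[OF g] by (auto simp: distinct_map inj_on_def)

text \<open>Conjugation by \<open>g\<close> only renames the entries of the cycle lists.\<close>

lemma has_comb_type_conj_by:
  assumes "has_comb_type n w T"
  shows "has_comb_type n (conj_by g w) T"
proof -
  obtain as bs where as: "\<forall>xs\<in>set as. length xs \<ge> 2" and bs: "\<forall>xs\<in>set bs. length xs \<ge> 1"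
    and sub: "set (concat (as @ bs)) \<subseteq> letters n" and dist: "distinct (map abs (concat (as @ bs)))"
    and w: "w = perm_prod (map A_cycle as @ map B_cycle bs)"
    and T: "T = mset (map (\<lambda>xs. TypeA (length xs - 1)) as) + mset (map (\<lambda>xs. TypeB (length xs)) bs)"
    using assms unfolding has_comb_type_def by blast
  have ok: "distinct (map abs xs)" "0 \<notin> set xs" if "xs \<in> set (as @ bs)" for xs
  proof -
    show "distinct (map abs xs)" using dist that unfolding distinct_abs_concat_iff by blast
    show "0 \<notin> set xs" using sub that letters_nonzero by fastforce
  qed
  have "map (conj_by g) (map A_cycle as) = map A_cycle (map (map g) as)"
    using conj_by_A_cycle ok by simp
  moreover have "map (conj_by g) (map B_cycle bs) = map B_cycle (map (map g) bs)"
    using conj_by_B_cycle ok by simp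
  ultimately have "conj_by g w = perm_prod (map A_cycle (map (map g) as) @ map B_cycle (map (map g) bs))"
    unfolding w conj_by_perm_prod[symmetric] map_append by (simp only:)
  moreover have cc: "concat (map (map g) as @ map (map g) bs) = map g (concat (as @ bs))"
    by (simp add: map_concat)
  moreover have "set (concat (map (map g) as @ map (map g) bs)) \<subseteq> letters n"
    unfolding cc using sub W_B_in_letters[OF g] by auto
  moreover have "distinct (map abs (concat (map (map g) as @ map (map g) bs)))"
    unfolding cc distinct_abs_map by (rule dist)
  moreover have "T = mset (map (\<lambda>xs. TypeA (length xs - 1)) (map (map g) as)) + mset (map (\<lambda>xs. TypeB (length xs)) (map (map g) bs))"
    unfolding T by (simp add: o_def)
  moreover have "\<forall>xs\<in>set (map (map g) as). length xs \<ge> 2" "\<forall>xs\<in>set (map (map g) bs). length xs \<ge> 1"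
    using as bs by auto
  ultimately show ?thesis unfolding has_comb_type_def by blast
qed

lemma reflections_conj_by:
  assumes "t \<in> reflections n"
  shows "conj_by g t \<in> reflections n"
proof -
  from assms consider i j where "t = A_cycle [i, j]" "i \<in> letters n" "j \<in> letters n" "\<bar>i\<bar> \<noteq> \<bar>j\<bar>"
    | i where "t = B_cycle [i]" "i \<in> letters n" unfolding reflections_def by blast
  then show ?thesis
  proof cases
    case 1
    then have "conj_by g t = A_cycle [g i, g j]"
      using conj_by_A_cycle[of "[i, j]"] letters_nonzero by auto
    moreover have "g i \<in> letters n" "g j \<in> letters n" "\<bar>g i\<bar> \<noteq> \<bar>g j\<bar>"
      using 1 W_B_in_letters[OF g] W_B_abs_eq[OF g] by auto
    ultimately show ?thesis unfolding reflections_def by blast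
  next
    case 2
    then have "conj_by g t = B_cycle [g i]"
      using conj_by_B_cycle[of "[i]"] letters_nonzero by auto
    moreover have "g i \<in> letters n" using 2 W_B_in_letters[OF g] by auto
    ultimately show ?thesis unfolding reflections_def by blast
  qed
qed

lemma reflection_word_conj_by:
  assumes "\<exists>ts. length ts = k \<and> set ts \<subseteq> reflections n \<and> w = perm_prod ts"
  shows "\<exists>ts. length ts = k \<and> set ts \<subseteq> reflections n \<and> conj_by g w = perm_prod ts"
proof -
  obtain ts where ts: "length ts = k" "set ts \<subseteq> reflections n" "w = perm_prod ts" using assms by blast
  show ?thesis
    using ts reflections_conj_by by (intro exI[of _ "map (conj_by g) ts"]) (auto simp: conj_by_perm_prod)
qed

end

text \<open>Conjugation by \<open>g\<close>, and likewise by its inverse, carries words in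
  reflections to words of the same length.\<close>

lemma absolute_length_conj_by:
  assumes g: "g \<in> W_B n"
  shows "absolute_length n (conj_by g w) = absolute_length n w"
proof -
  have "(\<exists>ts. length ts = k \<and> set ts \<subseteq> reflections n \<and> conj_by g w = perm_prod ts) \<longleftrightarrow>
      (\<exists>ts. length ts = k \<and> set ts \<subseteq> reflections n \<and> w = perm_prod ts)" for k
    using reflection_word_conj_by[OF g, of k w]
      reflection_word_conj_by[OF W_B_inv[OF g], of k "conj_by g w", unfolded conj_by_inv[OF g]] by blast
  then show ?thesis unfolding absolute_length_def by simp
qed

lemma upt_int_list: "distinct (map abs [1..int n])" "0 \<notin> set [1..int n]" "set [1..int n] \<subseteq> letters n"
proof -
  have "map abs [1..int n] = [1..int n]" by (rule map_idI) simp
  then show "distinct (map abs [1..int n])" by simp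
qed (auto simp: letters_def)

lemma coxeter_element_iff:
  assumes n: "n \<ge> 1"
  shows "coxeter_element n c \<longleftrightarrow> has_comb_type n c {#TypeB n#}"
proof
  have c0: "has_comb_type n (B_cycle [1..int n]) {#TypeB n#}"
    unfolding has_comb_type_def
    using upt_int_list[of n] n by (intro exI[of _ "[]"] exI[of _ "[[1..int n]]"]) (auto simp: perm_prod_Cons)
  assume "coxeter_element n c"
  then show "has_comb_type n c {#TypeB n#}"
    using has_comb_type_conj_by[OF _ c0] unfolding coxeter_element_def conj_by_def by blast
next
  assume "has_comb_type n c {#TypeB n#}"
  then obtain as bs where sub: "set (concat (as @ bs)) \<subseteq> letters n" and dist: "distinct (map abs (concat (as @ bs)))"
    and c: "c = perm_prod (map A_cycle as @ map B_cycle bs)"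
    and T: "{#TypeB n#} = mset (map (\<lambda>xs. TypeA (length xs - 1)) as) + mset (map (\<lambda>xs. TypeB (length xs)) bs)"
    unfolding has_comb_type_def by blast
  have "as = []"
  proof (rule ccontr)
    assume "as \<noteq> []"
    then obtain xs where "xs \<in> set as" by (cases as) auto
    then have "TypeA (length xs - 1) \<in># {#TypeB n#}" unfolding T by auto
    then show False by simp
  qed
  moreover obtain xs where "bs = [xs]" "length xs = n"
  proof -
    have m: "mset (map (\<lambda>xs. TypeB (length xs)) bs) = {#TypeB n#}" using T \<open>as = []\<close> by simp
    have "length bs = size (mset (map (\<lambda>xs. TypeB (length xs)) bs))" by simp
    also have "\<dots> = 1" unfolding m by simp
    finally obtain xs where "bs = [xs]" by (auto simp: length_Suc_conv)
    then show ?thesis using that m by simp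
  qed
  ultimately have xs: "length xs = n" "set xs \<subseteq> letters n" "distinct (map abs xs)" and cx: "c = B_cycle xs"
    using sub dist c by (auto simp: perm_prod_Cons)
  \<comment> \<open>The conjugating element sends the letter \<open>i\<close> to the entry of
    \<open>xs\<close> in place \<open>i\<close>, stored at index \<open>i - 1\<close>, and is
    extended to negative letters as an odd function.\<close>
  define g where "g y = (if y \<in> letters n then (if y > 0 then xs ! (nat y - 1) else - xs ! (nat (- y) - 1)) else y)" for y
  have ab: "\<bar>g y\<bar> = map abs xs ! (nat \<bar>y\<bar> - 1)" if "y \<in> letters n" for y
    using that xs(1) unfolding g_def letters_def by auto
  have odd: "g (- y) = - g y" if "y \<in> letters n" for y
    using that unfolding g_def letters_def by auto
  have into: "g y \<in> letters n" if y: "y \<in> letters n" for y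
  proof -
    have "nat \<bar>y\<bar> - 1 < length xs" using y xs(1) unfolding letters_def by auto
    then have "xs ! (nat \<bar>y\<bar> - 1) \<in> letters n" using xs(2) nth_mem by blast
    then show ?thesis using y unfolding g_def by auto
  qed
  have inj: "inj_on g (letters n)"
  proof (rule inj_onI)
    fix y z assume yz: "y \<in> letters n" "z \<in> letters n" "g y = g z"
    have "map abs xs ! (nat \<bar>y\<bar> - 1) = map abs xs ! (nat \<bar>z\<bar> - 1)"
      using ab[OF yz(1)] ab[OF yz(2)] yz(3) by simp
    moreover have "nat \<bar>y\<bar> - 1 < length (map abs xs)" "nat \<bar>z\<bar> - 1 < length (map abs xs)"
      using yz xs(1) unfolding letters_def by auto
    ultimately have "nat \<bar>y\<bar> - (1::nat) = nat \<bar>z\<bar> - 1" using nth_eq_iff_index_eq[OF xs(3)] by blast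
    moreover have "nat \<bar>y\<bar> \<ge> 1" "nat \<bar>z\<bar> \<ge> 1" using yz unfolding letters_def by auto
    ultimately have "nat \<bar>y\<bar> = nat \<bar>z\<bar>" by linarith
    then have "\<bar>y\<bar> = \<bar>z\<bar>" by simp
    then have "y = z \<or> y = - z" by (auto simp: abs_eq_iff)
    moreover have "y \<noteq> - z"
    proof
      assume "y = - z"
      then have "g z = - g z" using odd[OF yz(2)] yz(3) by simp
      then show False using letters_nonzero[OF into[OF yz(2)]] by simp
    qed
    ultimately show "y = z" by blast
  qed
  have "g ` letters n = letters n" by (rule endo_inj_surj[OF finite_letters _ inj]) (use into in auto)
  then have "bij_betw g (letters n) (letters n)" using inj by (simp add: bij_betw_def)
  then have "g permutes letters n" by (rule bij_imp_permutes) (simp add: g_def)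
  then have g: "g \<in> W_B n" using odd by (simp add: W_B_def)
  have "map g [1..int n] = xs"
  proof (rule nth_equalityI)
    fix i assume "i < length (map g [1..int n])"
    then have i: "i < n" by simp
    then have "[1..int n] ! i = 1 + int i" by (intro nth_upto) simp
    moreover have "1 + int i \<in> letters n" using i by (simp add: letters_def)
    moreover have "nat (1 + int i) - 1 = i" by simp
    ultimately show "map g [1..int n] ! i = xs ! i" using i by (simp add: g_def)
  qed (simp add: xs)
  then have "c = conj_by g (B_cycle [1..int n])"
    using conj_by_B_cycle[OF g upt_int_list(1,2), of n] cx by simp
  then show "coxeter_element n c" unfolding coxeter_element_def conj_by_def using g by blast
qed

section \<open>Factorisations of conjugate elements\<close>

lemma finite_factorisations: "finite (factorisations n c d T l m s)"
proof -
  define M where "M = Max (insert 0 (m ` {..<l}))"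
  let ?L = "{ts. set ts \<subseteq> W_B n \<and> length ts \<le> M}"
  have mM: "m i \<le> M" if "i < l" for i unfolding M_def using that by (intro Max_ge) auto
  have sub: "factorisations n c d T l m s \<subseteq>
      {ss. set ss \<subseteq> W_B n \<and> length ss = d} \<times> {tss. set tss \<subseteq> ?L \<and> length tss = l}"
  proof
    fix p assume "p \<in> factorisations n c d T l m s"
    then obtain ss tss where p: "p = (ss, tss)" and ss: "set ss \<subseteq> W_B n" "length ss = d"
      and tss: "length tss = l" "\<forall>i<l. length (tss ! i) = m i \<and> set (tss ! i) \<subseteq> W_B n"
      unfolding factorisations_def by blast
    have "set tss \<subseteq> ?L"
    proof
      fix ts assume "ts \<in> set tss"
      then obtain i where "i < l" "ts = tss ! i" using tss(1) by (auto simp: in_set_conv_nth)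
      then show "ts \<in> ?L" using tss(2) mM by simp
    qed
    then show "p \<in> {ss. set ss \<subseteq> W_B n \<and> length ss = d} \<times> {tss. set tss \<subseteq> ?L \<and> length tss = l}"
      using p ss tss by simp
  qed
  have "finite ?L" by (rule finite_lists_length_le[OF finite_W_B])
  then have "finite ({ss. set ss \<subseteq> W_B n \<and> length ss = d} \<times> {tss. set tss \<subseteq> ?L \<and> length tss = l})"
    by (intro finite_cartesian_product finite_lists_length_eq finite_W_B)
  then show ?thesis by (rule finite_subset[OF sub])
qed

text \<open>Conjugating every factor is injective and preserves all conditions. The same inequality
  for the inverse of \<open>g\<close> gives equality in
  \<open>card_factorisations_coxeter\<close>.\<close>

lemma card_factorisations_conj_le:
  assumes g: "g \<in> W_B n"
  shows "card (factorisations n c d T l m s) \<le> card (factorisations n (conj_by g c) d T l m s)"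
proof (rule card_inj_on_le[OF _ _ finite_factorisations])
  let ?f = "\<lambda>(ss, tss). (map (conj_by g) ss, map (map (conj_by g)) tss)"
  have "inj (conj_by g)" using conj_by_inj[OF g] by (auto simp: inj_on_def)
  then show "inj_on ?f (factorisations n c d T l m s)"
    by (auto simp: inj_on_def inj_map_eq_map inj_mapI)
  show "?f ` factorisations n c d T l m s \<subseteq> factorisations n (conj_by g c) d T l m s"
  proof
    fix p assume "p \<in> ?f ` factorisations n c d T l m s"
    then obtain ss tss where p: "p = (map (conj_by g) ss, map (map (conj_by g)) tss)"
      and f: "(ss, tss) \<in> factorisations n c d T l m s" by auto
    have "conj_by g c = perm_prod (map (conj_by g) ss @ concat (map (map (conj_by g)) tss))"
    proof -
      have "c = perm_prod (ss @ concat tss)" using f unfolding factorisations_def by auto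
      then show ?thesis
        using conj_by_perm_prod[OF g, of "ss @ concat tss"] by (simp add: map_concat)
    qed
    then show "p \<in> factorisations n (conj_by g c) d T l m s"
      using f conj_by_W_B[OF g] has_comb_type_conj_by[OF g] absolute_length_conj_by[OF g]
      unfolding p factorisations_def by (auto simp: o_def subset_iff)
  qed
qed

lemma card_factorisations_coxeter:
  assumes "coxeter_element n c" "coxeter_element n c'"
  shows "card (factorisations n c d T l m s) = card (factorisations n c' d T l m s)"
proof -
  have *: "card (factorisations n (conj_by g c0) d T l m s) = card (factorisations n c0 d T l m s)"
    if g: "g \<in> W_B n" for g c0
    using card_factorisations_conj_le[OF W_B_inv[OF g], of "conj_by g c0"] card_factorisations_conj_le[OF g, of c0]
    unfolding conj_by_inv[OF g] by (rule le_antisym)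
  show ?thesis using assms * unfolding coxeter_element_def conj_by_def by metis
qed

subsection \<open>Normalised counts\<close>

text \<open>The factor \<open>2 ^ r * fact r / real n\<close> is chosen such that
  \<open>good_Times\<close> holds with the plain product \<open>p * q\<close>.\<close>

definition good :: "nat \<Rightarrow> ('i \<Rightarrow> int set set) \<Rightarrow> 'i set \<Rightarrow> nat \<Rightarrow> real \<Rightarrow> bool" where
  "good n E X r q \<longleftrightarrow> connecting {1..int n} E X r (2 ^ r * fact r * q / real n)"

lemma good_empty: "good n E {} r 0"
  unfolding good_def by (simp add: connecting_empty)

lemma good_Un:
  "good n E X r p \<Longrightarrow> good n E Y r q \<Longrightarrow> X \<inter> Y = {} \<Longrightarrow> good n E (X \<union> Y) r (p + q)"
  unfolding good_def using connecting_disjoint_Un by (fastforce simp: algebra_simps add_divide_distrib)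

lemma good_UN:
  assumes "finite I" "\<And>i. i \<in> I \<Longrightarrow> good n E (X i) r (q i)"
    "\<And>i j. i \<in> I \<Longrightarrow> j \<in> I \<Longrightarrow> i \<noteq> j \<Longrightarrow> X i \<inter> X j = {}"
  shows "good n E (\<Union>i\<in>I. X i) r (\<Sum>i\<in>I. q i)"
proof -
  have "connecting {1..int n} E (\<Union>i\<in>I. X i) r (\<Sum>i\<in>I. 2 ^ r * fact r * q i / real n)"
    using assms unfolding good_def by (intro connecting_UN) auto
  then show ?thesis unfolding good_def by (simp add: sum_distrib_left sum_divide_distrib)
qed

lemma good_Times:
  assumes n: "n \<ge> 1" and X: "good n A X r p" and Y: "good n B Y s q"
  shows "good n (\<lambda>(x, y). A x \<union> B y) (X \<times> Y) (r + s) (p * q)"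
proof -
  have c: "connecting {1..int n} (\<lambda>(x, y). A x \<union> B y) (X \<times> Y) (r + s)
     ((2 ^ r * fact r * p / real n) * (2 ^ s * fact s * q / real n) * real (card {1..int n}) * real (r + s choose r))"
    using X Y n unfolding good_def by (intro connecting_Times) auto
  have "fact r * fact s * (r + s choose r) = (fact (r + s) :: nat)"
    using binomial_fact_lemma[of r "r + s"] by simp
  then have "real (fact r * fact s * (r + s choose r)) = real (fact (r + s))" by (rule arg_cong)
  then have "real (r + s choose r) * (fact r * fact s) = fact (r + s)" by (simp add: mult_ac)
  then have e: "fact (r + s) = real (r + s choose r) * (fact r * fact s)" by simp
  have "(2 ^ r * fact r * p / real n) * (2 ^ s * fact s * q / real n) * real (card {1..int n}) * real (r + s choose r) =
      2 ^ (r + s) * fact (r + s) * (p * q) / real n"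
    unfolding e using n by (simp add: power_add field_simps)
  then show ?thesis using c unfolding good_def by simp
qed

lemma good_Cons:
  assumes n: "n \<ge> 1" and X: "good n A X r p" and Y: "good n B Y s q"
    and B: "\<And>x xs. B (x # xs) = A x \<union> B xs"
  shows "good n B ((\<lambda>(x, xs). x # xs) ` (X \<times> Y)) (r + s) (p * q)"
  unfolding good_def
proof (rule connecting_image[OF good_Times[OF n X Y, unfolded good_def]])
  show "inj_on (\<lambda>(x, xs). x # xs) (X \<times> Y)" by (auto simp: inj_on_def)
  show "B ((\<lambda>(x, xs). x # xs) z) = (case z of (x, y) \<Rightarrow> A x \<union> B y)" for z
    by (cases z) (simp add: B)
qed

text \<open>The empty product merges nothing, so it connects precisely the partition with one block,
  whose weight is \<open>n\<close>.\<close>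

lemma good_Nil:
  assumes n: "n \<ge> 1" and B: "B [] = {}"
  shows "good n B {[]} 0 1"
  unfolding good_def
proof (rule connectingI)
  fix F assume F: "F \<subseteq> Pow {1..int n}" and k: "card (comps {1..int n} F) = Suc 0"
  then have c: "conn {1..int n} F" using conn_iff_card[of "{1..int n}" F] n by simp
  then have "{x \<in> {[]}. conn {1..int n} (B x \<union> F)} = {[]}" using B by auto
  moreover have "weight {1..int n} F = real n" using c unfolding conn_def weight_def by simp
  ultimately show "real (card {x \<in> {[]}. conn {1..int n} (B x \<union> F)}) = 2 ^ 0 * fact 0 * 1 / real n * weight {1..int n} F"
    using n by simp
qed (use B in auto)

text \<open>
  A type \<open>B\<close> cycle adds one more to the absolute length than to the number of merged blocks,
  hence families with exactly one such cycle are connecting for \<open>s - 1\<close> and empty for \<open>s = 0\<close>.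
\<close>

definition good1 :: "nat \<Rightarrow> ('i \<Rightarrow> int set set) \<Rightarrow> 'i set \<Rightarrow> nat \<Rightarrow> real \<Rightarrow> bool" where
  "good1 n E X s q \<longleftrightarrow> (if s = 0 then X = {} \<and> q = 0 else good n E X (s - 1) q)"

lemma good1_Un:
  "good1 n E X s p \<Longrightarrow> good1 n E Y s q \<Longrightarrow> X \<inter> Y = {} \<Longrightarrow> good1 n E (X \<union> Y) s (p + q)"
  unfolding good1_def using good_Un by (auto split: if_splits)

lemma good1_UN:
  assumes "finite I" "\<And>i. i \<in> I \<Longrightarrow> good1 n E (X i) s (q i)"
    "\<And>i j. i \<in> I \<Longrightarrow> j \<in> I \<Longrightarrow> i \<noteq> j \<Longrightarrow> X i \<inter> X j = {}"
  shows "good1 n E (\<Union>i\<in>I. X i) s (\<Sum>i\<in>I. q i)"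
proof (cases "s = 0")
  case True
  then show ?thesis using assms(2) unfolding good1_def by auto
next
  case False
  then show ?thesis using assms good_UN[of I n E X "s - 1" q] unfolding good1_def by auto
qed

lemma good_good1_Cons:
  assumes n: "n \<ge> 1" and X: "good n A X r p" and Y: "good1 n B Y s q"
    and B: "\<And>x xs. B (x # xs) = A x \<union> B xs"
  shows "good1 n B ((\<lambda>(x, xs). x # xs) ` (X \<times> Y)) (r + s) (p * q)"
proof (cases "s = 0")
  case True
  then have "Y = {}" "q = 0" using Y unfolding good1_def by auto
  then show ?thesis using good_empty unfolding good1_def by auto
next
  case False
  then have "good n B Y (s - 1) q" using Y unfolding good1_def by simp
  then have "good n B ((\<lambda>(x, xs). x # xs) ` (X \<times> Y)) (r + (s - 1)) (p * q)"
    by (rule good_Cons[OF n X _ B])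
  moreover have "r + (s - 1) = r + s - 1" using False by simp
  ultimately show ?thesis using False unfolding good1_def by (simp only: add_is_0 simp_thms if_False)
qed

lemma good1_good_Cons:
  assumes n: "n \<ge> 1" and X: "good1 n A X r p" and Y: "good n B Y s q"
    and B: "\<And>x xs. B (x # xs) = A x \<union> B xs"
  shows "good1 n B ((\<lambda>(x, xs). x # xs) ` (X \<times> Y)) (r + s) (p * q)"
proof (cases "r = 0")
  case True
  then have "X = {}" "p = 0" using X unfolding good1_def by auto
  then show ?thesis using good_empty unfolding good1_def by auto
next
  case False
  then have "good n A X (r - 1) p" using X unfolding good1_def by simp
  then have "good n B ((\<lambda>(x, xs). x # xs) ` (X \<times> Y)) ((r - 1) + s) (p * q)"
    by (rule good_Cons[OF n _ Y B])
  moreover have "(r - 1) + s = r + s - 1" using False by simp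
  ultimately show ?thesis using False unfolding good1_def by (simp only: add_is_0 simp_thms if_False)
qed

text \<open>This is \<open>type_coeff\<close> in the normalisation of \<open>good\<close>;
  \<open>type_weight_A\<close> and \<open>type_weight_B\<close> rewrite it as the factors of the
  final formula.\<close>

definition type_weight :: "nat \<Rightarrow> cox_type \<Rightarrow> real" where
  "type_weight n T = (if total_len T \<le> n
     then real n * fact (n - 1 - A_rank T) / (fact (n - total_len T) * (\<Prod>C\<in>set_mset T. fact (count T C))) else 0)"

lemma good_type:
  assumes n: "n \<ge> 1" and T: "\<forall>C\<in>#T. proper_comp C"
  shows "good n (edges n) {w. has_comb_type n w T} (A_rank T) (type_weight n T)"
proof -
  have "type_coeff n T = 2 ^ A_rank T * fact (A_rank T) * type_weight n T / real n"
    using n by (simp add: type_coeff_def type_weight_def)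
  then show ?thesis using connecting_type[OF n T] unfolding good_def by simp
qed

subsection \<open>Summation over types\<close>

lemma num_B_0_imp: "num_B T = 0 \<Longrightarrow> TypeB k \<notin># T"
  by (induction T) (auto split: if_splits)

text \<open>An element without \<open>B\<close> cycles and with \<open>b\<close> orbits on absolute
  values has a type coded by a list of length \<open>b\<close>: the entries are the orbit sizes
  minus one, zeros being fixed points. Sums over types thus become counts of lists with given
  sum.\<close>

definition A_parts :: "nat list \<Rightarrow> cox_type" where
  "A_parts ys = image_mset TypeA (filter_mset (\<lambda>k. k > 0) (mset ys))"

lemma A_parts_Cons [simp]: "A_parts (y # ys) = (if y > 0 then add_mset (TypeA y) (A_parts ys) else A_parts ys)"
  by (simp add: A_parts_def)

lemma A_parts_Nil [simp]: "A_parts [] = {#}"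
  by (simp add: A_parts_def)

lemma A_parts_props:
  "\<forall>C\<in>#A_parts ys. proper_comp C" "num_B (A_parts ys) = 0" "A_rank (A_parts ys) = sum_list ys"
  "size (A_parts ys) \<le> length ys"
  by (induction ys) auto

lemma A_parts_surj:
  "\<forall>C\<in>#T. proper_comp C \<Longrightarrow> num_B T = 0 \<Longrightarrow> size T \<le> b \<Longrightarrow> \<exists>ys. length ys = b \<and> A_parts ys = T"
proof (induction T arbitrary: b)
  case empty
  have "A_parts (replicate b 0) = {#}" by (induction b) auto
  then show ?case by (intro exI[of _ "replicate b 0"]) simp
next
  case (add C T)
  then obtain k where C: "C = TypeA k" "k \<ge> 1" by (cases C) auto
  obtain b' where b: "b = Suc b'" using add.prems by (cases b) auto
  obtain ys where "length ys = b'" "A_parts ys = T" using add C b by force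
  then show ?case using b C by (intro exI[of _ "k # ys"]) simp
qed

lemma card_A_parts_fiber:
  assumes T: "\<forall>C\<in>#T. proper_comp C" "num_B T = 0" and b: "size T \<le> b"
  shows "real (card {ys. length ys = b \<and> A_parts ys = T}) =
    fact b / (fact (b - size T) * (\<Prod>C\<in>set_mset T. fact (count T C)))"
proof -
  \<comment> \<open>The type \<open>T\<close> filled up to \<open>b\<close> components by fixed
    points; the lists in question are the arrangements of \<open>M\<close>.\<close>
  define M where "M = T + replicate_mset (b - size T) (TypeA 0)"
  have T0: "TypeA 0 \<notin># T" using T(1) by auto
  have TA: "\<exists>k\<ge>1. C = TypeA k" if "C \<in># T" for C
  proof (cases C)
    case (TypeA k)
    then show ?thesis using T(1) that by auto
  next
    case (TypeB k)
    then show ?thesis using num_B_0_imp[OF T(2)] that by blast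
  qed
  have mM: "mset (map TypeA ys) = A_parts ys + replicate_mset (length ys - size (A_parts ys)) (TypeA 0)" for ys
  proof (induction ys)
    case (Cons y ys)
    then show ?case using A_parts_props(4)[of ys] by (auto simp: Suc_diff_le)
  qed simp
  have "bij_betw (map TypeA) {ys. length ys = b \<and> A_parts ys = T} (permutations_of_multiset M)"
    unfolding bij_betw_def
  proof
    show "inj_on (map TypeA) {ys. length ys = b \<and> A_parts ys = T}"
      by (rule inj_onI) (auto dest: map_injective simp: inj_def)
    show "map TypeA ` {ys. length ys = b \<and> A_parts ys = T} = permutations_of_multiset M"
    proof
      show "map TypeA ` {ys. length ys = b \<and> A_parts ys = T} \<subseteq> permutations_of_multiset M"
        using mM unfolding M_def permutations_of_multiset_def by auto
      show "permutations_of_multiset M \<subseteq> map TypeA ` {ys. length ys = b \<and> A_parts ys = T}"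
      proof
        fix zs assume "zs \<in> permutations_of_multiset M"
        then have z: "mset zs = M" unfolding permutations_of_multiset_def by simp
        have "\<exists>k. C = TypeA k" if "C \<in> set zs" for C
        proof -
          have "C \<in># M" using that z by (metis set_mset_mset)
          then show ?thesis using TA unfolding M_def by (auto split: if_splits)
        qed
        then have "\<forall>C\<in>set zs. TypeA (component_rank C) = C" by force
        then have zz: "zs = map TypeA (map component_rank zs)" by (simp add: map_idI)
        define ys where "ys = map component_rank zs"
        have len: "length ys = b" using z b unfolding ys_def M_def by (metis length_map size_mset size_union size_replicate_mset le_add_diff_inverse)
        have "A_parts ys = filter_mset (\<lambda>C. C \<noteq> TypeA 0) (mset (map TypeA ys))"
          unfolding A_parts_def by (induction ys) auto
        also have "mset (map TypeA ys) = M" using z zz unfolding ys_def by simp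
        also have "filter_mset (\<lambda>C. C \<noteq> TypeA 0) M = T"
          unfolding M_def using T0 by (intro multiset_eqI) (auto simp: not_in_iff)
        finally show "zs \<in> map TypeA ` {ys. length ys = b \<and> A_parts ys = T}"
          using len zz unfolding ys_def by blast
      qed
    qed
  qed
  then have c: "card {ys. length ys = b \<and> A_parts ys = T} = card (permutations_of_multiset M)"
    by (rule bij_betw_same_card)
  have "size M = b" unfolding M_def using b by simp
  have p: "(\<Prod>C\<in>set_mset M. fact (count M C)) = fact (b - size T) * (\<Prod>C\<in>set_mset T. fact (count T C) :: nat)"
  proof -
    have "(\<Prod>C\<in>set_mset M. fact (count M C)) = (\<Prod>C\<in>insert (TypeA 0) (set_mset T). fact (count M C) :: nat)"
      by (rule prod.mono_neutral_left) (auto simp: M_def not_in_iff split: if_splits)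
    also have "\<dots> = fact (count M (TypeA 0)) * (\<Prod>C\<in>set_mset T. fact (count M C))"
      using T0 by (intro prod.insert) auto
    also have "count M (TypeA 0) = b - size T" using T0 unfolding M_def by (simp add: not_in_iff)
    also have "(\<Prod>C\<in>set_mset T. fact (count M C)) = (\<Prod>C\<in>set_mset T. fact (count T C) :: nat)"
    proof (rule prod.cong[OF refl])
      fix C assume "C \<in> set_mset T"
      then have "C \<noteq> TypeA 0" using T0 by auto
      then show "fact (count M C) = (fact (count T C) :: nat)" unfolding M_def by simp
    qed
    finally show ?thesis .
  qed
  have "card (permutations_of_multiset M) * (fact (b - size T) * (\<Prod>C\<in>set_mset T. fact (count T C))) = fact b"
    using card_permutations_of_multiset_aux[of M] unfolding p \<open>size M = b\<close> .
  then have "real (card {ys. length ys = b \<and> A_parts ys = T}) * real (fact (b - size T) * (\<Prod>C\<in>set_mset T. fact (count T C))) = real (fact b)"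
    unfolding c by (metis of_nat_mult)
  moreover have "real (fact (b - size T) * (\<Prod>C\<in>set_mset T. fact (count T C))) \<noteq> 0" by simp
  ultimately show ?thesis by (simp add: field_simps)
qed

definition num_B_of :: "nat \<Rightarrow> (int \<Rightarrow> int) \<Rightarrow> nat" where
  "num_B_of n w = num_B (THE T. has_comb_type n w T)"

lemma num_B_of_type: "has_comb_type n w T \<Longrightarrow> num_B_of n w = num_B T"
  unfolding num_B_of_def using has_comb_type_unique by (metis the_equality)

text \<open>For \<open>k \<le> 1\<close> the number \<open>r\<close> is the absolute length, see
  \<open>absolute_length_W_B\<close>. The sum of the two invariants is used in its place because the
  type determines it at once.\<close>

definition rank_class :: "nat \<Rightarrow> nat \<Rightarrow> nat \<Rightarrow> (int \<Rightarrow> int) set" where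
  "rank_class n k r = {w \<in> W_B n. num_B_of n w = k \<and> abs_rank n w + num_B_of n w = r}"

lemma rank_class_iff:
  "w \<in> rank_class n k r \<longleftrightarrow> (\<exists>T. has_comb_type n w T \<and> num_B T = k \<and> A_rank T + k = r)"
  unfolding rank_class_def
  using has_comb_type_exists[of w n] has_comb_type_W_B[of n w] num_B_of_type[of n w] abs_rank_type[of n w]
  by fastforce

text \<open>No partition of \<open>n\<close> points has more than \<open>n\<close> blocks, so the
  counting condition is vacuous and every \<open>q\<close> will do.\<close>

lemma good_large_rank:
  assumes X: "\<And>w. w \<in> X \<Longrightarrow> \<exists>T. has_comb_type n w T \<and> A_rank T = r" and r: "r \<ge> n"
  shows "good n (edges n) X r q"
  unfolding good_def
proof (rule connectingI)
  show "finite X" by (rule finite_subset[OF _ finite_W_B[of n]]) (use X has_comb_type_W_B in blast)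
  show "w \<in> X \<Longrightarrow> edges n w \<subseteq> Pow {1..int n}" for w
    using X edges_subset has_comb_type_W_B by blast
  show "w \<in> X \<Longrightarrow> F \<subseteq> Pow {1..int n} \<Longrightarrow> card (comps {1..int n} F) \<le> card (comps {1..int n} (edges n w \<union> F)) + r" for w F
    using X card_comps_edges_Un_ge by blast
  fix F :: "int set set" assume F: "F \<subseteq> Pow {1..int n}" and k: "card (comps {1..int n} F) = Suc r"
  have "card (comps {1..int n} F) \<le> n" using card_comps_le[OF F] by simp
  then show "real (card {x \<in> X. conn {1..int n} (edges n x \<union> F)}) =
      2 ^ r * fact r * q / real n * weight {1..int n} F" using k r by simp
qed

lemma card_lists_sum: "card {ys :: nat list. length ys = b \<and> sum_list ys = r} = (r + b - 1) choose r"
  by (rule card_length_sum_list)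

lemma finite_lists_sum: "finite {ys :: nat list. length ys = b \<and> sum_list ys = r}"
proof (rule finite_subset)
  show "{ys :: nat list. length ys = b \<and> sum_list ys = r} \<subseteq> {ys. set ys \<subseteq> {..r} \<and> length ys = b}"
    using member_le_sum_list by fastforce
  show "finite {ys. set ys \<subseteq> {..r} \<and> length ys = b}" by (rule finite_lists_length_eq) simp
qed

text \<open>With \<open>b = n - r\<close> orbits, the weight of a type is \<open>n / b\<close> times
  the number of lists that code it. Summed over the types this counts all lists of length
  \<open>b\<close> with sum \<open>r\<close>, and \<open>n / b * (n - 1 choose r)\<close> equals
  \<open>n choose r\<close>.\<close>

lemma good_rank_class_0:
  assumes n: "n \<ge> 1"
  shows "good n (edges n) (rank_class n 0 r) r (real (n choose r))"
proof (cases "r < n")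
  case False
  then show ?thesis by (intro good_large_rank) (auto simp: rank_class_iff)
next
  case True
  define b where "b = n - r"
  have b: "b \<ge> 1" "r + b = n" using True unfolding b_def by auto
  let ?L = "{ys :: nat list. length ys = b \<and> sum_list ys = r}"
  define I where "I = A_parts ` ?L"
  have fI: "finite I" unfolding I_def using finite_lists_sum by simp
  have IT: "\<forall>C\<in>#T. proper_comp C" "num_B T = 0" "A_rank T = r" "size T \<le> b" if "T \<in> I" for T
    using that A_parts_props unfolding I_def by auto
  have e: "rank_class n 0 r = (\<Union>T\<in>I. {w. has_comb_type n w T})"
  proof
    show "rank_class n 0 r \<subseteq> (\<Union>T\<in>I. {w. has_comb_type n w T})"
    proof
      fix w assume "w \<in> rank_class n 0 r"
      then obtain T where t: "has_comb_type n w T" and T: "num_B T = 0" "A_rank T = r" unfolding rank_class_iff by auto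
      have pr: "\<forall>C\<in>#T. proper_comp C" using has_comb_type_proper[OF t] by blast
      have "size T \<le> b" using total_len_le[OF t] total_len_eq[OF pr] T b by simp
      then obtain ys where ys: "length ys = b" "A_parts ys = T" using A_parts_surj[OF pr T(1)] by blast
      then have "sum_list ys = r" using A_parts_props(3)[of ys] T by simp
      then have "T \<in> I" unfolding I_def using ys by blast
      then show "w \<in> (\<Union>T\<in>I. {w. has_comb_type n w T})" using t by blast
    qed
    show "(\<Union>T\<in>I. {w. has_comb_type n w T}) \<subseteq> rank_class n 0 r"
      using IT unfolding rank_class_iff subset_iff by fastforce
  qed
  have g: "good n (edges n) (\<Union>T\<in>I. {w. has_comb_type n w T}) r (\<Sum>T\<in>I. type_weight n T)"
  proof (rule good_UN[OF fI])
    show "T \<in> I \<Longrightarrow> good n (edges n) {w. has_comb_type n w T} r (type_weight n T)" for T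
      using good_type[OF n] IT by metis
    show "T \<noteq> T' \<Longrightarrow> {w. has_comb_type n w T} \<inter> {w. has_comb_type n w T'} = {}" for T T'
      using has_comb_type_unique by blast
  qed
  have "(\<Sum>T\<in>I. type_weight n T) = (\<Sum>T\<in>I. real n / real b * real (card {ys\<in>?L. A_parts ys = T}))"
  proof (rule sum.cong[OF refl])
    fix T assume T: "T \<in> I"
    note t = IT[OF T]
    have "{ys\<in>?L. A_parts ys = T} = {ys. length ys = b \<and> A_parts ys = T}"
      using A_parts_props(3) t(3) by auto
    then have c: "real (card {ys\<in>?L. A_parts ys = T}) = fact b / (fact (b - size T) * (\<Prod>C\<in>set_mset T. fact (count T C)))"
      using card_A_parts_fiber[OF t(1,2,4)] by simp
    have "total_len T \<le> n" "n - total_len T = b - size T" "n - 1 - A_rank T = b - 1"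
      using total_len_eq[OF t(1)] t(3,4) b by auto
    moreover have "fact b = real b * fact (b - 1)" using b(1) by (simp add: fact_reduce)
    ultimately show "type_weight n T = real n / real b * real (card {ys\<in>?L. A_parts ys = T})"
      unfolding c type_weight_def using b(1) by simp
  qed
  also have "\<dots> = real n / real b * real (\<Sum>T\<in>I. card {ys\<in>?L. A_parts ys = T})"
    by (simp add: sum_distrib_left)
  also have "(\<Sum>T\<in>I. card {ys\<in>?L. A_parts ys = T}) = card ?L"
  proof -
    have "(\<Sum>T\<in>I. \<Sum>ys\<in>{ys\<in>?L. A_parts ys = T}. 1) = (\<Sum>ys\<in>?L. (1::nat))"
      by (rule sum.group[OF finite_lists_sum fI]) (auto simp: I_def)
    then show ?thesis by simp
  qed
  also have "card ?L = (n - 1 choose r)" using card_lists_sum[of b r] b by simp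
  also have "real n / real b * real (n - 1 choose r) = real (n choose r)"
  proof -
    have "b * (n choose r) = n * (n - 1 choose r)"
      using binomial_absorb_comp[of n r] unfolding b_def .
    then have "real b * real (n choose r) = real n * real (n - 1 choose r)" by (metis of_nat_mult)
    then show ?thesis using b(1) by (simp add: field_simps)
  qed
  finally show ?thesis using g e by simp
qed

text \<open>The \<open>B\<close> cycle is put at the head of the coding list. Only the other
  \<open>b - 1\<close> entries are arranged, their \<open>fact (b - 1)\<close> cancels completely,
  and the total is \<open>n * (n - 1 choose s)\<close> with \<open>s = r - 1\<close>, which equals
  \<open>r * (n choose r)\<close>.\<close>

lemma good1_rank_class_1:
  assumes n: "n \<ge> 1"
  shows "good1 n (edges n) (rank_class n 1 r) r (real r * real (n choose r))"
proof (cases r)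
  case 0
  then have "rank_class n 1 r = {}" by (auto simp: rank_class_def)
  then show ?thesis using 0 by (simp add: good1_def)
next
  case (Suc s)
  have "good n (edges n) (rank_class n 1 r) s (real r * real (n choose r))"
  proof (cases "s < n")
    case False
    then show ?thesis using Suc by (intro good_large_rank) (auto simp: rank_class_iff)
  next
    case True
    define b where "b = n - s"
    have b: "b \<ge> 1" "s + b = n" using True unfolding b_def by auto
    let ?L = "{ys :: nat list. length ys = b \<and> sum_list ys = s}"
    \<comment> \<open>An entry \<open>y\<close> at the head stands for a \<open>B\<close> cycle of
      length \<open>y + 1\<close>, so that every entry is an orbit size minus one and the sum is
      \<open>s\<close>.\<close>
    define f where "f ys = add_mset (TypeB (Suc (hd ys))) (A_parts (tl ys))" for ys
    define I where "I = f ` ?L"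
    have fI: "finite I" unfolding I_def using finite_lists_sum by simp
    have e: "rank_class n 1 r = (\<Union>T\<in>I. {w. has_comb_type n w T})"
    proof
      show "rank_class n 1 r \<subseteq> (\<Union>T\<in>I. {w. has_comb_type n w T})"
      proof
        fix w assume "w \<in> rank_class n 1 r"
        then obtain T where t: "has_comb_type n w T" and T: "num_B T = 1" "A_rank T = s"
          using Suc unfolding rank_class_iff by auto
        have pr: "\<forall>C\<in>#T. proper_comp C" using has_comb_type_proper[OF t] by blast
        obtain C where C: "C \<in># T" "comp_sgn C = - 1"
          using T(1) unfolding num_B_def by (auto dest!: size_eq_Suc_imp_elem)
        then obtain k where k: "C = TypeB (Suc k)" using pr by (cases C; cases "component_rank C") auto
        obtain T' where T': "T = add_mset C T'" using C(1) by (metis mset_add)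
        have pr': "\<forall>C\<in>#T'. proper_comp C" "num_B T' = 0" using pr T T' C by auto
        have "size T' \<le> b - 1"
          using total_len_le[OF t] total_len_eq[OF pr] T T' b by simp
        then obtain ys where ys: "length ys = b - 1" "A_parts ys = T'" using A_parts_surj[OF pr'] by blast
        then have "sum_list ys = A_rank T'" using A_parts_props(3)[of ys] by simp
        then have "sum_list (k # ys) = s" using T T' k by simp
        moreover have "length (k # ys) = b" using ys b by simp
        moreover have "f (k # ys) = T" using ys T' k by (simp add: f_def)
        ultimately have "T \<in> I" unfolding I_def by blast
        then show "w \<in> (\<Union>T\<in>I. {w. has_comb_type n w T})" using t by blast
      qed
      show "(\<Union>T\<in>I. {w. has_comb_type n w T}) \<subseteq> rank_class n 1 r"
      proof
        fix w assume "w \<in> (\<Union>T\<in>I. {w. has_comb_type n w T})"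
        then obtain ys where ys: "length ys = b" "sum_list ys = s" and t: "has_comb_type n w (f ys)"
          unfolding I_def by auto
        obtain y zs where "ys = y # zs" using ys b by (cases ys) auto
        then have "num_B (f ys) = 1" "A_rank (f ys) = s" using ys A_parts_props[of zs] by (auto simp: f_def)
        then show "w \<in> rank_class n 1 r" using t Suc unfolding rank_class_iff by auto
      qed
    qed
    have fib: "type_weight n T = real n * real (card {ys\<in>?L. f ys = T}) \<and> A_rank T = s \<and> (\<forall>C\<in>#T. proper_comp C)"
      if T: "T \<in> I" for T
    proof -
      obtain ys where ys: "length ys = b" "sum_list ys = s" and Tf: "T = f ys" using T unfolding I_def by auto
      obtain y zs where yz: "ys = y # zs" using ys b by (cases ys) auto
      define T' where "T' = A_parts zs"
      have TT: "T = add_mset (TypeB (Suc y)) T'" unfolding Tf yz f_def T'_def by simp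
      have p: "\<forall>C\<in>#T'. proper_comp C" "num_B T' = 0" "A_rank T' = sum_list zs" "size T' \<le> b - 1"
        using A_parts_props[of zs] ys yz unfolding T'_def by auto
      have pr: "\<forall>C\<in>#T. proper_comp C" using p TT by auto
      have r: "A_rank T = s" using TT p ys yz by simp
      note noB = num_B_0_imp[OF p(2)]
      have "{ys\<in>?L. f ys = T} = (\<lambda>zs. y # zs) ` {zs. length zs = b - 1 \<and> A_parts zs = T'}"
      proof
        show "{ys\<in>?L. f ys = T} \<subseteq> (\<lambda>zs. y # zs) ` {zs. length zs = b - 1 \<and> A_parts zs = T'}"
        proof
          fix us assume us: "us \<in> {ys\<in>?L. f ys = T}"
          then obtain u vs where uv: "us = u # vs" using b by (cases us) auto
          have ff: "add_mset (TypeB (Suc u)) (A_parts vs) = add_mset (TypeB (Suc y)) T'"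
            using us TT unfolding uv f_def by simp
          \<comment> \<open>The only \<open>B\<close> component comes from the head of the list, so
            the head can be recovered from the type.\<close>
          have "u = y"
          proof (rule ccontr)
            assume "u \<noteq> y"
            have "TypeB (Suc u) \<in># add_mset (TypeB (Suc y)) T'" unfolding ff[symmetric] by simp
            then show False using noB \<open>u \<noteq> y\<close> by simp
          qed
          then show "us \<in> (\<lambda>zs. y # zs) ` {zs. length zs = b - 1 \<and> A_parts zs = T'}"
            using ff us uv by auto
        qed
        show "(\<lambda>zs. y # zs) ` {zs. length zs = b - 1 \<and> A_parts zs = T'} \<subseteq> {ys\<in>?L. f ys = T}"
        proof
          fix us assume "us \<in> (\<lambda>zs. y # zs) ` {zs. length zs = b - 1 \<and> A_parts zs = T'}"
          then obtain vs where v: "us = y # vs" "length vs = b - 1" "A_parts vs = T'" by blast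
          then have "sum_list vs = sum_list zs" using A_parts_props(3)[of vs] p(3) by simp
          then show "us \<in> {ys\<in>?L. f ys = T}" using v ys yz b TT by (simp add: f_def)
        qed
      qed
      then have "card {ys\<in>?L. f ys = T} = card {zs. length zs = b - 1 \<and> A_parts zs = T'}"
        by (simp add: card_image)
      then have c: "real (card {ys\<in>?L. f ys = T}) = fact (b - 1) / (fact (b - 1 - size T') * (\<Prod>C\<in>set_mset T'. fact (count T' C)))"
        using card_A_parts_fiber[OF p(1,2,4)] by simp
      have "(\<Prod>C\<in>set_mset T. fact (count T C)) = (\<Prod>C\<in>set_mset T'. fact (count T' C) :: real)"
      proof -
        have "(\<Prod>C\<in>set_mset T. fact (count T C)) = fact (count T (TypeB (Suc y))) * (\<Prod>C\<in>set_mset T'. fact (count T C) :: real)"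
          unfolding TT set_mset_add_mset_insert using noB by (intro prod.insert) auto
        also have "count T (TypeB (Suc y)) = 1" using noB[of "Suc y"] unfolding TT by (simp add: not_in_iff)
        also have "(\<Prod>C\<in>set_mset T'. fact (count T C) :: real) = (\<Prod>C\<in>set_mset T'. fact (count T' C))"
        proof (rule prod.cong[OF refl])
          fix C assume "C \<in> set_mset T'"
          then have "C \<noteq> TypeB (Suc y)" using noB by auto
          then show "fact (count T C) = (fact (count T' C) :: real)" unfolding TT by simp
        qed
        finally show ?thesis by simp
      qed
      moreover have "total_len T \<le> n" "n - total_len T = b - 1 - size T'" "n - 1 - A_rank T = b - 1"
        using total_len_eq[OF pr] r p(4) b TT by auto
      ultimately show ?thesis unfolding c type_weight_def using r pr by simp
    qed
    have g: "good n (edges n) (\<Union>T\<in>I. {w. has_comb_type n w T}) s (\<Sum>T\<in>I. type_weight n T)"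
    proof (rule good_UN[OF fI])
      show "T \<in> I \<Longrightarrow> good n (edges n) {w. has_comb_type n w T} s (type_weight n T)" for T
        using good_type[OF n] fib by metis
      show "T \<noteq> T' \<Longrightarrow> {w. has_comb_type n w T} \<inter> {w. has_comb_type n w T'} = {}" for T T'
        using has_comb_type_unique by blast
    qed
    have "(\<Sum>T\<in>I. type_weight n T) = (\<Sum>T\<in>I. real n * real (card {ys\<in>?L. f ys = T}))"
      by (rule sum.cong) (use fib in auto)
    also have "\<dots> = real n * real (\<Sum>T\<in>I. card {ys\<in>?L. f ys = T})" by (simp add: sum_distrib_left)
    also have "(\<Sum>T\<in>I. card {ys\<in>?L. f ys = T}) = card ?L"
    proof -
      have "(\<Sum>T\<in>I. \<Sum>ys\<in>{ys\<in>?L. f ys = T}. 1) = (\<Sum>ys\<in>?L. (1::nat))"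
        by (rule sum.group[OF finite_lists_sum fI]) (auto simp: I_def)
      then show ?thesis by simp
    qed
    also have "card ?L = (n - 1 choose s)" using card_lists_sum[of b s] b by simp
    also have "real n * real (n - 1 choose s) = real r * real (n choose r)"
    proof -
      have "Suc s * (Suc (n - 1) choose Suc s) = Suc (n - 1) * (n - 1 choose s)"
        using Suc_times_binomial_eq[of "n - 1" s] by (simp add: mult_ac)
      then have "r * (n choose r) = n * (n - 1 choose s)" using n Suc by simp
      then show ?thesis by (metis of_nat_mult)
    qed
    finally show ?thesis using g e by simp
  qed
  then show ?thesis using Suc by (simp add: good1_def)
qed

subsection \<open>Blocks of factors\<close>

definition block_class :: "nat \<Rightarrow> nat \<Rightarrow> nat \<Rightarrow> nat \<Rightarrow> (int \<Rightarrow> int) list set" where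
  "block_class n k m s = {ts. length ts = m \<and> set ts \<subseteq> W_B n \<and> (\<Sum>t\<leftarrow>ts. num_B_of n t) = k \<and>
     (\<Sum>t\<leftarrow>ts. abs_rank n t + num_B_of n t) = s}"

abbreviation cons_set :: "'a set \<Rightarrow> 'a list set \<Rightarrow> 'a list set" where
  "cons_set X Y \<equiv> (\<lambda>(x, xs). x # xs) ` (X \<times> Y)"

lemma edges_list_Cons: "edges_list n (w # ws) = edges n w \<union> edges_list n ws"
  by (simp add: edges_list_def)

lemma block_class_0_Suc:
  "block_class n 0 (Suc m) s = (\<Union>r\<in>{..s}. cons_set (rank_class n 0 r) (block_class n 0 m (s - r)))"
proof (intro set_eqI iffI)
  fix zs assume z: "zs \<in> block_class n 0 (Suc m) s"
  then obtain t ts where e: "zs = t # ts" unfolding block_class_def by (cases zs) auto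
  define r where "r = abs_rank n t + num_B_of n t"
  have "r \<le> s" "t \<in> rank_class n 0 r" "ts \<in> block_class n 0 m (s - r)"
    using z unfolding e block_class_def rank_class_def r_def by auto
  then show "zs \<in> (\<Union>r\<in>{..s}. cons_set (rank_class n 0 r) (block_class n 0 m (s - r)))"
    unfolding e by blast
next
  fix zs assume "zs \<in> (\<Union>r\<in>{..s}. cons_set (rank_class n 0 r) (block_class n 0 m (s - r)))"
  then show "zs \<in> block_class n 0 (Suc m) s"
    unfolding block_class_def rank_class_def by auto
qed

lemma block_class_1_Suc:
  "block_class n 1 (Suc m) s =
     (\<Union>r\<in>{..s}. cons_set (rank_class n 0 r) (block_class n 1 m (s - r))) \<union>
     (\<Union>r\<in>{..s}. cons_set (rank_class n 1 r) (block_class n 0 m (s - r)))" (is "_ = ?A \<union> ?B")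
proof (intro set_eqI iffI)
  fix zs assume z: "zs \<in> block_class n 1 (Suc m) s"
  then obtain t ts where e: "zs = t # ts" unfolding block_class_def by (cases zs) auto
  define r where "r = abs_rank n t + num_B_of n t"
  have r: "r \<le> s" using z unfolding e block_class_def r_def by auto
  have "num_B_of n t = 0 \<or> num_B_of n t = 1" using z unfolding e block_class_def by auto
  then show "zs \<in> ?A \<union> ?B"
  proof
    assume "num_B_of n t = 0"
    then have "t \<in> rank_class n 0 r" "ts \<in> block_class n 1 m (s - r)"
      using z unfolding e block_class_def rank_class_def r_def by auto
    then show ?thesis using r unfolding e by blast
  next
    assume "num_B_of n t = 1"
    then have "t \<in> rank_class n 1 r" "ts \<in> block_class n 0 m (s - r)"
      using z unfolding e block_class_def rank_class_def r_def by auto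
    then show ?thesis using r unfolding e by blast
  qed
next
  fix zs assume "zs \<in> ?A \<union> ?B"
  then show "zs \<in> block_class n 1 (Suc m) s"
    unfolding block_class_def rank_class_def by auto
qed

lemma rank_class_disjoint: "w \<in> rank_class n k r \<Longrightarrow> w \<in> rank_class n k' r' \<Longrightarrow> k = k' \<and> r = r'"
  unfolding rank_class_def by auto

lemma cons_set_disjoint: "(\<And>x. x \<in> X \<Longrightarrow> x \<in> X' \<Longrightarrow> False) \<Longrightarrow> cons_set X Y \<inter> cons_set X' Y' = {}"
  by auto

lemma good_block_class_0:
  assumes n: "n \<ge> 1"
  shows "good n (edges_list n) (block_class n 0 m s) s (real (m * n choose s))"
proof (induction m arbitrary: s)
  case 0
  have E: "edges_list n [] = {}" by (simp add: edges_list_def)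
  show ?case
  proof (cases "s = 0")
    case True
    then have "block_class n 0 0 s = {[]}" by (auto simp: block_class_def)
    then show ?thesis using good_Nil[of n "edges_list n", OF n E] True by simp
  next
    case False
    then have "block_class n 0 0 s = {}" by (auto simp: block_class_def)
    moreover have "real (0 * n choose s) = 0" using False by (simp add: binomial_eq_0)
    ultimately show ?thesis using good_empty by (simp only:)
  qed
next
  case (Suc m)
  have "good n (edges_list n) (\<Union>r\<in>{..s}. cons_set (rank_class n 0 r) (block_class n 0 m (s - r))) s
      (\<Sum>r\<in>{..s}. real (n choose r) * real (m * n choose (s - r)))"
  proof (rule good_UN)
    fix r assume "r \<in> {..s}"
    then have "r + (s - r) = s" by simp
    then show "good n (edges_list n) (cons_set (rank_class n 0 r) (block_class n 0 m (s - r))) s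
        (real (n choose r) * real (m * n choose (s - r)))"
      using good_Cons[OF n good_rank_class_0[OF n, of r] Suc[of "s - r"] edges_list_Cons] by simp
  next
    show "r \<noteq> r' \<Longrightarrow> cons_set (rank_class n 0 r) (block_class n 0 m (s - r)) \<inter>
      cons_set (rank_class n 0 r') (block_class n 0 m (s - r')) = {}" for r r'
      by (rule cons_set_disjoint) (use rank_class_disjoint in blast)
  qed simp
  moreover have "(\<Sum>r\<in>{..s}. real (n choose r) * real (m * n choose (s - r))) = real (Suc m * n choose s)"
    using vandermonde[of n "m * n" s] by (simp flip: of_nat_mult of_nat_sum)
  ultimately show ?case unfolding block_class_0_Suc by simp
qed

text \<open>A product rule: the \<open>B\<close> cycle sits in a later factor, with coefficient
  \<open>s - r\<close>, or in the first one, with coefficient \<open>r\<close>. The terms agree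
  otherwise, so the coefficients add up to \<open>s\<close> before the Vandermonde identity is
  applied.\<close>

lemma good1_block_class_1:
  assumes n: "n \<ge> 1"
  shows "good1 n (edges_list n) (block_class n 1 m s) s (real s * real (m * n choose s))"
proof (induction m arbitrary: s)
  case 0
  have "block_class n 1 0 s = {}" by (auto simp: block_class_def)
  then show ?case using good_empty by (cases s) (auto simp: good1_def)
next
  case (Suc m)
  let ?A = "\<Union>r\<in>{..s}. cons_set (rank_class n 0 r) (block_class n 1 m (s - r))"
  let ?B = "\<Union>r\<in>{..s}. cons_set (rank_class n 1 r) (block_class n 0 m (s - r))"
  have A: "good1 n (edges_list n) ?A s (\<Sum>r\<in>{..s}. real (n choose r) * (real (s - r) * real (m * n choose (s - r))))"
  proof (rule good1_UN)
    fix r assume "r \<in> {..s}"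
    then have "r + (s - r) = s" by simp
    then show "good1 n (edges_list n) (cons_set (rank_class n 0 r) (block_class n 1 m (s - r))) s
        (real (n choose r) * (real (s - r) * real (m * n choose (s - r))))"
      using good_good1_Cons[OF n good_rank_class_0[OF n, of r] Suc[of "s - r"] edges_list_Cons] by simp
  next
    show "r \<noteq> r' \<Longrightarrow> cons_set (rank_class n 0 r) (block_class n 1 m (s - r)) \<inter>
      cons_set (rank_class n 0 r') (block_class n 1 m (s - r')) = {}" for r r'
      by (rule cons_set_disjoint) (use rank_class_disjoint in blast)
  qed simp
  have B: "good1 n (edges_list n) ?B s (\<Sum>r\<in>{..s}. (real r * real (n choose r)) * real (m * n choose (s - r)))"
  proof (rule good1_UN)
    fix r assume "r \<in> {..s}"
    then have "r + (s - r) = s" by simp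
    then show "good1 n (edges_list n) (cons_set (rank_class n 1 r) (block_class n 0 m (s - r))) s
        ((real r * real (n choose r)) * real (m * n choose (s - r)))"
      using good1_good_Cons[OF n good1_rank_class_1[OF n, of r] good_block_class_0[OF n, of m "s - r"] edges_list_Cons] by simp
  next
    show "r \<noteq> r' \<Longrightarrow> cons_set (rank_class n 1 r) (block_class n 0 m (s - r)) \<inter>
      cons_set (rank_class n 1 r') (block_class n 0 m (s - r')) = {}" for r r'
      by (rule cons_set_disjoint) (use rank_class_disjoint in blast)
  qed simp
  have dj: "?A \<inter> ?B = {}"
  proof (rule ccontr)
    assume "?A \<inter> ?B \<noteq> {}"
    then obtain t r r' where "t \<in> rank_class n 0 r" "t \<in> rank_class n 1 r'" by auto
    then show False using rank_class_disjoint by fastforce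
  qed
  have "(\<Sum>r\<in>{..s}. real (n choose r) * (real (s - r) * real (m * n choose (s - r)))) +
      (\<Sum>r\<in>{..s}. (real r * real (n choose r)) * real (m * n choose (s - r))) =
      (\<Sum>r\<in>{..s}. real s * (real (n choose r) * real (m * n choose (s - r))))"
    unfolding sum.distrib[symmetric] by (rule sum.cong) (auto simp: algebra_simps of_nat_diff)
  also have "\<dots> = real s * real (Suc m * n choose s)"
    using vandermonde[of n "m * n" s] by (simp add: sum_distrib_left[symmetric] flip: of_nat_mult of_nat_sum)
  finally show ?case using good1_Un[OF A B dj] unfolding block_class_1_Suc by simp
qed

definition edges_lists :: "nat \<Rightarrow> (int \<Rightarrow> int) list list \<Rightarrow> int set set" where
  "edges_lists n tss = (\<Union>ts\<in>set tss. edges_list n ts)"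

lemma edges_lists_Cons: "edges_lists n (ts # tss) = edges_list n ts \<union> edges_lists n tss"
  by (simp add: edges_lists_def)

definition blocks_class :: "nat \<Rightarrow> nat \<Rightarrow> (nat \<times> nat) list \<Rightarrow> (int \<Rightarrow> int) list list set" where
  "blocks_class n k ps = {tss. list_all2 (\<lambda>ts p. length ts = fst p \<and> set ts \<subseteq> W_B n \<and>
      (\<Sum>t\<leftarrow>ts. abs_rank n t + num_B_of n t) = snd p) tss ps \<and>
     (\<Sum>ts\<leftarrow>tss. \<Sum>t\<leftarrow>ts. num_B_of n t) = k}"

lemma blocks_class_Cons_iff:
  "ts # tss \<in> blocks_class n k (p # ps) \<longleftrightarrow>
    (\<exists>i\<le>k. ts \<in> block_class n i (fst p) (snd p) \<and> tss \<in> blocks_class n (k - i) ps)"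
  unfolding blocks_class_def block_class_def by auto

lemma blocks_class_Cons_cases: "zs \<in> blocks_class n k (p # ps) \<Longrightarrow> \<exists>ts tss. zs = ts # tss"
  unfolding blocks_class_def by (auto simp: list_all2_Cons2)

lemma blocks_class_0_Cons:
  "blocks_class n 0 (p # ps) = cons_set (block_class n 0 (fst p) (snd p)) (blocks_class n 0 ps)"
proof (intro set_eqI iffI)
  fix zs assume z: "zs \<in> blocks_class n 0 (p # ps)"
  then obtain ts tss where "zs = ts # tss" using blocks_class_Cons_cases by blast
  then show "zs \<in> cons_set (block_class n 0 (fst p) (snd p)) (blocks_class n 0 ps)"
    using z blocks_class_Cons_iff[of ts tss n 0 p ps] by auto
next
  fix zs assume "zs \<in> cons_set (block_class n 0 (fst p) (snd p)) (blocks_class n 0 ps)"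
  then show "zs \<in> blocks_class n 0 (p # ps)" using blocks_class_Cons_iff[of _ _ n 0 p ps] by auto
qed

lemma blocks_class_1_Cons:
  "blocks_class n 1 (p # ps) = cons_set (block_class n 0 (fst p) (snd p)) (blocks_class n 1 ps) \<union>
     cons_set (block_class n 1 (fst p) (snd p)) (blocks_class n 0 ps)" (is "_ = ?A \<union> ?B")
proof (intro set_eqI iffI)
  fix zs assume z: "zs \<in> blocks_class n 1 (p # ps)"
  then obtain ts tss where e: "zs = ts # tss" using blocks_class_Cons_cases by blast
  then obtain i where i: "i \<le> 1" "ts \<in> block_class n i (fst p) (snd p)" "tss \<in> blocks_class n (1 - i) ps"
    using z blocks_class_Cons_iff[of ts tss n 1 p ps] by auto
  then show "zs \<in> ?A \<union> ?B" unfolding e by (cases i) auto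
next
  fix zs assume "zs \<in> ?A \<union> ?B"
  then consider ts tss where "zs = ts # tss" "ts \<in> block_class n 0 (fst p) (snd p)" "tss \<in> blocks_class n 1 ps"
    | ts tss where "zs = ts # tss" "ts \<in> block_class n 1 (fst p) (snd p)" "tss \<in> blocks_class n 0 ps"
    by auto
  then show "zs \<in> blocks_class n 1 (p # ps)"
  proof cases
    case 1
    then show ?thesis using blocks_class_Cons_iff[of ts tss n 1 p ps] by (auto intro!: exI[of _ 0])
  next
    case 2
    then show ?thesis using blocks_class_Cons_iff[of ts tss n 1 p ps] by (auto intro!: exI[of _ 1])
  qed
qed

lemma good_blocks_class_0:
  assumes n: "n \<ge> 1"
  shows "good n (edges_lists n) (blocks_class n 0 ps) (\<Sum>p\<leftarrow>ps. snd p) (\<Prod>p\<leftarrow>ps. real (fst p * n choose snd p))"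
proof (induction ps)
  case Nil
  have "blocks_class n 0 [] = {[]}" by (auto simp: blocks_class_def)
  moreover have "edges_lists n [] = {}" by (simp add: edges_lists_def)
  ultimately show ?case using good_Nil[of n "edges_lists n", OF n] by simp
next
  case (Cons p ps)
  show ?case
    using good_Cons[OF n good_block_class_0[OF n, of "fst p" "snd p"] Cons.IH edges_lists_Cons]
    unfolding blocks_class_0_Cons by simp
qed

text \<open>The same product rule one level up: the block that contains the \<open>B\<close> cycle
  contributes its own \<open>snd p\<close>, and these add up.\<close>

lemma good1_blocks_class_1:
  assumes n: "n \<ge> 1"
  shows "good1 n (edges_lists n) (blocks_class n 1 ps) (\<Sum>p\<leftarrow>ps. snd p)
    (real (\<Sum>p\<leftarrow>ps. snd p) * (\<Prod>p\<leftarrow>ps. real (fst p * n choose snd p)))"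
proof (induction ps)
  case Nil
  have "blocks_class n 1 [] = {}" by (auto simp: blocks_class_def)
  then show ?case by (simp add: good1_def)
next
  case (Cons p ps)
  let ?b = "real (fst p * n choose snd p)" and ?P = "\<Prod>p\<leftarrow>ps. real (fst p * n choose snd p)"
  let ?S = "\<Sum>p\<leftarrow>ps. snd p"
  let ?A = "cons_set (block_class n 0 (fst p) (snd p)) (blocks_class n 1 ps)"
  let ?B = "cons_set (block_class n 1 (fst p) (snd p)) (blocks_class n 0 ps)"
  have A: "good1 n (edges_lists n) ?A (snd p + ?S) (?b * (real ?S * ?P))"
    by (rule good_good1_Cons[OF n good_block_class_0[OF n] Cons.IH edges_lists_Cons])
  have B: "good1 n (edges_lists n) ?B (snd p + ?S) ((real (snd p) * ?b) * ?P)"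
    by (rule good1_good_Cons[OF n good1_block_class_1[OF n] good_blocks_class_0[OF n] edges_lists_Cons])
  have dj: "?A \<inter> ?B = {}"
  proof (rule cons_set_disjoint)
    fix ts assume "ts \<in> block_class n 0 (fst p) (snd p)" "ts \<in> block_class n 1 (fst p) (snd p)"
    then have "(\<Sum>t\<leftarrow>ts. num_B_of n t) = 0" "(\<Sum>t\<leftarrow>ts. num_B_of n t) = 1" unfolding block_class_def by blast+
    then show False by linarith
  qed
  have "?b * (real ?S * ?P) + (real (snd p) * ?b) * ?P = real (snd p + ?S) * (?b * ?P)"
    by (simp add: algebra_simps)
  then show ?case using good1_Un[OF A B dj] unfolding blocks_class_1_Cons by simp
qed

definition typed_lists :: "nat \<Rightarrow> cox_type list \<Rightarrow> (int \<Rightarrow> int) list set" where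
  "typed_lists n Ts = {ss. list_all2 (has_comb_type n) ss Ts}"

lemma typed_lists_Cons: "typed_lists n (T # Ts) = cons_set {w. has_comb_type n w T} (typed_lists n Ts)"
  unfolding typed_lists_def by (auto simp: list_all2_Cons2)

lemma good_typed_lists:
  assumes n: "n \<ge> 1"
  shows "\<forall>T\<in>set Ts. \<forall>C\<in>#T. proper_comp C \<Longrightarrow>
    good n (edges_list n) (typed_lists n Ts) (\<Sum>T\<leftarrow>Ts. A_rank T) (\<Prod>T\<leftarrow>Ts. type_weight n T)"
proof (induction Ts)
  case Nil
  have "typed_lists n [] = {[]}" by (auto simp: typed_lists_def)
  moreover have "edges_list n [] = {}" by (simp add: edges_list_def)
  ultimately show ?case using good_Nil[of n "edges_list n", OF n] by simp
next
  case (Cons T Ts)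
  then have T: "\<forall>C\<in>#T. proper_comp C"
    and IH: "good n (edges_list n) (typed_lists n Ts) (\<Sum>T\<leftarrow>Ts. A_rank T) (\<Prod>T\<leftarrow>Ts. type_weight n T)" by auto
  show ?case using good_Cons[OF n good_type[OF n T] IH edges_list_Cons] unfolding typed_lists_Cons by simp
qed

subsection \<open>Factorisations of Coxeter elements\<close>

lemma absolute_length_W_B:
  assumes w: "w \<in> W_B n"
  shows "abs_rank n w \<le> absolute_length n w"
    and "absolute_length n w = abs_rank n w \<longleftrightarrow> num_B_of n w = 0"
    and "absolute_length n w = Suc (abs_rank n w) \<Longrightarrow> odd (num_B_of n w) \<Longrightarrow> num_B_of n w = 1"
    and "num_B_of n w \<le> 1 \<Longrightarrow> absolute_length n w = abs_rank n w + num_B_of n w"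
    and "sign w = (- 1) ^ num_B_of n w"
proof -
  obtain T where t: "has_comb_type n w T" using has_comb_type_exists[OF w] by blast
  note a = absolute_length_type[OF t] and e = abs_rank_type[OF t] num_B_of_type[OF t]
  show "abs_rank n w \<le> absolute_length n w" using a(1) e by simp
  show "absolute_length n w = abs_rank n w \<longleftrightarrow> num_B_of n w = 0" using a(2) e by simp
  show "absolute_length n w = Suc (abs_rank n w) \<Longrightarrow> odd (num_B_of n w) \<Longrightarrow> num_B_of n w = 1"
    using a(3) e by simp
  show "num_B_of n w \<le> 1 \<Longrightarrow> absolute_length n w = abs_rank n w + num_B_of n w"
    using a(2,4) e by (cases "num_B T") auto
  show "sign w = (- 1) ^ num_B_of n w" using sign_type[OF t] e by simp
qed

lemma sum_abs_rank_le:
  "set ts \<subseteq> W_B n \<Longrightarrow> (\<Sum>t\<leftarrow>ts. abs_rank n t) \<le> (\<Sum>t\<leftarrow>ts. absolute_length n t)"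
  using absolute_length_W_B(1) by (intro sum_list_mono) auto

text \<open>No factor is shorter than its rank, so comparing the sums forces equality for each
  factor.\<close>

lemma tight_lengths_0:
  "set ts \<subseteq> W_B n \<Longrightarrow> (\<Sum>t\<leftarrow>ts. absolute_length n t) \<le> (\<Sum>t\<leftarrow>ts. abs_rank n t) \<Longrightarrow>
    \<forall>t\<in>set ts. num_B_of n t = 0"
proof (induction ts)
  case (Cons t ts)
  then have t: "t \<in> W_B n" and ts: "set ts \<subseteq> W_B n" by auto
  have "absolute_length n t = abs_rank n t" "(\<Sum>t\<leftarrow>ts. absolute_length n t) \<le> (\<Sum>t\<leftarrow>ts. abs_rank n t)"
    using Cons.prems(2) absolute_length_W_B(1)[OF t] sum_abs_rank_le[OF ts] by auto
  then show ?case using Cons.IH[OF ts] absolute_length_W_B(2)[OF t] by simp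
qed simp

text \<open>At most one factor exceeds its rank, and then by one. The others have no
  \<open>B\<close> cycles, so the odd total belongs to this factor, where excess one and odd parity
  leave only one cycle.\<close>

lemma tight_lengths_1:
  "set ts \<subseteq> W_B n \<Longrightarrow> (\<Sum>t\<leftarrow>ts. absolute_length n t) \<le> Suc (\<Sum>t\<leftarrow>ts. abs_rank n t) \<Longrightarrow>
    odd (\<Sum>t\<leftarrow>ts. num_B_of n t) \<Longrightarrow> (\<Sum>t\<leftarrow>ts. num_B_of n t) = 1"
proof (induction ts)
  case (Cons t ts)
  then have t: "t \<in> W_B n" and ts: "set ts \<subseteq> W_B n" by auto
  note le = absolute_length_W_B(1)[OF t] sum_abs_rank_le[OF ts]
  show ?case
  proof (cases "absolute_length n t = abs_rank n t")
    case True
    then show ?thesis using Cons.IH[OF ts] Cons.prems absolute_length_W_B(2)[OF t] by simp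
  next
    case False
    then have e: "absolute_length n t = Suc (abs_rank n t)"
      and "(\<Sum>t\<leftarrow>ts. absolute_length n t) \<le> (\<Sum>t\<leftarrow>ts. abs_rank n t)" using Cons.prems(2) le by auto
    then have "\<forall>t\<in>set ts. num_B_of n t = 0" using tight_lengths_0[OF ts] by blast
    then have 0: "(\<Sum>t\<leftarrow>ts. num_B_of n t) = 0" by simp
    have s: "(\<Sum>t\<leftarrow>t # ts. num_B_of n t) = num_B_of n t" unfolding list.map sum_list.Cons 0 by simp
    show ?thesis using absolute_length_W_B(3)[OF t e] Cons.prems(3) unfolding s by blast
  qed
qed simp

lemma sign_perm_prod_num_B:
  assumes "set zs \<subseteq> W_B n"
  shows "sign (perm_prod zs) = (- 1) ^ (\<Sum>z\<leftarrow>zs. num_B_of n z)"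
  unfolding sign_perm_prod[OF assms] using assms
  by (induction zs) (simp_all add: absolute_length_W_B(5) power_add)

lemma weight_discrete: "weight U {} = 1"
  unfolding weight_def comps_empty by (simp add: prod.reindex)

text \<open>The discrete partition has \<open>n\<close> blocks and weight one, so taking
  \<open>F\<close> empty returns the constant itself.\<close>

lemma good_card_conn:
  assumes n: "n \<ge> 1" and g: "good n E X (n - 1) q"
  shows "real (card {x\<in>X. conn {1..int n} (E x)}) = 2 ^ (n - 1) * fact (n - 1) * q / real n"
  using connectingD(4)[OF g[unfolded good_def], of "{}"] n
  by (simp add: card_comps_empty weight_discrete)

text \<open>Coxeter elements form the single type \<open>B_n\<close>, and every element of it is
  connecting, so their number comes from the same count applied to one factor.\<close>

lemma card_coxeter:
  assumes n: "n \<ge> 1"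
  shows "finite {c. coxeter_element n c}" "real (card {c. coxeter_element n c}) = 2 ^ (n - 1) * fact (n - 1)"
proof -
  have e: "{c. coxeter_element n c} = {c. has_comb_type n c {#TypeB n#}}"
    using coxeter_element_iff[OF n] by simp
  show "finite {c. coxeter_element n c}"
    unfolding e by (rule finite_subset[OF _ finite_W_B[of n]]) (auto simp: has_comb_type_W_B)
  have "good n (edges n) {c. has_comb_type n c {#TypeB n#}} (n - 1) (type_weight n {#TypeB n#})"
    using good_type[OF n, of "{#TypeB n#}"] n by simp
  from good_card_conn[OF n this]
  have "real (card {c \<in> {c. has_comb_type n c {#TypeB n#}}. conn {1..int n} (edges n c)}) = 2 ^ (n - 1) * fact (n - 1)"
    using n by (simp add: type_weight_def total_len_def)
  moreover have "{c \<in> {c. has_comb_type n c {#TypeB n#}}. conn {1..int n} (edges n c)} = {c. has_comb_type n c {#TypeB n#}}"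
    using type_B_full_iff[OF n] by blast
  ultimately show "real (card {c. coxeter_element n c}) = 2 ^ (n - 1) * fact (n - 1)" unfolding e by simp
qed

definition pair_edges :: "nat \<Rightarrow> (int \<Rightarrow> int) list \<times> (int \<Rightarrow> int) list list \<Rightarrow> int set set" where
  "pair_edges n = (\<lambda>(ss, tss). edges_list n ss \<union> edges_lists n tss)"

lemma pair_edges_eq: "pair_edges n (ss, tss) = edges_list n (ss @ concat tss)"
  unfolding pair_edges_def edges_lists_def edges_list_def by auto

lemma sum_list_concat_map: "(\<Sum>x\<leftarrow>concat xss. f x) = (\<Sum>xs\<leftarrow>xss. \<Sum>x\<leftarrow>xs. f x :: nat)"
  by (induction xss) auto

context
  fixes n d l k :: nat and T :: "nat \<Rightarrow> cox_type" and m s :: "nat \<Rightarrow> nat"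
  assumes n: "n \<ge> 1"
    and proper: "\<forall>i<d. \<forall>C\<in>#T i. proper_comp C"
    and k: "k \<le> 1" "(\<Sum>i<d. num_B (T i)) + k = 1"
    and rank: "(\<Sum>i<d. rk (T i)) + (\<Sum>i<l. s i) = n"
begin

text \<open>The number \<open>k\<close> of \<open>B\<close> cycles left to the blocks is
  \<open>0\<close> in (i) and \<open>1\<close> in (ii). A \<open>B\<close> cycle adds one to the
  rank beyond what it merges, so the ranks on absolute values must add up to
  \<open>n - 1\<close>.\<close>

lemma sum_A_rank: "(\<Sum>i<d. A_rank (T i)) + (\<Sum>i<l. s i) + 1 = n + k"
proof -
  have "(\<Sum>i<d. rk (T i)) = (\<Sum>i<d. A_rank (T i)) + (\<Sum>i<d. num_B (T i))"
    unfolding sum.distrib[symmetric] using proper rk_eq_A_rank by (intro sum.cong) auto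
  then show ?thesis using rank k by simp
qed

text \<open>From left to right, a transitive product forces connectivity and hence a total rank of
  at least \<open>n - 1\<close>. This leaves an excess of at most \<open>k\<close> of lengths over
  ranks in the blocks, and the sign \<open>- 1\<close> then makes the number of \<open>B\<close>
  cycles there exactly \<open>k\<close>. From right to left the ranks are tight, so the product is
  transitive, and an odd number of \<open>B\<close> cycles gives it the sign
  \<open>- 1\<close>.\<close>

lemma coxeter_factorisations_eq:
  "{p. \<exists>c. coxeter_element n c \<and> p \<in> factorisations n c d T l m s} =
   {p \<in> typed_lists n (map T [0..<d]) \<times> blocks_class n k (map (\<lambda>i. (m i, s i)) [0..<l]). conn {1..int n} (pair_edges n p)}"
  (is "?L = ?R")
proof -
  have ss_iff: "ss \<in> typed_lists n (map T [0..<d]) \<longleftrightarrow> length ss = d \<and> (\<forall>i<d. has_comb_type n (ss ! i) (T i))" for ss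
    unfolding typed_lists_def by (auto simp: list_all2_conv_all_nth)
  have ts_iff: "tss \<in> blocks_class n k (map (\<lambda>i. (m i, s i)) [0..<l]) \<longleftrightarrow>
      length tss = l \<and> (\<forall>i<l. length (tss ! i) = m i \<and> set (tss ! i) \<subseteq> W_B n \<and>
        (\<Sum>t\<leftarrow>tss ! i. abs_rank n t + num_B_of n t) = s i) \<and> (\<Sum>t\<leftarrow>concat tss. num_B_of n t) = k" for tss
    unfolding blocks_class_def sum_list_concat_map by (auto simp: list_all2_conv_all_nth)
  have ss_sums: "set ss \<subseteq> W_B n" "(\<Sum>w\<leftarrow>ss. abs_rank n w) = (\<Sum>i<d. A_rank (T i))"
    "(\<Sum>w\<leftarrow>ss. num_B_of n w) = (\<Sum>i<d. num_B (T i))"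
    if ss: "length ss = d" "\<forall>i<d. has_comb_type n (ss ! i) (T i)" for ss
  proof -
    show "set ss \<subseteq> W_B n"
    proof
      fix w assume "w \<in> set ss"
      then obtain i where i: "i < length ss" "ss ! i = w" unfolding in_set_conv_nth by (elim exE conjE)
      then have "has_comb_type n w (T i)" using ss by metis
      then show "w \<in> W_B n" by (rule has_comb_type_W_B)
    qed
    show "(\<Sum>w\<leftarrow>ss. abs_rank n w) = (\<Sum>i<d. A_rank (T i))"
      using that abs_rank_type by (auto simp: sum_list_sum_nth atLeast0LessThan intro!: sum.cong)
    show "(\<Sum>w\<leftarrow>ss. num_B_of n w) = (\<Sum>i<d. num_B (T i))"
      using that num_B_of_type by (auto simp: sum_list_sum_nth atLeast0LessThan intro!: sum.cong)
  qed
  have concat_sub: "set (concat tss) \<subseteq> W_B n" if "length tss = l" "\<forall>i<l. set (tss ! i) \<subseteq> W_B n" for tss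
    using that by (fastforce simp: in_set_conv_nth)
  have block_sum: "(\<Sum>t\<leftarrow>concat tss. f t) = (\<Sum>i<l. s i)"
    if "length tss = l" "\<forall>i<l. (\<Sum>t\<leftarrow>tss ! i. f t) = s i" for tss and f :: "(int \<Rightarrow> int) \<Rightarrow> nat"
    unfolding sum_list_concat_map using that by (simp add: sum_list_sum_nth atLeast0LessThan)
  show ?thesis
  proof (intro set_eqI iffI)
    fix p assume "p \<in> ?L"
    then obtain ss tss where p: "p = (ss, tss)" and len: "length ss = d" "length tss = l"
      and ty: "\<forall>i<d. has_comb_type n (ss ! i) (T i)"
      and ts: "\<forall>i<l. length (tss ! i) = m i \<and> set (tss ! i) \<subseteq> W_B n"
        "\<forall>i<l. (\<Sum>t\<leftarrow>tss ! i. absolute_length n t) = s i"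
      and cox: "coxeter_element n (perm_prod (ss @ concat tss))"
      unfolding factorisations_def by auto
    let ?zs = "ss @ concat tss"
    note sums = ss_sums[OF len(1) ty]
    have cW: "set (concat tss) \<subseteq> W_B n" using concat_sub len(2) ts(1) by blast
    then have zW: "set ?zs \<subseteq> W_B n" using sums(1) by simp
    have tl: "(\<Sum>t\<leftarrow>concat tss. absolute_length n t) = (\<Sum>i<l. s i)" by (rule block_sum[OF len(2) ts(2)])
    have full: "conn {1..int n} (edges n (perm_prod ?zs))" "sign (perm_prod ?zs) = - 1"
      using cox type_B_full_iff[OF n] coxeter_element_iff[OF n] by auto
    have c: "conn {1..int n} (edges_list n ?zs)" by (rule conn_edges_list_of_prod[OF zW n full(1)])
    have "n \<le> 1 + (\<Sum>w\<leftarrow>?zs. abs_rank n w)" by (rule sum_abs_rank_ge[OF zW n c])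
    then have le: "(\<Sum>t\<leftarrow>concat tss. absolute_length n t) \<le> (\<Sum>t\<leftarrow>concat tss. abs_rank n t) + k"
      using sum_A_rank tl sums(2) by simp
    have "odd (\<Sum>z\<leftarrow>?zs. num_B_of n z)"
      using full(2) unfolding sign_perm_prod_num_B[OF zW]
      by (cases "even (\<Sum>z\<leftarrow>?zs. num_B_of n z)") (simp_all only: neg_one_even_power, simp)
    then have odd: "odd ((\<Sum>i<d. num_B (T i)) + (\<Sum>t\<leftarrow>concat tss. num_B_of n t))" using sums(3) by simp
    have nB: "(\<Sum>t\<leftarrow>concat tss. num_B_of n t) = k"
    proof (cases "k = 0")
      case True
      then have "\<forall>t\<in>set (concat tss). num_B_of n t = 0" using tight_lengths_0[OF cW] le by simp
      then show ?thesis using True by (simp del: set_concat)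
    next
      case False
      then have "k = 1" "(\<Sum>i<d. num_B (T i)) = 0" using k by linarith+
      then show ?thesis using tight_lengths_1[OF cW] le odd by simp
    qed
    \<comment> \<open>With at most one \<open>B\<close> cycle in each factor, absolute length is
      rank plus number of \<open>B\<close> cycles, which turns the length condition into the one of
      \<open>blocks_class\<close>.\<close>
    have one: "num_B_of n t \<le> 1" if "t \<in> set (concat tss)" for t
      using member_le_sum_list[of "num_B_of n t" "map (num_B_of n) (concat tss)"] that nB k(1) by simp
    have "absolute_length n t = abs_rank n t + num_B_of n t" if "t \<in> set (concat tss)" for t
      using absolute_length_W_B(4) one[OF that] cW that by blast
    then have "(\<Sum>t\<leftarrow>tss ! i. abs_rank n t + num_B_of n t) = s i" if "i < l" for i
    proof -
      have "map (\<lambda>t. abs_rank n t + num_B_of n t) (tss ! i) = map (absolute_length n) (tss ! i)"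
        using that len(2) \<open>\<And>t. t \<in> set (concat tss) \<Longrightarrow> absolute_length n t = abs_rank n t + num_B_of n t\<close>
        by (intro map_cong refl) (metis nth_mem concat.simps UN_I set_concat)
      then show ?thesis using ts(2) that by metis
    qed
    then have "tss \<in> blocks_class n k (map (\<lambda>i. (m i, s i)) [0..<l])"
      unfolding ts_iff using len(2) ts(1) nB by blast
    moreover have "ss \<in> typed_lists n (map T [0..<d])" unfolding ss_iff using len(1) ty by blast
    ultimately show "p \<in> ?R" using c unfolding p pair_edges_eq[symmetric] by blast
  next
    fix p assume "p \<in> ?R"
    then obtain ss tss where p: "p = (ss, tss)" and ss: "length ss = d" "\<forall>i<d. has_comb_type n (ss ! i) (T i)"
      and tss: "length tss = l" "\<forall>i<l. length (tss ! i) = m i \<and> set (tss ! i) \<subseteq> W_B n \<and>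
        (\<Sum>t\<leftarrow>tss ! i. abs_rank n t + num_B_of n t) = s i" "(\<Sum>t\<leftarrow>concat tss. num_B_of n t) = k"
      and c: "conn {1..int n} (edges_list n (ss @ concat tss))"
      using ss_iff ts_iff pair_edges_eq by auto
    let ?zs = "ss @ concat tss"
    note sums = ss_sums[OF ss]
    have cW: "set (concat tss) \<subseteq> W_B n" using concat_sub tss(1,2) by blast
    then have zW: "set ?zs \<subseteq> W_B n" using sums(1) by simp
    have "(\<Sum>t\<leftarrow>concat tss. abs_rank n t + num_B_of n t) = (\<Sum>i<l. s i)"
      by (rule block_sum[OF tss(1)]) (use tss(2) in blast)
    then have "(\<Sum>t\<leftarrow>concat tss. abs_rank n t) + k = (\<Sum>i<l. s i)" using tss(3) by (simp add: sum_list_addf)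
    then have "n = 1 + (\<Sum>w\<leftarrow>?zs. abs_rank n w)" using sum_A_rank sums(2) by simp
    then have cp: "conn {1..int n} (edges n (perm_prod ?zs))" by (rule conn_edges_prod[OF zW n c])
    have "(\<Sum>z\<leftarrow>?zs. num_B_of n z) = 1" using sums(3) tss(3) k by simp
    then have "sign (perm_prod ?zs) = - 1" using sign_perm_prod_num_B[OF zW] by simp
    then have cox: "coxeter_element n (perm_prod ?zs)"
      using cp W_B_perm_prod[OF zW] type_B_full_iff[OF n] coxeter_element_iff[OF n] by blast
    have one: "num_B_of n t \<le> 1" if "t \<in> set (concat tss)" for t
      using member_le_sum_list[of "num_B_of n t" "map (num_B_of n) (concat tss)"] that tss(3) k(1) by simp
    have al: "absolute_length n t = abs_rank n t + num_B_of n t" if "t \<in> set (concat tss)" for t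
      using absolute_length_W_B(4) one[OF that] cW that by blast
    have "(\<Sum>t\<leftarrow>tss ! i. absolute_length n t) = s i" if i: "i < l" for i
    proof -
      have "map (\<lambda>t. abs_rank n t + num_B_of n t) (tss ! i) = map (absolute_length n) (tss ! i)"
        using i tss(1) al by (intro map_cong refl) (metis nth_mem UN_I set_concat)
      then show ?thesis using tss(2) i by metis
    qed
    then have "(ss, tss) \<in> factorisations n (perm_prod ?zs) d T l m s"
      unfolding factorisations_def using ss tss sums(1) by simp
    then show "p \<in> ?L" using cox p by blast
  qed
qed

text \<open>The connecting count treats all Coxeter elements together; as they have equally many
  factorisations, it is divided by their number.\<close>

lemma card_factorisations_eq:
  assumes c: "coxeter_element n c"
    and g: "good n (pair_edges n) (typed_lists n (map T [0..<d]) \<times> blocks_class n k (map (\<lambda>i. (m i, s i)) [0..<l])) (n - 1) q"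
  shows "real (card (factorisations n c d T l m s)) = q / real n"
proof -
  let ?C = "{c. coxeter_element n c}"
  have "{p. \<exists>c. coxeter_element n c \<and> p \<in> factorisations n c d T l m s} = (\<Union>c\<in>?C. factorisations n c d T l m s)" by blast
  moreover have "card (\<Union>c\<in>?C. factorisations n c d T l m s) = (\<Sum>c\<in>?C. card (factorisations n c d T l m s))"
    using card_coxeter(1)[OF n] finite_factorisations
    by (intro card_UN_disjoint) (auto simp: factorisations_def)
  moreover have "\<dots> = (\<Sum>c'\<in>?C. card (factorisations n c d T l m s))"
    using card_factorisations_coxeter[OF _ c] by (intro sum.cong) auto
  ultimately have "real (card {p. \<exists>c. coxeter_element n c \<and> p \<in> factorisations n c d T l m s}) =
      real (card ?C) * real (card (factorisations n c d T l m s))" by simp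
  also have "\<dots> = 2 ^ (n - 1) * fact (n - 1) * real (card (factorisations n c d T l m s))"
    using card_coxeter(2)[OF n] by simp
  finally have "2 ^ (n - 1) * fact (n - 1) * real (card (factorisations n c d T l m s)) = 2 ^ (n - 1) * fact (n - 1) * (q / real n)"
    unfolding coxeter_factorisations_eq using good_card_conn[OF n g] by simp
  moreover have "(2 :: real) ^ (n - 1) * fact (n - 1) \<noteq> 0" by simp
  ultimately show ?thesis using mult_left_cancel by blast
qed

end

section \<open>Weights of the types in the theorem\<close>

lemma A_type_elem: "C \<in># A_type n a \<Longrightarrow> \<exists>j\<in>{1..n}. C = TypeA j"
  unfolding A_type_def by (auto simp: set_mset_sum split: if_splits)

lemma count_A_type: "j \<in> {1..n} \<Longrightarrow> count (A_type n a) (TypeA j) = a j"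
proof -
  assume j: "j \<in> {1..n}"
  have "count (A_type n a) (TypeA j) = (\<Sum>i = 1..n. if i = j then a i else 0)"
    unfolding A_type_def count_sum by (rule sum.cong) auto
  then show ?thesis using j by simp
qed

lemma size_A_type: "size (A_type n a) = (\<Sum>j = 1..n. a j)"
  unfolding A_type_def by (simp add: size_multiset_sum)

lemma num_B_A_type: "num_B (A_type n a) = 0"
proof -
  have "filter_mset (\<lambda>C. comp_sgn C = - 1) (A_type n a) = filter_mset (\<lambda>_. False) (A_type n a)"
    by (rule filter_mset_cong) (use A_type_elem in force)+
  then show ?thesis by (simp add: num_B_def)
qed

lemma proper_A_type: "C \<in># A_type n a \<Longrightarrow> proper_comp C"
  using A_type_elem by fastforce

lemma prod_fact_count_A_type:
  "(\<Prod>C\<in>set_mset (A_type n a). fact (count (A_type n a) C)) = (\<Prod>j = 1..n. fact (a j) :: real)"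
proof -
  have "(\<Prod>C\<in>set_mset (A_type n a). fact (count (A_type n a) C)) =
      (\<Prod>C\<in>TypeA ` {1..n}. fact (count (A_type n a) C) :: real)"
  proof (rule prod.mono_neutral_left)
    show "set_mset (A_type n a) \<subseteq> TypeA ` {1..n}" using A_type_elem by blast
  qed (auto simp: not_in_iff)
  also have "\<dots> = (\<Prod>j\<in>{1..n}. fact (count (A_type n a) (TypeA j)))"
    by (rule prod.reindex_cong[of TypeA]) (auto simp: inj_on_def)
  also have "\<dots> = (\<Prod>j = 1..n. fact (a j))" by (rule prod.cong) (auto simp: count_A_type)
  finally show ?thesis .
qed

text \<open>For \<open>b = n - rk T\<close> the leading factorial is \<open>fact (b - 1)\<close>,
  that is \<open>fact b / b\<close>; this is the origin of the denominators in the formula.\<close>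

lemma type_weight_A:
  assumes n: "n \<ge> 1" and r: "rk (A_type n a) \<le> n"
  shows "type_weight n (A_type n a) = real n * (1 / real (n - rk (A_type n a)) * multinom (n - rk (A_type n a)) n a)"
proof -
  let ?T = "A_type n a"
  have pr: "\<forall>C\<in>#?T. proper_comp C" using proper_A_type by blast
  have rk: "rk ?T = A_rank ?T" using rk_eq_A_rank[OF pr] num_B_A_type by simp
  have tl: "total_len ?T = rk ?T + (\<Sum>j = 1..n. a j)" using total_len_eq[OF pr] rk size_A_type by simp
  show ?thesis
  \<comment> \<open>For \<open>rk ?T = n\<close> the right side is zero because
    \<open>1 / 0 = 0\<close>, and the left side is zero because the cycles do not fit into
    \<open>n\<close> points.\<close>
  proof (cases "rk ?T = n")
    case True
    have "?T \<noteq> {#}"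
    proof
      assume "?T = {#}"
      then show False using True n by (simp add: rk_def)
    qed
    then have "size ?T > 0" by (simp add: nonempty_has_size)
    then have "\<not> total_len ?T \<le> n" using tl True size_A_type[of n a] by linarith
    then show ?thesis using True by (simp add: type_weight_def)
  next
    case False
    define b where "b = n - rk ?T"
    have b: "b \<ge> 1" "n - 1 - A_rank ?T = b - 1" "total_len ?T \<le> n \<longleftrightarrow> (\<Sum>j = 1..n. a j) \<le> b"
      "n - total_len ?T = b - (\<Sum>j = 1..n. a j)"
      using False r rk tl unfolding b_def by auto
    have "fact b = real b * fact (b - 1)" using b(1) by (simp add: fact_reduce)
    then show ?thesis
      using b(1) unfolding type_weight_def multinom_def prod_fact_count_A_type b b_def[symmetric]
      by (simp add: mult_ac)
  qed
qed

text \<open>The \<open>B\<close> cycle lifts the rank one above \<open>A_rank T\<close>, so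
  \<open>n - 1 - A_rank T\<close> is \<open>n - rk T\<close> itself and no denominator
  appears.\<close>

lemma type_weight_B:
  assumes n: "n \<ge> 1" and \<alpha>: "\<alpha> \<ge> 1" and T: "T = {#TypeB \<alpha>#} + A_type n a" and r: "rk T \<le> n"
  shows "type_weight n T = real n * multinom (n - rk T) n a"
proof -
  have pr: "\<forall>C\<in>#T. proper_comp C" using proper_A_type \<alpha> unfolding T by auto
  have nb: "TypeB \<alpha> \<notin># A_type n a" using A_type_elem by blast
  have rk: "rk T = Suc (A_rank T)" using rk_eq_A_rank[OF pr] num_B_A_type unfolding T by simp
  have tl: "total_len T = rk T + (\<Sum>j = 1..n. a j)"
    using total_len_eq[OF pr] rk size_A_type[of n a] unfolding T by simp
  have "(\<Prod>C\<in>set_mset T. fact (count T C)) = fact (count T (TypeB \<alpha>)) * (\<Prod>C\<in>set_mset (A_type n a). fact (count T C) :: real)"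
    unfolding T using nb by simp
  also have "count T (TypeB \<alpha>) = 1" using nb unfolding T by (simp add: not_in_iff)
  also have "(\<Prod>C\<in>set_mset (A_type n a). fact (count T C)) = (\<Prod>C\<in>set_mset (A_type n a). fact (count (A_type n a) C) :: real)"
    using nb unfolding T by (intro prod.cong) auto
  finally have p: "(\<Prod>C\<in>set_mset T. fact (count T C)) = (\<Prod>j = 1..n. fact (a j) :: real)"
    using prod_fact_count_A_type by simp
  have b: "n - 1 - A_rank T = n - rk T" "total_len T \<le> n \<longleftrightarrow> (\<Sum>j = 1..n. a j) \<le> n - rk T"
    "n - total_len T = n - rk T - (\<Sum>j = 1..n. a j)"
    using r rk tl by auto
  show ?thesis unfolding type_weight_def multinom_def p b by (simp add: mult_ac)
qed

lemma prod_list_upt: "prod_list (map f [0..<l]) = (\<Prod>i<l. f i :: real)"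
  by (induction l) (auto simp: mult.commute)

theorem theorem9:
  fixes n d l :: nat and c :: "int \<Rightarrow> int"
    and a :: "nat \<Rightarrow> nat \<Rightarrow> nat" and m s :: "nat \<Rightarrow> nat"
  assumes "n \<ge> 1" and "coxeter_element n c" and "d \<ge> 1"
  shows
    "(\<forall>T j \<alpha>. j < d \<and> \<alpha> \<ge> 1 \<and>
        (\<forall>i<d. i \<noteq> j \<longrightarrow> T i = A_type n (a i)) \<and>
        T j = {#TypeB \<alpha>#} + A_type n (a j) \<and>
        (\<Sum>i<d. rk (T i)) + (\<Sum>i<l. s i) = n \<longrightarrow>
        real (card (factorisations n c d T l m s)) =
          real n ^ (d - 1) * multinom (n - rk (T j)) n (a j) *
          (\<Prod>i\<in>{..<d} - {j}. 1 / real (n - rk (T i)) * multinom (n - rk (T i)) n (a i)) *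
          (\<Prod>i<l. real ((m i * n) choose (s i))))
     \<and>
     (\<forall>T. (\<forall>i<d. T i = A_type n (a i)) \<and>
        (\<Sum>i<d. rk (T i)) + (\<Sum>i<l. s i) = n \<longrightarrow>
        real (card (factorisations n c d T l m s)) =
          real n ^ (d - 1) * real (n - (\<Sum>i<d. rk (T i))) *
          (\<Prod>i<d. 1 / real (n - rk (T i)) * multinom (n - rk (T i)) n (a i)) *
          (\<Prod>i<l. real ((m i * n) choose (s i))))"
proof (intro conjI allI impI; (elim conjE)?)
  let ?ps = "map (\<lambda>i. (m i, s i)) [0..<l]"
  let ?P = "\<Prod>i<l. real ((m i * n) choose (s i))"
  have psS: "(\<Sum>p\<leftarrow>?ps. snd p) = (\<Sum>i<l. s i)"
    by (simp add: o_def interv_sum_list_conv_sum_set_nat atLeast0LessThan)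
  have psP: "(\<Prod>p\<leftarrow>?ps. real (fst p * n choose snd p)) = ?P"
    by (simp add: o_def prod_list_upt)
  have Tsum: "(\<Sum>T\<leftarrow>map T [0..<d]. A_rank T) = (\<Sum>i<d. A_rank (T i))" for T
    by (simp add: o_def interv_sum_list_conv_sum_set_nat atLeast0LessThan)
  have Tprod: "(\<Prod>T\<leftarrow>map T [0..<d]. type_weight n T) = (\<Prod>i<d. type_weight n (T i))" for T
    by (simp add: o_def prod_list_upt)
  {
    fix T j \<alpha>
    assume j: "j < d" and \<alpha>: "1 \<le> \<alpha>" and TA: "\<forall>i<d. i \<noteq> j \<longrightarrow> T i = A_type n (a i)"
      and TB: "T j = {#TypeB \<alpha>#} + A_type n (a j)" and rank: "(\<Sum>i<d. rk (T i)) + (\<Sum>i<l. s i) = n"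
    have proper: "\<forall>i<d. \<forall>C\<in>#T i. proper_comp C"
    proof (intro allI impI)
      fix i assume "i < d"
      then show "\<forall>C\<in>#T i. proper_comp C" using TA TB \<alpha> proper_A_type by (cases "i = j") auto
    qed
    \<comment> \<open>The \<open>B\<close> component of \<open>T j\<close> is the only one allowed,
      so the blocks have to be free of \<open>B\<close> cycles: \<open>k = 0\<close>.\<close>
    have nB: "(\<Sum>i<d. num_B (T i)) + 0 = 1"
    proof -
      have "(\<Sum>i<d. num_B (T i)) = num_B (T j) + (\<Sum>i\<in>{..<d} - {j}. num_B (T i))"
        using j by (intro sum.remove) auto
      also have "(\<Sum>i\<in>{..<d} - {j}. num_B (T i)) = 0" using TA num_B_A_type by simp
      finally show ?thesis using TB num_B_A_type by simp
    qed
    note r = sum_A_rank[OF assms(1) proper _ nB rank]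
    have rk_le: "rk (T i) \<le> n" if "i < d" for i
      using member_le_sum[of i "{..<d}" "\<lambda>i. rk (T i)"] that rank by simp
    have "good n (pair_edges n) (typed_lists n (map T [0..<d]) \<times> blocks_class n 0 ?ps)
        ((\<Sum>T\<leftarrow>map T [0..<d]. A_rank T) + (\<Sum>p\<leftarrow>?ps. snd p))
        ((\<Prod>T\<leftarrow>map T [0..<d]. type_weight n T) * (\<Prod>p\<leftarrow>?ps. real (fst p * n choose snd p)))"
      unfolding pair_edges_def
      by (rule good_Times[OF assms(1) good_typed_lists[OF assms(1)] good_blocks_class_0[OF assms(1)]]) (use proper in auto)
    moreover have "(\<Sum>T\<leftarrow>map T [0..<d]. A_rank T) + (\<Sum>p\<leftarrow>?ps. snd p) = n - 1" unfolding Tsum psS using r by simp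
    ultimately have "real (card (factorisations n c d T l m s)) = ((\<Prod>i<d. type_weight n (T i)) * ?P) / real n"
      using card_factorisations_eq[OF assms(1) proper _ nB rank assms(2)] unfolding Tprod psP by simp
    also have "(\<Prod>i<d. type_weight n (T i)) = type_weight n (T j) * (\<Prod>i\<in>{..<d} - {j}. type_weight n (T i))"
      using j by (intro prod.remove) auto
    also have "type_weight n (T j) = real n * multinom (n - rk (T j)) n (a j)"
      by (rule type_weight_B[OF assms(1) \<alpha> TB rk_le[OF j]])
    also have "(\<Prod>i\<in>{..<d} - {j}. type_weight n (T i)) =
        (\<Prod>i\<in>{..<d} - {j}. real n * (1 / real (n - rk (T i)) * multinom (n - rk (T i)) n (a i)))"
    proof (rule prod.cong[OF refl])
      fix i assume "i \<in> {..<d} - {j}"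
      then have T: "T i = A_type n (a i)" and "rk (T i) \<le> n" using TA rk_le by blast+
      then show "type_weight n (T i) = real n * (1 / real (n - rk (T i)) * multinom (n - rk (T i)) n (a i))"
        using type_weight_A[OF assms(1), of "a i"] unfolding T by simp
    qed
    \<comment> \<open>One \<open>n\<close> for each type other than \<open>T j\<close>; the
      \<open>n\<close> from \<open>T j\<close> cancels against the division by
      \<open>n\<close>.\<close>
    also have "\<dots> = real n ^ (d - 1) * (\<Prod>i\<in>{..<d} - {j}. 1 / real (n - rk (T i)) * multinom (n - rk (T i)) n (a i))"
      unfolding prod.distrib[of "\<lambda>_. real n"] using j by simp
    finally show "real (card (factorisations n c d T l m s)) =
          real n ^ (d - 1) * multinom (n - rk (T j)) n (a j) *
          (\<Prod>i\<in>{..<d} - {j}. 1 / real (n - rk (T i)) * multinom (n - rk (T i)) n (a i)) * ?P"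
      using assms(1) by simp
  }
  {
    fix T
    assume TA: "\<forall>i<d. T i = A_type n (a i)" and rank: "(\<Sum>i<d. rk (T i)) + (\<Sum>i<l. s i) = n"
    have proper: "\<forall>i<d. \<forall>C\<in>#T i. proper_comp C" using TA proper_A_type by auto
    \<comment> \<open>No prescribed type has a \<open>B\<close> component, so exactly one
      \<open>B\<close> cycle must occur in the blocks: \<open>k = 1\<close>.\<close>
    have nB: "(\<Sum>i<d. num_B (T i)) + 1 = 1" using TA num_B_A_type by simp
    note r = sum_A_rank[OF assms(1) proper _ nB rank]
    let ?S = "\<Sum>i<l. s i"
    have rk_le: "rk (T i) \<le> n" if "i < d" for i
      using member_le_sum[of i "{..<d}" "\<lambda>i. rk (T i)"] that rank by simp
    let ?X = "typed_lists n (map T [0..<d])" and ?Y = "blocks_class n 1 ?ps"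
    have gX: "good n (edges_list n) ?X (\<Sum>i<d. A_rank (T i)) (\<Prod>i<d. type_weight n (T i))"
      using good_typed_lists[OF assms(1), of "map T [0..<d]"] proper unfolding Tsum Tprod by auto
    have gY: "good1 n (edges_lists n) ?Y ?S (real ?S * ?P)"
      using good1_blocks_class_1[OF assms(1), of ?ps] unfolding psS psP .
    have "good n (pair_edges n) (?X \<times> ?Y) (n - 1) ((\<Prod>i<d. type_weight n (T i)) * (real ?S * ?P))"
    \<comment> \<open>Without any length to spend there is no room for the \<open>B\<close> cycle;
      both the family and the factor \<open>?S\<close> vanish.\<close>
    proof (cases "?S = 0")
      case True
      then have "?Y = {}" using gY unfolding good1_def by simp
      then show ?thesis using True good_empty by simp
    next
      case False
      then have "good n (edges_lists n) ?Y (?S - 1) (real ?S * ?P)" using gY unfolding good1_def by (simp only: if_False)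
      from good_Times[OF assms(1) gX this]
      have "good n (pair_edges n) (?X \<times> ?Y) ((\<Sum>i<d. A_rank (T i)) + (?S - 1)) ((\<Prod>i<d. type_weight n (T i)) * (real ?S * ?P))"
        unfolding pair_edges_def .
      moreover have "(\<Sum>i<d. A_rank (T i)) + (?S - 1) = n - 1" using r False by linarith
      ultimately show ?thesis by simp
    qed
    then have "real (card (factorisations n c d T l m s)) = ((\<Prod>i<d. type_weight n (T i)) * (real ?S * ?P)) / real n"
      using card_factorisations_eq[OF assms(1) proper _ nB rank assms(2)] by simp
    also have "(\<Prod>i<d. type_weight n (T i)) =
        (\<Prod>i<d. real n * (1 / real (n - rk (T i)) * multinom (n - rk (T i)) n (a i)))"
      using type_weight_A[OF assms(1)] TA rk_le by (intro prod.cong) auto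
    also have "\<dots> = real n ^ d * (\<Prod>i<d. 1 / real (n - rk (T i)) * multinom (n - rk (T i)) n (a i))"
      unfolding prod.distrib[of "\<lambda>_. real n"] by simp
    also have "real n ^ d = real n * real n ^ (d - 1)" using assms(3) by (cases d) auto
    \<comment> \<open>By the rank condition the coefficient collected by the product rule is the
      factor of (ii) that subtracts all ranks from \<open>n\<close>.\<close>
    also have "?S = n - (\<Sum>i<d. rk (T i))" using rank by simp
    finally show "real (card (factorisations n c d T l m s)) =
          real n ^ (d - 1) * real (n - (\<Sum>i<d. rk (T i))) *
          (\<Prod>i<d. 1 / real (n - rk (T i)) * multinom (n - rk (T i)) n (a i)) * ?P"
      using assms(1) by simp
  }
qed

end
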